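(* Let $g\in\mathcal G$ be conjugate to a reduced word of the form $f_1^{-1}\cdots f_m^{-1}\,\tilde r_1\,f_m\cdots f_1\,\tilde r_0$, where $\tilde r_0,\tilde r_1$ are involutions, each affine or elementary. Then $g$ is conjugate in $\mathcal G$ to a cyclically-reduced map of one of the following forms (for some $m'\ge 0$): (N_aa) $(h_1^{-1}\cdots h_{m'}^{-1})\,t\,(h_{m'}\cdots h_1)\,t$, if $\tilde r_0$ and $\tilde r_1$ are both affine; (N_ea) $(h_1^{-1}\cdots h_{m'}^{-1})\,e_{m'+1}\,(h_{m'}\cdots h_1)\,t$, if one of $\tilde r_0,\tilde r_1$ is affine and the other elementary; (N_ee) $(t\,h_1^{-1}\cdots h_{m'}^{-1})\,e_{m'+1}\,(h_{m'}\cdots h_1\,t)\,e_0$, if $\tilde r_0$ and $\tilde r_1$ are both elementary; where each $h_i$ is a generalized H\'enon transformation and $e_0,e_{m'+1}$ are elementary involutions. Furthermore one may require that the H\'enon transformations $h_i=t\,e_i$ ($i=1,\dots,m'$) be normal and that the involutions $e_0,e_{m'+1}$ be in the normal forms for elementary involutions; with these requirements the resulting composition is unique up to a finite number of choices.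
   Context: $\mathcal G$ is the group of polynomial automorphisms of $\mathbb C^2$; $\mathcal E$ the elementary maps $(x,y)\mapsto(\alpha x+p(y),\beta y+\eta)$, $\alpha\beta\ne0$; $\mathcal A$ the affine automorphisms; $\mathcal S=\mathcal A\cap\mathcal E$; $t(x,y)=(y,x)$. A reduced word is $g_k\cdots g_1$ with $g_i\in(\mathcal E\cup\mathcal A)\setminus\mathcal S$ and consecutive factors in different subgroups $\mathcal A$, $\mathcal E$; it is cyclically reduced if moreover $k\ge2$ and $g_k,g_1$ are not in the same subgroup (or trivially if the map is in $\mathcal A\cup\mathcal E$). A generalized H\'enon transformation is $h(x,y)=(y,p(y)-\delta x)$, $\delta\ne0$, $\deg p\ge2$, so $h=t\,e$ with $e$ elementary; it is normal if $p(y)=y^l+O(y^{l-2})$. Normal forms of elementary involutions (of degree $l\ge2$): $(x,y)\mapsto(-x+p(y),y)$ with $p(y)=y^l+O(y^{l-2})$; $(x,y)\mapsto(x+p(y),-y)$ with $p$ odd with leading coefficient $1$; $(x,y)\mapsto(-x+p(y),-y)$ with $p$ even with leading coefficient $1$. *)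

theory Defs
  imports Complex_Main "HOL-Computational_Algebra.Polynomial"
begin

type_synonym pmap = "complex \<times> complex \<Rightarrow> complex \<times> complex"

definition poly2 :: "(complex \<times> complex \<Rightarrow> complex) \<Rightarrow> bool" where
  "poly2 f \<longleftrightarrow> (\<exists>(c::nat \<Rightarrow> nat \<Rightarrow> complex) N. \<forall>x y.
      f (x, y) = (\<Sum>i\<le>N. \<Sum>j\<le>N. c i j * x ^ i * y ^ j))"

definition poly_map :: "pmap \<Rightarrow> bool" where
  "poly_map F \<longleftrightarrow> poly2 (fst \<circ> F) \<and> poly2 (snd \<circ> F)"

definition poly_aut :: "pmap \<Rightarrow> bool" where
  "poly_aut F \<longleftrightarrow> bij F \<and> poly_map F \<and> poly_map (inv F)"

definition elementary :: "pmap \<Rightarrow> bool" where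
  "elementary F \<longleftrightarrow> (\<exists>\<alpha> \<beta> \<eta> (p::complex poly). \<alpha> \<noteq> 0 \<and> \<beta> \<noteq> 0 \<and>
      F = (\<lambda>(x, y). (\<alpha> * x + poly p y, \<beta> * y + \<eta>)))"

definition affine_aut :: "pmap \<Rightarrow> bool" where
  "affine_aut F \<longleftrightarrow> (\<exists>a b c d u v. a * d - b * c \<noteq> 0 \<and>
      F = (\<lambda>(x, y). (a * x + b * y + u, c * x + d * y + v)))"

definition tswap :: pmap where
  "tswap = (\<lambda>(x, y). (y, x))"

definition word_map :: "pmap list \<Rightarrow> pmap" where
  "word_map ws = foldr (\<circ>) ws id"

definition in_AE_minus_S :: "pmap \<Rightarrow> bool" where
  "in_AE_minus_S g \<longleftrightarrow> (affine_aut g \<or> elementary g) \<and> \<not> (affine_aut g \<and> elementary g)"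

definition diff_subgroups :: "pmap \<Rightarrow> pmap \<Rightarrow> bool" where
  "diff_subgroups g h \<longleftrightarrow> \<not> (affine_aut g \<and> affine_aut h) \<and> \<not> (elementary g \<and> elementary h)"

definition reduced_word :: "pmap list \<Rightarrow> bool" where
  "reduced_word ws \<longleftrightarrow> ws \<noteq> [] \<and> (\<forall>g\<in>set ws. in_AE_minus_S g) \<and>
      (\<forall>i. Suc i < length ws \<longrightarrow> diff_subgroups (ws ! i) (ws ! Suc i))"

definition cyclically_reduced_word :: "pmap list \<Rightarrow> bool" where
  "cyclically_reduced_word ws \<longleftrightarrow> reduced_word ws \<and> length ws \<ge> 2 \<and>
      diff_subgroups (hd ws) (last ws)"

definition cyc_reduced_map :: "pmap \<Rightarrow> bool" where
  "cyc_reduced_map F \<longleftrightarrow> affine_aut F \<or> elementary F \<or>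
      (\<exists>ws. cyclically_reduced_word ws \<and> F = word_map ws)"

definition conj_in_G :: "pmap \<Rightarrow> pmap \<Rightarrow> bool" where
  "conj_in_G g F \<longleftrightarrow> (\<exists>\<phi>. poly_aut \<phi> \<and> g = \<phi> \<circ> F \<circ> inv \<phi>)"

definition involution :: "pmap \<Rightarrow> bool" where
  "involution r \<longleftrightarrow> r \<circ> r = id"

definition henon :: "pmap \<Rightarrow> bool" where
  "henon h \<longleftrightarrow> (\<exists>(p::complex poly) \<delta>. \<delta> \<noteq> 0 \<and> degree p \<ge> 2 \<and>
      h = (\<lambda>(x, y). (y, poly p y - \<delta> * x)))"

definition normal_henon :: "pmap \<Rightarrow> bool" where
  "normal_henon h \<longleftrightarrow> (\<exists>(p::complex poly) \<delta>. \<delta> \<noteq> 0 \<and> degree p \<ge> 2 \<and>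
      lead_coeff p = 1 \<and> coeff p (degree p - 1) = 0 \<and>
      h = (\<lambda>(x, y). (y, poly p y - \<delta> * x)))"

definition elem_involution :: "pmap \<Rightarrow> bool" where
  "elem_involution e \<longleftrightarrow> elementary e \<and> involution e"

definition normal_elem_involution :: "pmap \<Rightarrow> bool" where
  "normal_elem_involution e \<longleftrightarrow> (\<exists>p::complex poly. degree p \<ge> 2 \<and> lead_coeff p = 1 \<and>
     ((coeff p (degree p - 1) = 0 \<and> e = (\<lambda>(x, y). (- x + poly p y, y))) \<or>
      ((\<forall>i. even i \<longrightarrow> coeff p i = 0) \<and> e = (\<lambda>(x, y). (x + poly p y, - y))) \<or>
      ((\<forall>i. odd i \<longrightarrow> coeff p i = 0) \<and> e = (\<lambda>(x, y). (- x + poly p y, - y)))))"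

definition form_aa :: "pmap list \<Rightarrow> pmap" where
  "form_aa hs = word_map (map inv hs) \<circ> tswap \<circ> word_map (rev hs) \<circ> tswap"

definition form_ea :: "pmap list \<Rightarrow> pmap \<Rightarrow> pmap" where
  "form_ea hs e1 = word_map (map inv hs) \<circ> e1 \<circ> word_map (rev hs) \<circ> tswap"

definition form_ee :: "pmap list \<Rightarrow> pmap \<Rightarrow> pmap \<Rightarrow> pmap" where
  "form_ee hs e1 e0 = tswap \<circ> word_map (map inv hs) \<circ> e1 \<circ> word_map (rev hs) \<circ> tswap \<circ> e0"

end

theory Submission
  imports Defs
begin

text \<open>Up to conjugation by the swap \<open>t\<close>, each of the three forms is a composition of letters
  \<open>(x, y) \<mapsto> (e y + k, a x + p(y))\<close>, \<open>deg p \<ge> 2\<close>. For existence, the triangular maps in the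
  symmetric word are absorbed into its elementary factors and the resulting letters are normalised by
  diagonal affine maps.

  For finiteness no structure theorem for polynomial automorphisms is needed. The growth of degrees of
  polynomial curves under forward iteration is a height, and a polynomial conjugacy \<open>\<phi>\<close> between two words
  of letters multiplies it by a constant, because after composition with a long word every nonconstant
  polynomial is dominated by a power of \<open>y\<close>. Applied to horizontal and vertical lines, in both time
  directions and to both \<open>\<phi>\<close> and its inverse, this forces \<open>\<phi>\<close> to be diagonal and affine after a rotation
  of the word. Then the letters correspond to each other through diagonal maps, whose scalings satisfy
  power relations with finitely many solutions.\<close>

text \<open>The obstacle is that the conjugacy \<open>\<phi>\<close> is arbitrary: along a given
  curve its leading terms may cancel, so degrees of single curves say nothing about it. Asymptotic
  degrees avoid this. Every nonconstant curve becomes steep along its orbit, and once a steep curve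
  has been carried through enough further letters, the second component of \<open>\<phi>\<close>
  multiplies degrees by a fixed number; hence one constant \<open>C\<close> for all curves. Vertical
  lines have height 1 and horizontal lines height 1/d < 1, with d the degree of the letter applied
  first, so the height tells the two coordinate directions apart as soon as 1 \<le> C < d. Powers of
  the word raise \<open>C\<close>, rotations lower it; of the rotations only the multiset of letters
  is retained, which still leaves finitely many words. All three forms are treated together as words
  of normal letters from which the data of a form can be read off, so finiteness is proved once, for
  words. Squares of scalings occur because the letters of involutions carry signs.\<close>

section \<open>Polynomial maps, automorphisms and conjugacy\<close>

lemma poly2_iff:
  "poly2 f \<longleftrightarrow> (\<exists>P::complex poly poly. \<forall>x y. f (x, y) = poly (poly P [:y:]) x)"
proof
  assume "poly2 f"
  then obtain c N where c: "\<And>x y. f (x, y) = (\<Sum>i\<le>N. \<Sum>j\<le>N. c i j * x ^ i * y ^ j)"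
    unfolding poly2_def by blast
  have "f (x, y) = poly (poly (\<Sum>i\<le>N. \<Sum>j\<le>N. monom (monom (c i j) i) j) [:y:]) x" for x y
    by (simp add: c poly_sum poly_monom poly_power)
  then show "\<exists>P::complex poly poly. \<forall>x y. f (x, y) = poly (poly P [:y:]) x" by blast
next
  assume "\<exists>P::complex poly poly. \<forall>x y. f (x, y) = poly (poly P [:y:]) x"
  then obtain P :: "complex poly poly" where P: "\<And>x y. f (x, y) = poly (poly P [:y:]) x" by blast
  define N where "N = max (degree P) (Max ((\<lambda>j. degree (coeff P j)) ` {..degree P}))"
  have N1: "degree P \<le> N" by (simp add: N_def)
  have N2: "degree (coeff P j) \<le> N" for j
  proof (cases "j \<le> degree P")
    case True
    then have "degree (coeff P j) \<le> Max ((\<lambda>j. degree (coeff P j)) ` {..degree P})"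
      by (intro Max_ge) auto
    then show ?thesis by (simp add: N_def)
  qed (simp add: coeff_eq_0)
  have ev: "poly p z = (\<Sum>i\<le>N. coeff p i * z ^ i)" if "degree p \<le> N" for p :: "'a::comm_semiring_1 poly" and z
    unfolding poly_altdef using that
    by (intro sum.mono_neutral_left) (auto simp: coeff_eq_0)
  have "f (x, y) = (\<Sum>i\<le>N. \<Sum>j\<le>N. coeff (coeff P j) i * x ^ i * y ^ j)" for x y
  proof -
    have "f (x, y) = (\<Sum>j\<le>N. poly (coeff P j) x * y ^ j)"
      by (simp add: P ev[OF N1] poly_sum poly_power)
    also have "\<dots> = (\<Sum>j\<le>N. \<Sum>i\<le>N. coeff (coeff P j) i * x ^ i * y ^ j)"
      by (simp add: ev[OF N2] sum_distrib_right)
    also have "\<dots> = (\<Sum>i\<le>N. \<Sum>j\<le>N. coeff (coeff P j) i * x ^ i * y ^ j)"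
      by (rule sum.swap)
    finally show ?thesis .
  qed
  then show "poly2 f"
    unfolding poly2_def by (intro exI[of _ "\<lambda>i j. coeff (coeff P j) i"] exI[of _ N]) blast
qed

lemma poly2_const: "poly2 (\<lambda>_. k)"
  unfolding poly2_iff by (rule exI[of _ "[:[:k:]:]"]) simp

lemma poly2_fst: "poly2 fst"
  unfolding poly2_iff by (rule exI[of _ "[:[:0, 1:]:]"]) simp

lemma poly2_snd: "poly2 snd"
  unfolding poly2_iff by (rule exI[of _ "[:0, 1:]"]) simp

text \<open>In the nested form, with outer variable y and coefficients polynomials in x, closure is
  just the ring structure; the double sums would need a new bound \<open>N\<close> each
  time.\<close>

lemma poly2_add: "poly2 f \<Longrightarrow> poly2 g \<Longrightarrow> poly2 (\<lambda>z. f z + g z)"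
  unfolding poly2_iff by (elim exE, rule_tac x = "P + Pa" in exI) simp

lemma poly2_mult: "poly2 f \<Longrightarrow> poly2 g \<Longrightarrow> poly2 (\<lambda>z. f z * g z)"
  unfolding poly2_iff by (elim exE, rule_tac x = "P * Pa" in exI) simp

lemma poly2_power: "poly2 f \<Longrightarrow> poly2 (\<lambda>z. f z ^ n)"
  by (induction n) (simp_all add: poly2_const poly2_mult)

lemma poly2_sum: "(\<And>i. i \<in> A \<Longrightarrow> poly2 (f i)) \<Longrightarrow> poly2 (\<lambda>z. \<Sum>i\<in>A. f i z)"
  by (induction A rule: infinite_finite_induct) (simp_all add: poly2_const poly2_add)

lemma poly2_poly: "poly2 f \<Longrightarrow> poly2 (\<lambda>z. poly p (f z))"
  unfolding poly_altdef by (intro poly2_sum poly2_mult poly2_const poly2_power)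

lemma poly_mapI: "poly2 (\<lambda>z. fst (F z)) \<Longrightarrow> poly2 (\<lambda>z. snd (F z)) \<Longrightarrow> poly_map F"
  by (simp add: poly_map_def o_def)

lemma poly_mapD:
  assumes "poly_map F"
  shows "poly2 (\<lambda>z. fst (F z))" "poly2 (\<lambda>z. snd (F z))"
  using assms by (simp_all add: poly_map_def o_def)

lemma poly2_compose:
  assumes "poly2 f" "poly_map F" shows "poly2 (\<lambda>z. f (F z))"
proof -
  obtain c N where c: "\<And>x y. f (x, y) = (\<Sum>i\<le>N. \<Sum>j\<le>N. c i j * x ^ i * y ^ j)"
    using assms(1) unfolding poly2_def by blast
  have "(\<lambda>z. f (F z)) = (\<lambda>z. \<Sum>i\<le>N. \<Sum>j\<le>N. c i j * fst (F z) ^ i * snd (F z) ^ j)"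
    using c[of "fst (F z)" "snd (F z)" for z] by simp
  then show ?thesis
    by (auto intro!: poly2_sum poly2_mult poly2_const poly2_power poly_mapD assms(2))
qed

lemma poly_map_comp:
  assumes "poly_map F" "poly_map G" shows "poly_map (F \<circ> G)"
  using poly2_compose[OF poly_mapD(1)[OF assms(1)] assms(2)]
    poly2_compose[OF poly_mapD(2)[OF assms(1)] assms(2)]
  by (simp add: poly_mapI)

lemma poly_map_id: "poly_map id"
  by (simp add: poly_map_def poly2_fst poly2_snd)

lemma poly_map_funpow: "poly_map F \<Longrightarrow> poly_map (F ^^ n)"
  by (induction n) (simp_all add: poly_map_id poly_map_comp)

lemma poly_autD:
  assumes "poly_aut F"
  shows "bij F" "poly_map F" "poly_map (inv F)" "F \<circ> inv F = id" "inv F \<circ> F = id"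
    "\<And>z. F (inv F z) = z" "\<And>z. inv F (F z) = z"
  using assms by (auto simp: poly_aut_def bij_is_surj surj_f_inv_f bij_is_inj)

lemma poly_autI:
  assumes "F \<circ> G = id" "G \<circ> F = id" "poly_map F" "poly_map G"
  shows "poly_aut F" "inv F = G"
proof -
  show "inv F = G" using inv_unique_comp[OF assms(1,2)] .
  then show "poly_aut F" using assms o_bij[OF assms(2,1)] by (simp add: poly_aut_def)
qed

lemma poly_aut_inv: "poly_aut F \<Longrightarrow> poly_aut (inv F)"
  by (simp add: poly_aut_def inv_inv_eq bij_imp_bij_inv)

lemma poly_aut_comp: "poly_aut F \<Longrightarrow> poly_aut G \<Longrightarrow> poly_aut (F \<circ> G)"
  by (simp add: poly_aut_def bij_comp poly_map_comp o_inv_distrib)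

lemma poly_aut_id: "poly_aut id"
  by (simp add: poly_aut_def poly_map_id)

lemma word_map_simps [simp]:
  "word_map [] = id" "word_map (w # ws) = w \<circ> word_map ws"
  by (simp_all add: word_map_def)

lemma word_map_append [simp]: "word_map (us @ ws) = word_map us \<circ> word_map ws"
  by (induction us) (simp_all add: o_assoc)

lemma poly_aut_word_map: "(\<And>w. w \<in> set ws \<Longrightarrow> poly_aut w) \<Longrightarrow> poly_aut (word_map ws)"
  by (induction ws) (simp_all add: poly_aut_id poly_aut_comp)

lemma inv_word_map:
  "(\<And>w. w \<in> set ws \<Longrightarrow> bij w) \<Longrightarrow> inv (word_map ws) = word_map (map inv (rev ws)) \<and> bij (word_map ws)"
  by (induction ws) (simp_all add: o_inv_distrib bij_comp)

text \<open>Conjugacies are used as intertwining relations, which compose without inverses.\<close>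

lemma conj_in_GI:
  assumes "poly_aut \<phi>" "g \<circ> \<phi> = \<phi> \<circ> F" shows "conj_in_G g F"
  unfolding conj_in_G_def using assms
  by (intro exI[of _ \<phi>]) (simp flip: assms(2) add: comp_assoc poly_autD(4))

lemma conj_in_GD: "conj_in_G g F \<Longrightarrow> \<exists>\<phi>. poly_aut \<phi> \<and> g \<circ> \<phi> = \<phi> \<circ> F"
  unfolding conj_in_G_def by (auto simp: comp_assoc poly_autD(5))

lemma conj_in_G_trans:
  assumes "conj_in_G f g" "conj_in_G g h" shows "conj_in_G f h"
proof -
  obtain \<phi> \<psi> where \<phi>: "poly_aut \<phi>" "f \<circ> \<phi> = \<phi> \<circ> g" and \<psi>: "poly_aut \<psi>" "g \<circ> \<psi> = \<psi> \<circ> h"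
    using assms by (meson conj_in_GD)
  have "f (\<phi> z) = \<phi> (g z)" "g (\<psi> z) = \<psi> (h z)" for z
    using fun_cong[OF \<phi>(2), of z] fun_cong[OF \<psi>(2), of z] by simp_all
  then have "f \<circ> (\<phi> \<circ> \<psi>) = (\<phi> \<circ> \<psi>) \<circ> h"
    by (simp add: fun_eq_iff)
  then show ?thesis using \<phi>(1) \<psi>(1) conj_in_GI poly_aut_comp by blast
qed

lemma conj_in_G_sym:
  assumes "conj_in_G f g" shows "conj_in_G g f"
proof -
  obtain \<phi> where \<phi>: "poly_aut \<phi>" "f \<circ> \<phi> = \<phi> \<circ> g"
    using assms by (meson conj_in_GD)
  have "f (\<phi> z) = \<phi> (g z)" for z
    using fun_cong[OF \<phi>(2), of z] by simp
  then have "g (inv \<phi> z) = inv \<phi> (f z)" for z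
    by (metis poly_autD(6,7)[OF \<phi>(1)])
  then have "g \<circ> inv \<phi> = inv \<phi> \<circ> f" by auto
  then show ?thesis using \<phi>(1) conj_in_GI poly_aut_inv by blast
qed

subsection \<open>Diagonal affine maps, letters and curves\<close>

lemma tswap_apply [simp]: "tswap (x, y) = (y, x)"
  by (simp add: tswap_def)

lemma tswap_tswap [simp]: "tswap \<circ> tswap = id" "tswap (tswap z) = z"
  by (auto simp: tswap_def case_prod_beta)

lemma poly_aut_tswap: "poly_aut tswap"
proof -
  have "poly_map tswap"
    by (auto intro!: poly_mapI simp: tswap_def case_prod_beta poly2_fst poly2_snd)
  then show ?thesis using poly_autI(1)[of tswap tswap] by simp
qed

definition dg :: "complex \<Rightarrow> complex \<Rightarrow> complex \<Rightarrow> complex \<Rightarrow> pmap" where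
  "dg a c b d = (\<lambda>(x, y). (a * x + c, b * y + d))"

lemma dg_apply [simp]: "dg a c b d (x, y) = (a * x + c, b * y + d)"
  by (simp add: dg_def)

lemma poly_map_dg: "poly_map (dg a c b d)"
  by (auto intro!: poly_mapI poly2_add poly2_mult poly2_const poly2_fst poly2_snd
      simp: dg_def case_prod_beta)

lemma poly_aut_dg:
  assumes "a \<noteq> 0" "b \<noteq> 0"
  shows "poly_aut (dg a c b d)" "inv (dg a c b d) = dg (1/a) (-c/a) (1/b) (-d/b)"
proof -
  have 1: "dg a c b d \<circ> dg (1/a) (-c/a) (1/b) (-d/b) = id"
    and 2: "dg (1/a) (-c/a) (1/b) (-d/b) \<circ> dg a c b d = id"
    using assms by (auto simp: fun_eq_iff field_simps)
  show "poly_aut (dg a c b d)" "inv (dg a c b d) = dg (1/a) (-c/a) (1/b) (-d/b)"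
    using poly_autI[OF 1 2] poly_map_dg by auto
qed

text \<open>The swap after the elementary map \<open>(a x + p(y), e y + k)\<close>. Generalized
  Henon maps are the case \<open>e = 1\<close>, \<open>k = 0\<close>.\<close>

definition lm :: "complex \<Rightarrow> complex \<Rightarrow> complex \<Rightarrow> complex poly \<Rightarrow> pmap" where
  "lm e k a p = (\<lambda>(x, y). (e * y + k, a * x + poly p y))"

lemma lm_apply [simp]: "lm e k a p (x, y) = (e * y + k, a * x + poly p y)"
  by (simp add: lm_def)

lemma poly_map_lm: "poly_map (lm e k a p)"
  by (auto intro!: poly_mapI poly2_add poly2_mult poly2_const poly2_fst poly2_snd poly2_poly
      simp: lm_def case_prod_beta)

definition letter :: "pmap \<Rightarrow> bool" where
  "letter w \<longleftrightarrow> (\<exists>e k a p. e \<noteq> 0 \<and> a \<noteq> 0 \<and> 2 \<le> degree p \<and> w = lm e k a p)"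

text \<open>The inverse of a letter, conjugated by the swap, is again a letter; this exchanges forward and
  backward iteration.\<close>

definition hat :: "pmap \<Rightarrow> pmap" where
  "hat w = tswap \<circ> inv w \<circ> tswap"

lemma inv_lm:
  assumes "e \<noteq> 0" "a \<noteq> 0"
  shows "poly_aut (lm e k a p)"
    and "inv (lm e k a p) = (\<lambda>(x, y). ((y - poly p ((x - k) / e)) / a, (x - k) / e))"
proof -
  let ?G = "\<lambda>(x, y). ((y - poly p ((x - k) / e)) / a, (x - k) / e)"
  have G: "?G = (\<lambda>z. ((1/a) * (snd z + (-1) * poly p ((1/e) * (fst z + (-k)))), (1/e) * (fst z + (-k))))"
    by (auto simp: fun_eq_iff)
  have "poly_map ?G"
    unfolding G by (rule poly_mapI) (simp only: fst_conv snd_conv,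
        intro poly2_add poly2_mult poly2_const poly2_fst poly2_snd poly2_poly)+
  moreover have "lm e k a p \<circ> ?G = id" "?G \<circ> lm e k a p = id"
    using assms by (auto simp: fun_eq_iff)
  ultimately show "poly_aut (lm e k a p)" "inv (lm e k a p) = ?G"
    using poly_autI poly_map_lm by blast+
qed

lemma hat_lm:
  assumes "e \<noteq> 0" "a \<noteq> 0"
  shows "hat (lm e k a p) = lm (1/e) (-k/e) (1/a) (smult (-1/a) (pcompose p [:-k/e, 1/e:]))"
  unfolding hat_def inv_lm[OF assms]
  by (auto simp: fun_eq_iff poly_pcompose divide_simps)

lemma poly_aut_letter: "letter w \<Longrightarrow> poly_aut w"
  by (auto simp: letter_def inv_lm)

lemma letterI: "e \<noteq> 0 \<Longrightarrow> a \<noteq> 0 \<Longrightarrow> 2 \<le> degree p \<Longrightarrow> letter (lm e k a p)"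
  by (auto simp: letter_def)

lemma letter_hat:
  assumes "letter w" shows "letter (hat w)"
proof -
  obtain e k a p where w: "e \<noteq> 0" "a \<noteq> 0" "2 \<le> degree p" "w = lm e k a p"
    using assms unfolding letter_def by blast
  then show ?thesis
    unfolding w(4) hat_lm[OF w(1,2)] by (intro letterI) (auto simp: degree_pcompose)
qed

subsection \<open>Dominance of the second coordinate after long words\<close>

text \<open>The support must carry nonzero coefficients, so that a part of top degree or top weight
  is really present.\<close>

definition expansion :: "(complex \<times> complex \<Rightarrow> complex) \<Rightarrow> (nat \<times> nat) set \<Rightarrow> (nat \<Rightarrow> nat \<Rightarrow> complex) \<Rightarrow> bool" where
  "expansion f S c \<longleftrightarrow> finite S \<and> (\<forall>(i, j)\<in>S. c i j \<noteq> 0) \<and>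
     (\<forall>x y. f (x, y) = (\<Sum>(i, j)\<in>S. c i j * x ^ i * y ^ j))"

lemma poly2_expansion:
  assumes "poly2 f" shows "\<exists>S c. expansion f S c"
proof -
  obtain c N where c: "\<And>x y. f (x, y) = (\<Sum>i\<le>N. \<Sum>j\<le>N. c i j * x ^ i * y ^ j)"
    using assms unfolding poly2_def by blast
  define S where "S = {(i, j). i \<le> N \<and> j \<le> N \<and> c i j \<noteq> 0}"
  have sub: "S \<subseteq> {..N} \<times> {..N}" by (auto simp: S_def)
  have "f (x, y) = (\<Sum>(i, j)\<in>S. c i j * x ^ i * y ^ j)" for x y
  proof -
    have "f (x, y) = (\<Sum>(i, j)\<in>{..N} \<times> {..N}. c i j * x ^ i * y ^ j)"
      by (simp add: c sum.cartesian_product)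
    also have "\<dots> = (\<Sum>(i, j)\<in>S. c i j * x ^ i * y ^ j)"
      by (rule sum.mono_neutral_right) (auto simp: S_def)
    finally show ?thesis .
  qed
  then have "expansion f S c"
    unfolding expansion_def using finite_subset[OF sub] by (auto simp: S_def)
  then show ?thesis by blast
qed

text \<open>The homogeneous part of top degree of \<open>f\<close> has degree at most \<open>r\<close> in the first variable.\<close>

definition top_bound :: "(complex \<times> complex \<Rightarrow> complex) \<Rightarrow> nat \<Rightarrow> bool" where
  "top_bound f r \<longleftrightarrow> (\<exists>S c N. expansion f S c \<and>
     (\<forall>(i, j)\<in>S. i + j \<le> N \<and> (r < i \<longrightarrow> i + j < N)) \<and> (\<exists>(i, j)\<in>S. i + j = N))"

lemma top_bound_mono:
  assumes "top_bound f r" "r \<le> r'" shows "top_bound f r'"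
proof -
  obtain S c N where S: "expansion f S c"
    and SN: "\<forall>(i, j)\<in>S. i + j \<le> N \<and> (r < i \<longrightarrow> i + j < N)"
    and S0: "\<exists>(i, j)\<in>S. i + j = N"
    using assms(1) unfolding top_bound_def by blast
  have "\<forall>(i, j)\<in>S. i + j \<le> N \<and> (r' < i \<longrightarrow> i + j < N)"
    using SN assms(2) by auto
  then show ?thesis unfolding top_bound_def using S S0 by blast
qed

text \<open>With \<open>r\<close> the total degree the bound is vacuous; it gains content only as
  letters shrink \<open>r\<close>.\<close>

lemma top_bound_exists:
  assumes "poly2 f" "f \<noteq> (\<lambda>_. 0)" shows "\<exists>r. top_bound f r"
proof -
  obtain S c where S: "expansion f S c"
    using poly2_expansion[OF assms(1)] by blast
  have "S \<noteq> {}"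
    using S assms(2) by (auto simp: expansion_def fun_eq_iff)
  moreover have fin: "finite S" using S by (simp add: expansion_def)
  define N where "N = Max ((\<lambda>(i, j). i + j) ` S)"
  have "\<exists>(i, j)\<in>S. i + j = N"
  proof -
    have "N \<in> (\<lambda>(i, j). i + j) ` S"
      unfolding N_def using fin \<open>S \<noteq> {}\<close> by (intro Max_in) auto
    then show ?thesis by force
  qed
  moreover have "i + j \<le> N" if "(i, j) \<in> S" for i j
    unfolding N_def using fin that by (intro Max_ge) auto
  ultimately have "top_bound f N"
    unfolding top_bound_def using S by (intro exI[of _ S] exI[of _ c] exI[of _ N]) fastforce
  then show ?thesis by blast
qed

text \<open>Coefficients at a formal degree bound multiply even where the true degree is smaller.
  This matters below, where the formal leading coefficient \<open>a x + lc\<close> vanishes for one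
  \<open>x\<close>.\<close>

lemma coeff_mult_bound:
  fixes p q :: "complex poly"
  assumes "degree p \<le> m" "degree q \<le> n"
  shows "degree (p * q) \<le> m + n" "coeff (p * q) (m + n) = coeff p m * coeff q n"
proof -
  show "degree (p * q) \<le> m + n"
    using degree_mult_le[of p q] assms by linarith
  show "coeff (p * q) (m + n) = coeff p m * coeff q n"
  proof (cases "degree p = m \<and> degree q = n")
    case True
    then show ?thesis using coeff_mult_degree_sum[of p q] by simp
  next
    case False
    then have "degree p < m \<or> degree q < n" using assms by auto
    then have "coeff p m = 0 \<or> coeff q n = 0" by (auto intro: coeff_eq_0)
    moreover have "degree (p * q) < m + n"
      using degree_mult_le[of p q] assms False by linarith
    ultimately show ?thesis by (auto simp: coeff_eq_0)
  qed
qed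

lemma coeff_power_bound:
  fixes p :: "complex poly"
  assumes "degree p \<le> m"
  shows "degree (p ^ n) \<le> n * m \<and> coeff (p ^ n) (n * m) = coeff p m ^ n"
proof (induction n)
  case (Suc n)
  then show ?case
    using coeff_mult_bound[OF assms, of "p ^ n" "n * m"] by simp
qed simp

text \<open>Only the part \<open>x\<^sup>i y\<^sup>j\<close>, \<open>i + d j = M\<close>, of top weight contributes to the top weight part of
  the composition, where \<open>x\<close> now has weight \<open>d\<close> and \<open>y\<close> weight \<open>1\<close>. At \<open>y = 1\<close> that part is the polynomial
  \<open>b\<close> below, whose order at \<open>0\<close> is at most \<open>r / d\<close>.\<close>

lemma top_bound_letter:
  assumes f: "top_bound f r" "poly2 f" and e: "e \<noteq> 0" "a \<noteq> 0" and p: "degree p = d" "2 \<le> d"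
  shows "top_bound (\<lambda>z. f (lm e k a p z)) (r div d)"
proof -
  obtain S c N where S: "expansion f S c"
    and SN: "\<And>i j. (i, j) \<in> S \<Longrightarrow> i + j \<le> N \<and> (r < i \<longrightarrow> i + j < N)"
    and S0: "\<exists>(i, j)\<in>S. i + j = N"
    using f(1) unfolding top_bound_def by blast
  obtain i1 j1 where ij1: "(i1, j1) \<in> S" "i1 + j1 = N" using S0 by blast
  have fin: "finite S" and c0: "\<And>i j. (i, j) \<in> S \<Longrightarrow> c i j \<noteq> 0"
    and fS: "\<And>x y. f (x, y) = (\<Sum>(i, j)\<in>S. c i j * x ^ i * y ^ j)"
    using S by (auto simp: expansion_def)
  have "poly2 (\<lambda>z. f (lm e k a p z))"
    using f(2) poly_map_lm by (rule poly2_compose)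
  then obtain S' c' where S': "expansion (\<lambda>z. f (lm e k a p z)) S' c'"
    using poly2_expansion by blast
  have fin': "finite S'" and c0': "\<And>i j. (i, j) \<in> S' \<Longrightarrow> c' i j \<noteq> 0"
    and fS': "\<And>x y. f (lm e k a p (x, y)) = (\<Sum>(i, j)\<in>S'. c' i j * x ^ i * y ^ j)"
    using S' by (auto simp: expansion_def)
  define M where "M = Max ((\<lambda>(i, j). i + d * j) ` S)"
  have M: "i + d * j \<le> M" if "(i, j) \<in> S" for i j
    unfolding M_def using fin that by (intro Max_ge) auto
  have "M \<in> (\<lambda>(i, j). i + d * j) ` S"
    unfolding M_def using fin ij1 by (intro Max_in) auto
  then obtain i2 j2 where ij2: "(i2, j2) \<in> S" "i2 + d * j2 = M" by auto
  define T where "T = {(i, j)\<in>S. i + d * j = M}"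
  have "T \<subseteq> S" by (auto simp: T_def)
  then have T: "finite T" "(i2, j2) \<in> T"
    using finite_subset fin ij2 by (auto simp: T_def)
  \<comment> \<open>A pair with \<open>i > r\<close> has total degree below that of
    \<open>(i1, j1)\<close>, while \<open>i1 \<le> r < i\<close>; so also \<open>j < j1\<close>, and
    its weight \<open>(i + j) + (d - 1) j\<close> stays below that of
    \<open>(i1, j1)\<close>.\<close>
  have Tr: "i \<le> r" if "(i, j) \<in> T" for i j
  proof (rule ccontr)
    assume "\<not> i \<le> r"
    then have "i + j < i1 + j1" using SN that ij1(2) by (auto simp: T_def)
    moreover have "i1 \<le> r" using SN[OF ij1(1)] ij1(2) by force
    ultimately have "j < j1" using \<open>\<not> i \<le> r\<close> by linarith
    have "i + d * j = (i + j) + (d - 1) * j" using p(2) by (simp add: algebra_simps diff_mult_distrib2)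
    also have "\<dots> < (i1 + j1) + (d - 1) * j1"
      using \<open>i + j < i1 + j1\<close> mult_le_mono2[OF less_imp_le[OF \<open>j < j1\<close>], of "d - 1"] by linarith
    also have "\<dots> = i1 + d * j1" using p(2) by (simp add: algebra_simps diff_mult_distrib2)
    finally show False using M[OF ij1(1)] that by (simp add: T_def)
  qed
  define lc where "lc = coeff p d"
  have lc: "lc \<noteq> 0" using p by (metis lc_def degree_0 leading_coeff_0_iff not_numeral_le_zero)
  define j0 where "j0 = Min (snd ` T)"
  have j0: "j0 \<le> j" if "(i, j) \<in> T" for i j
    unfolding j0_def using T(1) that by (force intro: Min_le)
  have "j0 \<in> snd ` T" unfolding j0_def using T by (intro Min_in) auto
  then obtain i0 where i0: "(i0, j0) \<in> T" by auto
  \<comment> \<open>All pairs of \<open>T\<close> share the weight \<open>M\<close>, so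
    \<open>d (j - j0) = i0 - i \<le> r\<close>.\<close>
  have jr: "j - j0 \<le> r div d" if "(i, j) \<in> T" for i j
  proof -
    have "d * j \<le> r + d * j0" using that i0 Tr[OF i0] by (auto simp: T_def)
    then have "d * (j - j0) \<le> r" by (simp add: diff_mult_distrib2)
    then show ?thesis using p(2) by (simp add: less_eq_div_iff_mult_less_eq mult.commute)
  qed
  \<comment> \<open>The top weight part with the common power \<open>(a x + lc)^j0\<close> removed,
    as a polynomial in \<open>a x + lc\<close>. Distinct pairs of \<open>T\<close> have distinct
    \<open>j\<close>, so nothing cancels in \<open>q\<close>.\<close>
  define q where "q = (\<Sum>(i, j)\<in>T. monom (c i j * e ^ i) (j - j0))"
  define b2 where "b2 = pcompose q [:lc, a:]"
  define b where "b = [:lc, a:] ^ j0 * b2"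
  have "coeff q (j2 - j0) \<noteq> 0"
  proof -
    have "coeff q (j2 - j0) = (\<Sum>(i, j)\<in>T. if (i, j) = (i2, j2) then c i j * e ^ i else 0)"
      unfolding q_def coeff_sum using j0 T(2)
      by (intro sum.cong) (auto simp: T_def eq_diff_iff split: if_splits)
    also have "\<dots> = (\<Sum>z\<in>T. if z = (i2, j2) then c i2 j2 * e ^ i2 else 0)"
      by (intro sum.cong) (auto split: if_splits)
    also have "\<dots> = c i2 j2 * e ^ i2"
      using T by (subst sum.delta) auto
    finally show ?thesis using c0[OF ij2(1)] e by simp
  qed
  then have "q \<noteq> 0" by auto
  have "b2 \<noteq> 0" unfolding b2_def using \<open>q \<noteq> 0\<close> e by (simp add: pcompose_eq_0_iff)
  have "degree q \<le> r div d"
    unfolding q_def using jr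
    by (intro degree_sum_le) (auto intro: order_trans[OF degree_monom_le] T(1))
  then have degb2: "degree b2 \<le> r div d" unfolding b2_def by (simp add: degree_pcompose e)
  have "b \<noteq> 0" unfolding b_def using \<open>b2 \<noteq> 0\<close> lc by auto
  \<comment> \<open>The removed power takes the value \<open>lc ^ j0 \<noteq> 0\<close> at 0, so the
    order of \<open>b\<close> is that of \<open>b2\<close>, whose degree is at most
    \<open>r div d\<close>.\<close>
  have "order 0 b = order 0 b2"
  proof -
    have "order 0 ([:lc, a:] ^ j0) = 0" using lc by (intro order_0I) simp
    then show ?thesis unfolding b_def using order_mult[of "[:lc, a:] ^ j0" b2 0] \<open>b \<noteq> 0\<close> by (simp add: b_def)
  qed
  then have "order 0 b \<le> r div d" using degb2 order_degree[OF \<open>b2 \<noteq> 0\<close>, of 0] by simp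
  then have "\<not> monom 1 (Suc (r div d)) dvd b"
    using monom_1_dvd_iff[OF \<open>b \<noteq> 0\<close>] by simp
  then obtain r' where r': "r' \<le> r div d" "coeff b r' \<noteq> 0"
    unfolding monom_1_dvd_iff' by (auto simp: less_Suc_eq_le)
  have b_eval: "poly b x = (\<Sum>(i, j)\<in>T. c i j * e ^ i * (a * x + lc) ^ j)" for x
  proof -
    have "poly b x = (lc + x * a) ^ j0 * (\<Sum>(i, j)\<in>T. c i j * e ^ i * (lc + x * a) ^ (j - j0))"
      unfolding b_def b2_def q_def
      by (simp add: poly_pcompose poly_sum poly_monom case_prod_beta)
    also have "\<dots> = (\<Sum>(i, j)\<in>T. c i j * e ^ i * (a * x + lc) ^ j)"
      unfolding sum_distrib_left using j0
      by (intro sum.cong) (auto simp: algebra_simps power_add[symmetric])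
    finally show ?thesis .
  qed
  \<comment> \<open>Along \<open>(s ^ d * x, s)\<close> the weight becomes the degree in
    \<open>s\<close>. \<open>A x\<close> reads the composition from its own expansion,
    \<open>B x\<close> from the expansion of \<open>f\<close>; comparing coefficients of
    \<open>s\<close> isolates each weight.\<close>
  define A where "A x = (\<Sum>(i, j)\<in>S'. monom (c' i j * x ^ i) (d * i + j))" for x
  define B where "B x = (\<Sum>(i, j)\<in>S. smult (c i j) ([:k, e:] ^ i * (monom (a * x) d + p) ^ j))" for x
  have AB: "A x = B x" for x
  proof -
    have "poly (A x) s = poly (B x) s" for s
    proof -
      have "poly (A x) s = f (lm e k a p (s ^ d * x, s))"
        unfolding A_def fS' by (simp add: poly_sum poly_monom case_prod_beta power_mult_distrib power_add power_mult mult_ac)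
      also have "\<dots> = poly (B x) s"
        unfolding B_def by (simp add: fS poly_sum poly_monom case_prod_beta algebra_simps)
      finally show ?thesis .
    qed
    then show ?thesis by (intro poly_ext) auto
  qed
  have wt: "degree ([:k, e:] ^ i * (monom (a * x) d + p) ^ j) \<le> i + d * j"
    "coeff ([:k, e:] ^ i * (monom (a * x) d + p) ^ j) (i + d * j) = e ^ i * (a * x + lc) ^ j" for i j x
  proof -
    have 1: "degree ([:k, e:] ^ i) \<le> i" "coeff ([:k, e:] ^ i) i = e ^ i"
      using coeff_power_bound[of "[:k, e:]" 1 i] by auto
    have "degree (monom (a * x) d + p) \<le> d"
      using p(1) by (intro degree_add_le degree_monom_le) auto
    from coeff_power_bound[OF this, of j]
    have 2: "degree ((monom (a * x) d + p) ^ j) \<le> d * j"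
      "coeff ((monom (a * x) d + p) ^ j) (d * j) = (a * x + lc) ^ j"
      by (auto simp: lc_def mult.commute)
    show "degree ([:k, e:] ^ i * (monom (a * x) d + p) ^ j) \<le> i + d * j"
      "coeff ([:k, e:] ^ i * (monom (a * x) d + p) ^ j) (i + d * j) = e ^ i * (a * x + lc) ^ j"
      using coeff_mult_bound[OF 1(1) 2(1)] 1(2) 2(2) by auto
  qed
  have BM: "coeff (B x) M = poly b x" for x
  proof -
    have "coeff (B x) M = (\<Sum>(i, j)\<in>S. c i j * coeff ([:k, e:] ^ i * (monom (a * x) d + p) ^ j) M)"
      unfolding B_def by (simp add: coeff_sum case_prod_beta)
    also have "\<dots> = (\<Sum>(i, j)\<in>T. c i j * coeff ([:k, e:] ^ i * (monom (a * x) d + p) ^ j) M)"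
    proof (rule sum.mono_neutral_right[OF fin])
      show "T \<subseteq> S" by (auto simp: T_def)
      show "\<forall>z\<in>S - T. (case z of (i, j) \<Rightarrow> c i j * coeff ([:k, e:] ^ i * (monom (a * x) d + p) ^ j) M) = 0"
      proof safe
        fix i j assume "(i, j) \<in> S" "(i, j) \<notin> T"
        then have "i + d * j < M" using M[of i j] by (auto simp: T_def)
        then show "c i j * coeff ([:k, e:] ^ i * (monom (a * x) d + p) ^ j) M = 0"
          using wt(1)[of i x j] by (simp add: coeff_eq_0)
      qed
    qed
    also have "\<dots> = (\<Sum>(i, j)\<in>T. c i j * e ^ i * (a * x + lc) ^ j)"
      using wt(2) by (intro sum.cong) (auto simp: T_def)
    finally show ?thesis by (simp add: b_eval)
  qed
  have Bn: "coeff (B x) n = 0" if "M < n" for x n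
    unfolding B_def coeff_sum
  proof (rule sum.neutral, safe)
    fix i j assume "(i, j) \<in> S"
    then have "i + d * j < n" using M[of i j] that by simp
    then show "coeff (smult (c i j) ([:k, e:] ^ i * (monom (a * x) d + p) ^ j)) n = 0"
      using wt(1)[of i x j] by (simp add: coeff_eq_0)
  qed
  define A' where "A' n = (\<Sum>(i, j)\<in>{(i, j)\<in>S'. d * i + j = n}. monom (c' i j) i)" for n
  have A': "poly (A' n) x = coeff (A x) n" for n x
  proof -
    have "coeff (A x) n = (\<Sum>(i, j)\<in>S'. if d * i + j = n then c' i j * x ^ i else 0)"
      unfolding A_def by (simp add: coeff_sum case_prod_beta)
    also have "\<dots> = (\<Sum>(i, j)\<in>{(i, j)\<in>S'. d * i + j = n}. c' i j * x ^ i)"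
      using fin' by (intro sum.mono_neutral_cong_right) (auto split: if_splits)
    finally show ?thesis
      unfolding A'_def by (simp add: poly_sum poly_monom case_prod_beta)
  qed
  have A'c: "coeff (A' n) i = (if (i, n - d * i) \<in> S' \<and> d * i \<le> n then c' i (n - d * i) else 0)" for n i
  proof -
    have fT: "finite {(i, j)\<in>S'. d * i + j = n}"
      using fin' by (rule finite_subset[rotated]) auto
    have "coeff (A' n) i = (\<Sum>z\<in>{(i, j)\<in>S'. d * i + j = n}. if z = (i, n - d * i) then c' i (n - d * i) else 0)"
      unfolding A'_def coeff_sum by (intro sum.cong) (auto split: if_splits)
    then show ?thesis using fT by auto
  qed
  have S'M: "d * i + j \<le> M" if "(i, j) \<in> S'" for i j
  proof (rule ccontr)
    assume *: "\<not> d * i + j \<le> M"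
    have "poly (A' (d * i + j)) x = 0" for x
      using * by (simp add: A' AB Bn)
    then have "A' (d * i + j) = 0" by (intro poly_ext) simp
    then show False using A'c[of "d * i + j" i] that c0' by auto
  qed
  have "poly (A' M) x = poly b x" for x by (simp add: A' AB BM)
  then have "A' M = b" by (rule poly_ext)
  then have r'S: "(r', M - d * r') \<in> S'" "d * r' \<le> M"
    using A'c[of M r'] r'(2) by (auto split: if_splits)
  define N' where "N' = Max ((\<lambda>(i, j). i + j) ` S')"
  have N': "i + j \<le> N'" if "(i, j) \<in> S'" for i j
    unfolding N'_def using fin' that by (intro Max_ge) auto
  have "N' \<in> (\<lambda>(i, j). i + j) ` S'"
    unfolding N'_def using fin' r'S by (intro Max_in) auto
  \<comment> \<open>Weight at most \<open>M\<close> and x-degree above \<open>r'\<close> force a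
    total degree below that of the monomial \<open>(r', M - d * r')\<close>, which occurs because
    \<open>b\<close> has a nonzero coefficient at \<open>r'\<close>.\<close>
  moreover have "i + j < N'" if "(i, j) \<in> S'" "r div d < i" for i j
  proof -
    have "r' < i" using r'(1) that(2) by simp
    then have "(d - 1) * r' < (d - 1) * i" using p(2) by simp
    then have "d * r' + i < d * i + r'"
      using p(2) \<open>r' < i\<close> by (simp add: diff_mult_distrib)
    then show ?thesis using S'M[OF that(1)] N'[OF r'S(1)] r'S(2) by linarith
  qed
  ultimately show ?thesis
    unfolding top_bound_def using S' N' by (intro exI[of _ S'] exI[of _ c'] exI[of _ N']) force
qed

text \<open>Each letter divides \<open>r\<close> by its degree, at least 2, so a long word leaves
  \<open>r = 0\<close>: the top homogeneous part is then a power of y alone.\<close>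

lemma top_bound_word:
  assumes "top_bound f r" "poly2 f" "\<And>w. w \<in> set ws \<Longrightarrow> letter w"
  shows "top_bound (\<lambda>z. f (word_map ws z)) (r div 2 ^ length ws)"
  using assms
proof (induction ws arbitrary: f r)
  case (Cons w ws)
  obtain e k a p where w: "e \<noteq> 0" "a \<noteq> 0" "2 \<le> degree p" "w = lm e k a p"
    using Cons.prems(3)[of w, OF list.set_intros(1)] unfolding letter_def by blast
  have "top_bound (\<lambda>z. f (w z)) (r div degree p)"
    unfolding w(4) by (rule top_bound_letter[OF Cons.prems(1,2) w(1,2) refl w(3)])
  then have "top_bound (\<lambda>z. f (w z)) (r div 2)"
    by (rule top_bound_mono) (use div_le_mono2[of 2 "degree p" r] w(3) in simp)
  moreover have "poly2 (\<lambda>z. f (w z))"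
    unfolding w(4) using Cons.prems(2) poly_map_lm by (rule poly2_compose)
  ultimately have "top_bound (\<lambda>z. f (w (word_map ws z))) (r div 2 div 2 ^ length ws)"
    using Cons.prems(3) by (intro Cons.IH) auto
  moreover have "r div 2 ^ length (w # ws) = r div 2 div 2 ^ length ws"
    by (simp only: list.size power_Suc div_mult2_eq add_0_right add_Suc_right)
  ultimately show ?case by (simp only: word_map_simps o_apply)
qed simp

abbreviation dominated :: "(complex \<times> complex \<Rightarrow> complex) \<Rightarrow> nat \<Rightarrow> bool" where
  "dominated f N \<equiv> \<forall>p q h. degree p < degree q \<longrightarrow>
    (\<forall>s. poly h s = f (poly p s, poly q s)) \<longrightarrow> degree h = N * degree q"

text \<open>For \<open>r = 0\<close> the only monomial of top degree is \<open>y ^ N\<close>; the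
  others have total degree below \<open>N\<close>, and since y has the larger degree along the curve
  they cannot reach \<open>N * degree q\<close>.\<close>

lemma top_bound_0_degree:
  assumes "top_bound f 0" "\<not> (\<exists>k. f = (\<lambda>_. k))"
  shows "\<exists>N>0. dominated f N"
proof -
  obtain S c N where S: "expansion f S c"
    and SN: "\<And>i j. (i, j) \<in> S \<Longrightarrow> i + j \<le> N \<and> (0 < i \<longrightarrow> i + j < N)"
    and S0: "\<exists>(i, j)\<in>S. i + j = N"
    using assms(1) unfolding top_bound_def by blast
  have fin: "finite S" and c0: "\<And>i j. (i, j) \<in> S \<Longrightarrow> c i j \<noteq> 0"
    and fS: "\<And>x y. f (x, y) = (\<Sum>(i, j)\<in>S. c i j * x ^ i * y ^ j)"
    using S by (auto simp: expansion_def)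
  obtain i j where "(i, j) \<in> S" "i + j = N" using S0 by blast
  then have 0: "(0, N) \<in> S" using SN[of i j] by (cases i) auto
  have "N > 0"
  proof (rule ccontr)
    assume "\<not> N > 0"
    then have "S \<subseteq> {(0, 0)}" using SN by fastforce
    then have "S = {(0, 0)}" using 0 \<open>\<not> N > 0\<close> by auto
    then have "f = (\<lambda>_. c 0 0)" by (auto simp: fS)
    then show False using assms(2) by blast
  qed
  moreover have "degree h = N * degree q"
    if pq: "degree p < degree q" and h: "\<And>s. poly h s = f (poly p s, poly q s)" for p q h
  proof -
    have "poly h s = poly (\<Sum>(i, j)\<in>S. smult (c i j) (p ^ i * q ^ j)) s" for s
      by (simp add: h fS poly_sum case_prod_beta mult.assoc)
    then have h': "h = (\<Sum>(i, j)\<in>S. smult (c i j) (p ^ i * q ^ j))"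
      by (rule poly_ext)
    also have "\<dots> = smult (c 0 N) (q ^ N) + (\<Sum>(i, j)\<in>S - {(0, N)}. smult (c i j) (p ^ i * q ^ j))"
      using sum.remove[OF fin 0, of "\<lambda>(i, j). smult (c i j) (p ^ i * q ^ j)"] by simp
    finally have h'': "h = smult (c 0 N) (q ^ N) + (\<Sum>(i, j)\<in>S - {(0, N)}. smult (c i j) (p ^ i * q ^ j))" .
    have "q \<noteq> 0" using pq by auto
    then have d1: "degree (smult (c 0 N) (q ^ N)) = N * degree q"
      using c0[OF 0] by (simp add: degree_power_eq)
    have pos: "0 < N * degree q" using pq \<open>N > 0\<close> by simp
    have "degree (\<Sum>(i, j)\<in>S - {(0, N)}. smult (c i j) (p ^ i * q ^ j)) \<le> N * degree q - 1"
    proof (rule degree_sum_le)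
      fix z assume z: "z \<in> S - {(0, N)}"
      obtain i j where ij: "z = (i, j)" by force
      have "i + j < N" using SN[of i j] z ij by (cases i) auto
      then have "(i + j + 1) * degree q \<le> N * degree q" by (intro mult_right_mono) auto
      moreover have "i * degree p \<le> i * degree q" using pq by simp
      moreover have "degree (p ^ i * q ^ j) \<le> i * degree p + j * degree q"
        using degree_mult_le[of "p ^ i" "q ^ j"] degree_power_le[of p i] degree_power_le[of q j]
        by (simp add: mult.commute)
      ultimately have "degree (p ^ i * q ^ j) + degree q \<le> N * degree q"
        unfolding distrib_right by linarith
      then have "degree (p ^ i * q ^ j) \<le> N * degree q - 1" using pq by linarith
      then show "degree (case z of (i, j) \<Rightarrow> smult (c i j) (p ^ i * q ^ j)) \<le> N * degree q - 1"
        using pq order_trans[OF degree_smult_le] unfolding ij prod.case by fastforce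
    qed (use fin in auto)
    then have "degree (\<Sum>(i, j)\<in>S - {(0, N)}. smult (c i j) (p ^ i * q ^ j)) < N * degree q"
      using pos by linarith
    then show ?thesis unfolding h'' using d1 by (simp add: degree_add_eq_left)
  qed
  ultimately show ?thesis by blast
qed

text \<open>The threshold depends on \<open>f\<close> only: any \<open>n0 = r\<close> works, because
  \<open>r < 2 ^ r\<close>.\<close>

lemma word_dominated:
  assumes "poly2 f" "\<not> (\<exists>k. f = (\<lambda>_. k))"
  shows "\<exists>n0. \<forall>ws. n0 \<le> length ws \<longrightarrow> (\<forall>w\<in>set ws. letter w) \<longrightarrow>
    (\<exists>N>0. dominated (\<lambda>z. f (word_map ws z)) N)"
proof -
  obtain r where r: "top_bound f r"
    using top_bound_exists[OF assms(1)] assms(2) by blast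
  have "\<exists>N>0. dominated (\<lambda>z. f (word_map ws z)) N"
    if ws: "r \<le> length ws" "\<forall>w\<in>set ws. letter w" for ws
  proof -
    have "r < 2 ^ length ws"
      using ws(1) by (meson less_exp order_le_less_trans)
    then have "top_bound (\<lambda>z. f (word_map ws z)) 0"
      using top_bound_word[OF r assms(1), of ws] ws(2) by simp
    moreover have "\<not> (\<exists>k. (\<lambda>z. f (word_map ws z)) = (\<lambda>_. k))"
    proof
      assume "\<exists>k. (\<lambda>z. f (word_map ws z)) = (\<lambda>_. k)"
      then obtain k where k: "\<And>z. f (word_map ws z) = k" by meson
      have "bij (word_map ws)"
        using ws(2) by (intro poly_autD(1) poly_aut_word_map poly_aut_letter) auto
      then have "f z = k" for z by (metis k bij_pointE)
      then show False using assms(2) by blast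
    qed
    ultimately show ?thesis by (rule top_bound_0_degree)
  qed
  then show ?thesis by blast
qed

subsection \<open>Polynomial curves and their heights\<close>

type_synonym curve = "complex poly \<times> complex poly"

definition cv :: "curve \<Rightarrow> complex \<Rightarrow> complex \<times> complex" where
  "cv X = (\<lambda>s. (poly (fst X) s, poly (snd X) s))"

text \<open>The image curve under a polynomial map. The choice is harmless: a curve is determined by
  its values (\<open>cv_inject\<close>).\<close>

definition app :: "pmap \<Rightarrow> curve \<Rightarrow> curve" where
  "app F X = (SOME X'. cv X' = F \<circ> cv X)"

abbreviation d1 :: "curve \<Rightarrow> nat" where "d1 X \<equiv> degree (fst X)"
abbreviation d2 :: "curve \<Rightarrow> nat" where "d2 X \<equiv> degree (snd X)"

lemma cv_inject: "cv X = cv X' \<longleftrightarrow> X = X'"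
proof
  assume *: "cv X = cv X'"
  have "poly (fst X) s = poly (fst X') s" "poly (snd X) s = poly (snd X') s" for s
    using fun_cong[OF *, of s] by (simp_all add: cv_def)
  from this[THEN poly_ext] show "X = X'" by (rule prod_eqI)
qed simp

lemma poly2_curve:
  assumes "poly2 f" shows "\<exists>h. \<forall>s. poly h s = f (cv X s)"
proof -
  obtain c N where c: "\<And>x y. f (x, y) = (\<Sum>i\<le>N. \<Sum>j\<le>N. c i j * x ^ i * y ^ j)"
    using assms unfolding poly2_def by blast
  show ?thesis
    by (rule exI[of _ "\<Sum>i\<le>N. \<Sum>j\<le>N. [:c i j:] * fst X ^ i * snd X ^ j"])
      (simp add: c cv_def poly_sum poly_power mult.assoc)
qed

lemma cv_app:
  assumes "poly_map F" shows "cv (app F X) = F \<circ> cv X"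
proof -
  obtain h1 where "\<And>s. poly h1 s = fst (F (cv X s))"
    using poly2_curve[OF poly_mapD(1)[OF assms]] by blast
  moreover obtain h2 where "\<And>s. poly h2 s = snd (F (cv X s))"
    using poly2_curve[OF poly_mapD(2)[OF assms]] by blast
  ultimately have "cv (h1, h2) = F \<circ> cv X" by (simp add: cv_def fun_eq_iff)
  then show ?thesis unfolding app_def by (rule someI)
qed

lemma app_eqI:
  assumes "cv X' = F \<circ> cv X" shows "app F X = X'"
  unfolding app_def
proof (rule some_equality, rule assms)
  fix X'' assume "cv X'' = F \<circ> cv X"
  then show "X'' = X'" using assms cv_inject[of X'' X'] by simp
qed

lemma app_comp: "poly_map F \<Longrightarrow> poly_map G \<Longrightarrow> app (F \<circ> G) X = app F (app G X)"
  by (rule app_eqI) (simp add: cv_app o_assoc)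

lemma app_id [simp]: "app id X = X"
  by (rule app_eqI) simp

lemma app_lm: "app (lm e k a p) X = (smult e (snd X) + [:k:], smult a (fst X) + pcompose p (snd X))"
  by (rule app_eqI) (auto simp: cv_def fun_eq_iff poly_pcompose)

lemma app_dg: "app (dg a c b d) X = (smult a (fst X) + [:c:], smult b (snd X) + [:d:])"
  by (rule app_eqI) (auto simp: cv_def fun_eq_iff)

lemma app_tswap: "app tswap X = (snd X, fst X)"
  by (rule app_eqI) (auto simp: cv_def fun_eq_iff)

lemma degree_add_const [simp]: "degree (p + [:c:]) = degree (p :: complex poly)"
proof (cases "degree p = 0")
  case True
  then obtain a where "p = [:a:]" by (rule degree_eq_zeroE)
  then show ?thesis by simp
qed (simp add: degree_add_eq_left)

abbreviation nonconst :: "curve \<Rightarrow> bool" where "nonconst X \<equiv> 0 < d1 X + d2 X"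

text \<open>Expressed through values, nonconstancy is visibly preserved by bijections; the degrees
  themselves are not.\<close>

lemma curve_nonconst: "(\<exists>s s'. cv X s \<noteq> cv X s') \<longleftrightarrow> nonconst X"
proof
  assume *: "\<exists>s s'. cv X s \<noteq> cv X s'"
  show "nonconst X"
  proof (rule ccontr)
    assume "\<not> nonconst X"
    then have "d1 X = 0" "d2 X = 0" by simp_all
    then obtain x y where "fst X = [:x:]" "snd X = [:y:]"
      by (meson degree_eq_zeroE)
    then show False using * by (simp add: cv_def)
  qed
next
  assume pos: "nonconst X"
  show "\<exists>s s'. cv X s \<noteq> cv X s'"
  proof (rule ccontr)
    assume "\<not> (\<exists>s s'. cv X s \<noteq> cv X s')"
    then have *: "cv X s = cv X 0" for s by blast
    have "poly (fst X) s = poly [:poly (fst X) 0:] s" "poly (snd X) s = poly [:poly (snd X) 0:] s" for s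
      using *[of s] by (simp_all add: cv_def)
    note eq = this[THEN poly_ext]
    have "d1 X = 0" "d2 X = 0"
      by (subst eq(1), simp) (subst eq(2), simp)
    then show False using pos by simp
  qed
qed

lemma app_nonconst:
  assumes "poly_aut F" "nonconst X" shows "nonconst (app F X)"
proof -
  obtain s s' where "cv X s \<noteq> cv X s'" using iffD2[OF curve_nonconst assms(2)] by auto
  then have "F (cv X s) \<noteq> F (cv X s')"
    using poly_autD(1)[OF assms(1)] by (simp add: bij_def inj_eq)
  then have "cv (app F X) s \<noteq> cv (app F X) s'"
    unfolding cv_app[OF poly_autD(2)[OF assms(1)]] by simp
  then show ?thesis by (intro iffD1[OF curve_nonconst] exI)
qed

abbreviation vline :: "complex \<Rightarrow> curve" where "vline c \<equiv> ([:c:], [:0, 1:])"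
abbreviation hline :: "complex \<Rightarrow> curve" where "hline c \<equiv> ([:0, 1:], [:c:])"

text \<open>For \<open>lm e k a p\<close> with \<open>2 \<le> degree p\<close> this is
  \<open>degree p\<close>; reading it off the image of a vertical line avoids choosing a
  representation of the letter.\<close>

definition ldeg :: "pmap \<Rightarrow> nat" where
  "ldeg w = d2 (app w (vline 0))"

lemma ldeg_lm:
  assumes "2 \<le> degree p" shows "ldeg (lm e k a p) = degree p"
  unfolding ldeg_def app_lm by simp

text \<open>The summands \<open>a x\<close> and \<open>p(y)\<close> of the new second coordinate can
  cancel only if their degrees agree, hence the one exceptional case.\<close>

lemma letter_degree:
  assumes "letter w"
  shows "2 \<le> ldeg w" "d1 (app w X) = d2 X" "d2 (app w X) \<le> max (d1 X) (ldeg w * d2 X)"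
    "d1 X \<noteq> ldeg w * d2 X \<Longrightarrow> d2 (app w X) = max (d1 X) (ldeg w * d2 X)"
proof -
  obtain e k a p where w: "e \<noteq> 0" "a \<noteq> 0" "2 \<le> degree p" "w = lm e k a p"
    using assms unfolding letter_def by blast
  have ld: "ldeg w = degree p" using ldeg_lm[OF w(3)] w(4) by simp
  show "2 \<le> ldeg w" using ld w(3) by simp
  show "d1 (app w X) = d2 X" unfolding w(4) app_lm using w(1) by simp
  have *: "d2 (app w X) = degree (smult a (fst X) + pcompose p (snd X))"
    "degree (smult a (fst X)) = d1 X" "degree (pcompose p (snd X)) = ldeg w * d2 X"
    unfolding ld unfolding w(4) app_lm using w(2) by (simp_all add: degree_pcompose)
  show "d2 (app w X) \<le> max (d1 X) (ldeg w * d2 X)"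
    unfolding *(1) using degree_add_le_max[of "smult a (fst X)" "pcompose p (snd X)"] *(2,3) by simp
  show "d2 (app w X) = max (d1 X) (ldeg w * d2 X)" if "d1 X \<noteq> ldeg w * d2 X"
  proof (cases "d1 X < ldeg w * d2 X")
    case True
    then show ?thesis unfolding *(1) using *(2,3) by (simp add: degree_add_eq_right)
  next
    case False
    then have "ldeg w * d2 X < d1 X" using that by simp
    then show ?thesis unfolding *(1) using *(2,3) by (simp add: degree_add_eq_left)
  qed
qed

section \<open>Degrees of curves under words\<close>

definition letters :: "pmap list \<Rightarrow> bool" where
  "letters ws \<longleftrightarrow> (\<forall>w\<in>set ws. letter w)"

lemma letters_simps [simp]:
  "letters []" "letters (w # ws) \<longleftrightarrow> letter w \<and> letters ws"
  "letters (us @ ws) \<longleftrightarrow> letters us \<and> letters ws" "letters (rev ws) \<longleftrightarrow> letters ws"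
  by (auto simp: letters_def)

lemma poly_aut_letters: "letters ws \<Longrightarrow> poly_aut (word_map ws)"
  by (rule poly_aut_word_map) (simp add: letters_def poly_aut_letter)

lemma poly_map_letters: "letters ws \<Longrightarrow> poly_map (word_map ws)"
  using poly_aut_letters poly_autD(2) by blast

lemma app_word_Cons: "letter w \<Longrightarrow> letters ws \<Longrightarrow> app (word_map (w # ws)) X = app w (app (word_map ws) X)"
  by (simp add: app_comp poly_map_letters poly_autD(2) poly_aut_letter)

lemma app_word_append:
  "letters us \<Longrightarrow> letters ws \<Longrightarrow> app (word_map (us @ ws)) X = app (word_map us) (app (word_map ws) X)"
  by (simp add: app_comp poly_map_letters)

definition wdeg :: "pmap list \<Rightarrow> nat" where
  "wdeg ws = prod_list (map ldeg ws)"

lemma wdeg_simps [simp]: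
  "wdeg [] = 1" "wdeg (w # ws) = ldeg w * wdeg ws" "wdeg (us @ ws) = wdeg us * wdeg ws"
  by (simp_all add: wdeg_def)

lemma wdeg_pos: "letters ws \<Longrightarrow> 0 < wdeg ws"
  by (induction ws) (auto dest: letter_degree(1))

lemma wdeg_ge2: "letters ws \<Longrightarrow> ws \<noteq> [] \<Longrightarrow> 2 \<le> wdeg ws"
proof (cases ws)
  case (Cons w ws')
  assume "letters ws"
  then have "2 * 1 \<le> ldeg w * wdeg ws'"
    using Cons letter_degree(1)[of w] wdeg_pos[of ws'] by (intro mult_le_mono) auto
  then show ?thesis using Cons by simp
qed simp

text \<open>The cone of degree pairs on which every letter multiplies \<open>d2\<close> exactly by
  \<open>ldeg\<close>. The weak inequality suffices because \<open>ldeg\<close> is at least 2, and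
  one letter makes it strict.\<close>

definition steep :: "curve \<Rightarrow> bool" where
  "steep X \<longleftrightarrow> d1 X \<le> d2 X \<and> 0 < d2 X"

lemma steepI: "d1 X < d2 X \<Longrightarrow> steep X"
  by (simp add: steep_def)

lemma letter_steep:
  assumes "letter w" "steep X"
  shows "d1 (app w X) < d2 (app w X)" "d2 (app w X) = ldeg w * d2 X"
proof -
  have "2 * d2 X \<le> ldeg w * d2 X" using letter_degree(1)[OF assms(1)] by simp
  then have "d1 X < ldeg w * d2 X" "d2 X < ldeg w * d2 X"
    using assms(2) unfolding steep_def by linarith+
  then show "d2 (app w X) = ldeg w * d2 X" "d1 (app w X) < d2 (app w X)"
    using letter_degree(2,4)[OF assms(1)] by auto
qed

lemma word_steep:
  assumes "letters ws" "steep X"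
  shows "steep (app (word_map ws) X) \<and> d2 (app (word_map ws) X) = wdeg ws * d2 X \<and>
    (ws \<noteq> [] \<longrightarrow> d1 (app (word_map ws) X) < d2 (app (word_map ws) X))"
  using assms
proof (induction ws)
  case (Cons w ws)
  then have IH: "steep (app (word_map ws) X)" "d2 (app (word_map ws) X) = wdeg ws * d2 X"
    and w: "letter w" "letters ws" by simp_all
  show ?case
    unfolding app_word_Cons[OF w] using letter_steep[OF w(1) IH(1)] IH(2)
    by (simp add: steepI mult.assoc)
qed simp

text \<open>If neither \<open>X\<close> nor its image under the first letter is steep, leading terms
  have cancelled and \<open>d1 X = ldeg w * d2 X\<close>. The image then has degrees
  \<open>d2 X\<close> and less than \<open>d2 X\<close>, so \<open>d1 + d2\<close> drops; this can
  happen only boundedly often.\<close>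

lemma steep_eventually:
  assumes "letters ws" "nonconst X" "d1 X + d2 X < length ws"
  shows "d1 (app (word_map ws) X) < d2 (app (word_map ws) X)"
  using assms
proof (induction ws arbitrary: X rule: rev_induct)
  case (snoc w ws)
  show ?case
  proof (cases "steep X")
    case True
    from word_steep[OF snoc.prems(1) this] show ?thesis by blast
  next
    case False
    let ?X = "app w X"
    have w: "letter w" and ws: "letters ws" using snoc.prems by auto
    have eq: "app (word_map (ws @ [w])) X = app (word_map ws) ?X"
      using app_word_append[of ws "[w]"] w ws by simp
    have "ws \<noteq> []" using snoc.prems by auto
    have l2: "2 * d2 X \<le> ldeg w * d2 X" using letter_degree(1)[OF w] by simp
    show ?thesis
    proof (cases "steep ?X")
      case True
      then show ?thesis unfolding eq using word_steep[OF ws True] \<open>ws \<noteq> []\<close> by blast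
    next
      case nst: False
      have "d1 X = ldeg w * d2 X"
      proof (rule ccontr)
        assume "d1 X \<noteq> ldeg w * d2 X"
        from letter_degree(4)[OF w this] have "steep ?X"
          unfolding steep_def using letter_degree(2)[OF w, of X] l2 snoc.prems(2)
          by (intro conjI; linarith)
        then show False using nst by simp
      qed
      then have "d2 ?X < d2 X" "0 < d2 X" "2 * d2 X \<le> d1 X"
        using nst letter_degree(2)[OF w, of X] l2 snoc.prems(2) unfolding steep_def
        by (cases "d2 X = 0"; simp)+
      then show ?thesis
        unfolding eq using snoc.prems(3) letter_degree(2)[OF w, of X] by (intro snoc.IH[OF ws]) auto
    qed
  qed
qed simp

section \<open>Iterates of a word and the height\<close>

lemma word_map_funpow: "word_map ws ^^ n = word_map (concat (replicate n ws))"
  by (induction n) simp_all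

lemma wdeg_power: "wdeg (concat (replicate n ws)) = wdeg ws ^ n"
  by (induction n) simp_all

lemma letters_power: "letters ws \<Longrightarrow> letters (concat (replicate n ws))"
  by (induction n) simp_all

lemma length_power: "length (concat (replicate n ws)) = n * length ws"
  by (induction n) simp_all

lemma app_funpow_add:
  "poly_map F \<Longrightarrow> app (F ^^ (m + n)) X = app (F ^^ m) (app (F ^^ n) X)"
  by (simp add: funpow_add app_comp poly_map_funpow)

lemma funpow_steep:
  assumes "letters ws" "steep X"
  shows "steep (app (word_map ws ^^ n) X)" "d2 (app (word_map ws ^^ n) X) = wdeg ws ^ n * d2 X"
  using word_steep[OF letters_power[OF assms(1)] assms(2), of n]
  by (simp_all add: word_map_funpow wdeg_power)

lemma funpow_steep_eventually:
  assumes "letters ws" "ws \<noteq> []" "nonconst X" "d1 X + d2 X < n"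
  shows "d1 (app (word_map ws ^^ n) X) < d2 (app (word_map ws ^^ n) X)"
proof -
  have "n * 1 \<le> n * length ws"
    using assms(2) by (intro mult_le_mono) (auto simp: Suc_le_eq)
  then have "d1 X + d2 X < n * length ws" using assms(4) by linarith
  then show ?thesis
    unfolding word_map_funpow using assms(1,3)
    by (intro steep_eventually letters_power, simp_all only: length_power)
qed

text \<open>From step \<open>d1 X + d2 X + 1\<close> on, the degrees grow exactly geometrically.\<close>

definition hgt :: "pmap list \<Rightarrow> curve \<Rightarrow> real" where
  "hgt ws X = (let n = d1 X + d2 X + 1 in real (d2 (app (word_map ws ^^ n) X)) / real (wdeg ws) ^ n)"

text \<open>Any steep iterate may be used instead of the prescribed one: both continue to step
  \<open>m + n\<close>, and from a steep curve on growth is exact.\<close>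

lemma hgt_eq:
  assumes ws: "letters ws" "ws \<noteq> []" and pos: "nonconst X"
    and n: "steep (app (word_map ws ^^ n) X)"
  shows "hgt ws X = real (d2 (app (word_map ws ^^ n) X)) / real (wdeg ws) ^ n"
proof -
  define m where "m = d1 X + d2 X + 1"
  have m: "steep (app (word_map ws ^^ m) X)"
    using funpow_steep_eventually[OF ws pos, of m] by (auto simp: m_def steep_def)
  note pm = poly_map_letters[OF ws(1)]
  have "wdeg ws ^ m * d2 (app (word_map ws ^^ n) X) = wdeg ws ^ n * d2 (app (word_map ws ^^ m) X)"
    using funpow_steep(2)[OF ws(1) n, of m] funpow_steep(2)[OF ws(1) m, of n]
      app_funpow_add[OF pm, of m n X] app_funpow_add[OF pm, of n m X]
    by (simp add: add.commute)
  then have "real (wdeg ws) ^ m * real (d2 (app (word_map ws ^^ n) X)) = real (wdeg ws) ^ n * real (d2 (app (word_map ws ^^ m) X))"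
    by (metis of_nat_mult of_nat_power)
  moreover have "real (wdeg ws) > 0" using wdeg_pos[OF ws(1)] by simp
  ultimately show ?thesis
    unfolding hgt_def Let_def m_def[symmetric] by (simp add: field_simps)
qed

lemma hgt_steep:
  assumes "letters ws" "ws \<noteq> []" "steep X" shows "hgt ws X = d2 X"
  using hgt_eq[OF assms(1,2), of X 0] assms(3) by (simp add: steep_def)

lemma hgt_pos:
  assumes "letters ws" "ws \<noteq> []" "nonconst X" shows "0 < hgt ws X"
  using funpow_steep_eventually[OF assms, of "d1 X + d2 X + 1"] wdeg_pos[OF assms(1)]
  by (auto simp: hgt_def Let_def)

lemma hgt_growth:
  assumes "letters ws" "ws \<noteq> []" "nonconst X" "d1 X + d2 X < n"
  shows "real (d2 (app (word_map ws ^^ n) X)) = hgt ws X * real (wdeg ws) ^ n"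
proof -
  have "steep (app (word_map ws ^^ n) X)"
    using funpow_steep_eventually[OF assms] by (simp add: steep_def)
  then show ?thesis
    using hgt_eq[OF assms(1-3)] wdeg_pos[OF assms(1)] by simp
qed

text \<open>The letter \<open>w\<close> intertwines the two rotations of the word and multiplies
  \<open>d2\<close> of a steep iterate by \<open>ldeg w\<close>.\<close>

lemma hgt_rotate:
  assumes "letters (ws @ [w])" "nonconst X"
  shows "hgt (w # ws) (app w X) = ldeg w * hgt (ws @ [w]) X"
proof -
  have w: "letter w" and ws: "letters ws" using assms(1) by auto
  have ls: "letters (w # ws)" using w ws by simp
  have pw: "poly_map w" "poly_aut w" using w poly_autD(2) poly_aut_letter by auto
  define n where "n = Suc (d1 X + d2 X)"
  have n: "steep (app (word_map (ws @ [w]) ^^ n) X)"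
    using funpow_steep_eventually[OF assms(1) _ assms(2), of n] by (auto simp: n_def steep_def)
  have "word_map (w # ws) ^^ n \<circ> w = w \<circ> word_map (ws @ [w]) ^^ n" for n
    by (induction n) (simp_all add: fun_eq_iff)
  then have eq: "app (word_map (w # ws) ^^ n) (app w X) = app w (app (word_map (ws @ [w]) ^^ n) X)"
    using app_comp[OF poly_map_funpow[OF poly_map_letters[OF ls]] pw(1)]
      app_comp[OF pw(1) poly_map_funpow[OF poly_map_letters[OF assms(1)]]] by metis
  have "steep (app (word_map (w # ws) ^^ n) (app w X))"
    unfolding eq by (rule steepI[OF letter_steep(1)[OF w n]])
  from hgt_eq[OF ls _ app_nonconst[OF pw(2) assms(2)] this]
  have "hgt (w # ws) (app w X) = real (ldeg w * d2 (app (word_map (ws @ [w]) ^^ n) X)) / real (wdeg (w # ws)) ^ n"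
    unfolding eq letter_steep(2)[OF w n] by simp
  also have "\<dots> = ldeg w * hgt (ws @ [w]) X"
    using hgt_eq[OF assms(1) _ assms(2) n] by (simp add: mult.commute)
  finally show ?thesis .
qed

lemma hgt_vline:
  assumes "letters ws" "ws \<noteq> []" shows "hgt ws (vline c) = 1"
  using hgt_steep[OF assms, of "vline c"] by (simp add: steep_def)

text \<open>The letter applied first takes a horizontal line to a curve of degrees 0 and 1, the
  degrees of a vertical line; rotating back costs the factor \<open>ldeg w\<close>.\<close>

lemma hgt_hline:
  assumes "letters (ws @ [w])" shows "hgt (ws @ [w]) (hline c) = 1 / ldeg w"
proof -
  have w: "letter w" and ws: "letters ws" using assms by auto
  have "d1 (app w (hline c)) = 0" "d2 (app w (hline c)) = 1"
    using letter_degree(2,4)[OF w, of "hline c"] by simp_all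
  then have "hgt (w # ws) (app w (hline c)) = 1"
    using hgt_steep[of "w # ws" "app w (hline c)"] w ws by (simp add: steep_def)
  then show ?thesis using hgt_rotate[OF assms, of "hline c"] letter_degree(1)[OF w]
    by (simp add: field_simps)
qed

subsection \<open>Rigidity of conjugacies between words\<close>

lemma comp_conj_funpow:
  fixes \<phi> :: "'a \<Rightarrow> 'b"
  assumes "\<phi> \<circ> F = G \<circ> \<phi>" shows "\<phi> \<circ> F ^^ n = G ^^ n \<circ> \<phi>"
proof (induction n)
  case (Suc n)
  have "\<phi> \<circ> F ^^ Suc n = (\<phi> \<circ> F) \<circ> F ^^ n" by (simp add: comp_assoc)
  also have "\<dots> = G \<circ> (\<phi> \<circ> F ^^ n)" by (simp only: assms comp_assoc)
  finally show ?case by (simp only: Suc.IH funpow.simps comp_assoc)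
qed simp

text \<open>Inserting \<open>n0\<close> copies of the word before \<open>\<phi>\<close> brings its
  second component, nonconstant by surjectivity, into the range where no leading terms
  cancel.\<close>

lemma d2_app_dominated:
  assumes \<phi>: "poly_aut \<phi>" and ws: "letters ws" "ws \<noteq> []"
  shows "\<exists>n0 N. 0 < N \<and> (\<forall>X. d1 X < d2 X \<longrightarrow> d2 (app \<phi> (app (word_map ws ^^ n0) X)) = N * d2 X)"
proof -
  define f where "f = (\<lambda>z. snd (\<phi> z))"
  have f: "poly2 f" unfolding f_def using poly_mapD(2)[OF poly_autD(2)[OF \<phi>]] .
  have "\<not> (\<exists>k. f = (\<lambda>_. k))"
  proof
    assume "\<exists>k. f = (\<lambda>_. k)"
    then obtain k where "f = (\<lambda>_. k)" by (rule exE)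
    then have "f (inv \<phi> (0, k + 1)) = k" by simp
    then show False unfolding f_def poly_autD(6)[OF \<phi>] by simp
  qed
  from word_dominated[OF f this] obtain n0 where n0: "\<And>ws. n0 \<le> length ws \<Longrightarrow> (\<forall>w\<in>set ws. letter w) \<Longrightarrow>
    (\<exists>N>0. dominated (\<lambda>z. f (word_map ws z)) N)"
    by blast
  let ?us = "concat (replicate n0 ws)"
  have "n0 * 1 \<le> n0 * length ws"
    using ws(2) by (intro mult_le_mono) (auto simp: Suc_le_eq)
  then have "n0 \<le> length ?us" by (simp only: length_power)
  moreover have "\<forall>w\<in>set ?us. letter w" using letters_power[OF ws(1)] by (simp only: letters_def)
  ultimately obtain N where N: "0 < N"
    "\<And>p q h. degree p < degree q \<Longrightarrow> (\<forall>s. poly h s = f (word_map ?us (poly p s, poly q s))) \<Longrightarrow> degree h = N * degree q"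
    using n0 by blast
  have "d2 (app \<phi> (app (word_map ws ^^ n0) X)) = N * d2 X" if "d1 X < d2 X" for X
  proof (rule N(2)[OF that], rule allI)
    fix s
    let ?F = "word_map ws ^^ n0"
    have "cv (app \<phi> (app ?F X)) s = \<phi> (?F (cv X s))"
      using cv_app[OF poly_autD(2)[OF \<phi>]] cv_app[OF poly_map_funpow[OF poly_map_letters[OF ws(1)]]] by simp
    from arg_cong[OF this, of snd]
    show "poly (snd (app \<phi> (app ?F X))) s = f (word_map ?us (poly (fst X) s, poly (snd X) s))"
      by (simp add: cv_def f_def word_map_funpow)
  qed
  then show ?thesis using N(1) by blast
qed

text \<open>Evaluating \<open>\<phi> F^(n0+n) = G^(n0+n) \<phi>\<close> on \<open>X\<close> for
  large \<open>n\<close> relates the two heights through \<open>D'^(n0+n)\<close> and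
  \<open>N D^n\<close>. Comparing \<open>n\<close> with \<open>n + 1\<close> on one line gives
  \<open>D = D'\<close>, and \<open>C = N / D^n0\<close> remains.\<close>

lemma hgt_conj:
  assumes \<phi>: "poly_aut \<phi>" and ws: "letters ws" "ws \<noteq> []" and vs: "letters vs" "vs \<noteq> []"
    and conj: "\<phi> \<circ> word_map ws = word_map vs \<circ> \<phi>"
  shows "\<exists>C>0. \<forall>X. nonconst X \<longrightarrow> hgt vs (app \<phi> X) = C * hgt ws X"
proof -
  let ?F = "word_map ws" and ?G = "word_map vs"
  let ?D = "real (wdeg ws)" and ?D' = "real (wdeg vs)"
  have D: "0 < ?D" "0 < ?D'" using wdeg_pos ws(1) vs(1) by auto
  obtain n0 N where N: "0 < N" "\<And>X. d1 X < d2 X \<Longrightarrow> d2 (app \<phi> (app (?F ^^ n0) X)) = N * d2 X"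
    using d2_app_dominated[OF \<phi> ws] by blast
  have key: "hgt vs (app \<phi> X) * ?D' ^ (n0 + n) = N * hgt ws X * ?D ^ n"
    if pos: "nonconst X" and n: "d1 X + d2 X + d1 (app \<phi> X) + d2 (app \<phi> X) < n" for X n
  proof -
    have "app (?G ^^ (n0 + n)) (app \<phi> X) = app (\<phi> \<circ> ?F ^^ (n0 + n)) X"
      unfolding comp_conj_funpow[OF conj]
      by (rule app_comp[symmetric]) (auto intro: poly_map_funpow poly_map_letters vs(1) poly_autD(2) \<phi>)
    also have "\<dots> = app \<phi> (app (?F ^^ n0) (app (?F ^^ n) X))"
      unfolding app_comp[OF poly_autD(2)[OF \<phi>] poly_map_funpow[OF poly_map_letters[OF ws(1)]]]
        app_funpow_add[OF poly_map_letters[OF ws(1)]] ..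
    also have "d2 \<dots> = N * d2 (app (?F ^^ n) X)"
      using funpow_steep_eventually[OF ws pos] n by (intro N(2)) simp
    finally have "real (d2 (app (?G ^^ (n0 + n)) (app \<phi> X))) = N * real (d2 (app (?F ^^ n) X))"
      by simp
    then show ?thesis
      using hgt_growth[OF ws pos, of n] hgt_growth[OF vs app_nonconst[OF \<phi> pos], of "n0 + n"] n by simp
  qed
  have DD: "?D' = ?D"
  proof -
    let ?X = "vline 0"
    define n where "n = Suc (d1 ?X + d2 ?X + d1 (app \<phi> ?X) + d2 (app \<phi> ?X))"
    have pos: "nonconst ?X" by simp
    have "0 < hgt vs (app \<phi> ?X)" by (rule hgt_pos[OF vs app_nonconst[OF \<phi> pos]])
    then have "0 < hgt vs (app \<phi> ?X) * ?D' ^ (n0 + n)" using D by simp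
    moreover have "hgt vs (app \<phi> ?X) * ?D' ^ (n0 + n) = N * hgt ws ?X * ?D ^ n"
      by (rule key[OF pos]) (simp add: n_def)
    moreover have "hgt vs (app \<phi> ?X) * ?D' ^ (n0 + Suc n) = N * hgt ws ?X * ?D ^ Suc n"
      by (rule key[OF pos]) (simp add: n_def)
    then have "(hgt vs (app \<phi> ?X) * ?D' ^ (n0 + n)) * ?D' = (N * hgt ws ?X * ?D ^ n) * ?D"
      by (simp add: mult_ac)
    ultimately show ?thesis by (metis less_irrefl mult_left_cancel)
  qed
  have "hgt vs (app \<phi> X) = (N / ?D ^ n0) * hgt ws X" if "nonconst X" for X
  proof -
    define n where "n = Suc (d1 X + d2 X + d1 (app \<phi> X) + d2 (app \<phi> X))"
    have "hgt vs (app \<phi> X) * ?D ^ n0 * ?D ^ n = N * hgt ws X * ?D ^ n"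
      using key[OF that, of n] unfolding DD by (simp add: n_def power_add mult.assoc)
    then have "hgt vs (app \<phi> X) * ?D ^ n0 = N * hgt ws X" using D by simp
    then show ?thesis using D by (simp add: field_simps)
  qed
  moreover have "0 < N / ?D ^ n0" using N(1) D by simp
  ultimately show ?thesis by blast
qed

section \<open>Backward iteration and diagonal conjugacies\<close>

definition hats :: "pmap list \<Rightarrow> pmap list" where
  "hats ws = map hat (rev ws)"

lemma letters_hats: "letters ws \<Longrightarrow> letters (hats ws)"
  by (auto simp: letters_def hats_def letter_hat)

lemma word_map_hats:
  "letters ws \<Longrightarrow> word_map (hats ws) = tswap \<circ> inv (word_map ws) \<circ> tswap"
proof (induction ws)
  case (Cons w ws)
  then have "bij w" "bij (word_map ws)"
    using poly_autD(1) poly_aut_letter poly_aut_letters by auto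
  have "word_map (hats (w # ws)) = word_map (hats ws) \<circ> hat w"
    by (simp add: hats_def)
  also have "\<dots> = tswap \<circ> inv (word_map ws) \<circ> (tswap \<circ> tswap) \<circ> inv w \<circ> tswap"
    using Cons by (simp only: hat_def comp_assoc letters_simps)
  also have "\<dots> = tswap \<circ> inv (word_map (w # ws)) \<circ> tswap"
    using \<open>bij w\<close> \<open>bij (word_map ws)\<close> by (simp add: o_inv_distrib comp_assoc)
  finally show ?case .
qed (simp add: hats_def)

lemma hats_conj:
  assumes \<phi>: "poly_aut \<phi>" and ws: "letters ws" and vs: "letters vs"
    and conj: "\<phi> \<circ> word_map ws = word_map vs \<circ> \<phi>"
  shows "(tswap \<circ> \<phi> \<circ> tswap) \<circ> word_map (hats ws) = word_map (hats vs) \<circ> (tswap \<circ> \<phi> \<circ> tswap)"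
proof -
  note W = poly_autD[OF poly_aut_letters[OF ws]] and V = poly_autD[OF poly_aut_letters[OF vs]]
  have "\<phi> (word_map ws z) = word_map vs (\<phi> z)" for z
    using fun_cong[OF conj, of z] by simp
  then have "\<phi> (inv (word_map ws) z) = inv (word_map vs) (\<phi> z)" for z
    by (metis W(6) V(7))
  then show ?thesis
    unfolding word_map_hats[OF ws] word_map_hats[OF vs] by (simp add: fun_eq_iff)
qed

abbreviation sw :: "curve \<Rightarrow> curve" where "sw X \<equiv> (snd X, fst X)"

lemma app_swap_conj:
  assumes "poly_map \<phi>" shows "app (tswap \<circ> \<phi> \<circ> tswap) X = sw (app \<phi> (sw X))"
  using assms poly_autD(2)[OF poly_aut_tswap]
  by (simp add: app_comp poly_map_comp app_tswap)

text \<open>A steep curve has height \<open>d2 X\<close>, a positive integer.\<close>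

lemma hgt_less_1:
  assumes "letters ws" "ws \<noteq> []" "nonconst X" "hgt ws X < 1"
  shows "d2 X < d1 X"
proof (rule ccontr)
  assume "\<not> d2 X < d1 X"
  then have "steep X" unfolding steep_def using assms(3) by (intro conjI; linarith)
  then show False using hgt_steep[OF assms(1,2)] assms(4) by (simp add: steep_def)
qed

lemma hgt_hline_less_1:
  assumes "letters ws" "ws \<noteq> []" shows "hgt ws (hline c) < 1"
proof -
  obtain us w where ws: "ws = us @ [w]" using assms(2) rev_exhaust by blast
  then have "2 \<le> ldeg w" using assms(1) letter_degree(1) by simp
  then show ?thesis using hgt_hline assms(1) unfolding ws by simp
qed

definition diag :: "pmap \<Rightarrow> bool" where
  "diag s \<longleftrightarrow> (\<exists>a c b d. a \<noteq> 0 \<and> b \<noteq> 0 \<and> s = dg a c b d)"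

lemma diag_dg: "a \<noteq> 0 \<Longrightarrow> b \<noteq> 0 \<Longrightarrow> diag (dg a c b d)"
  by (auto simp: diag_def)

lemma diagE:
  assumes "diag s" obtains a c b d where "a \<noteq> 0" "b \<noteq> 0" "s = dg a c b d"
  using assms unfolding diag_def by blast

text \<open>The first component is constant on vertical lines and the second on horizontal ones, so
  the variables separate; on the two axes each component has degree 1.\<close>

lemma diag_if_lines:
  assumes \<phi>: "poly_map \<phi>"
    and v: "\<And>c. d1 (app \<phi> (vline c)) = 0 \<and> d2 (app \<phi> (vline c)) = 1"
    and h: "\<And>c. d1 (app \<phi> (hline c)) = 1 \<and> d2 (app \<phi> (hline c)) = 0"
  shows "diag \<phi>"
proof -
  have deg0: "poly p x = poly p y" if "degree p = 0" for p :: "complex poly" and x y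
    using that by (elim degree_eq_zeroE) simp
  have deg1: "\<exists>a b. a \<noteq> 0 \<and> p = [:b, a:]" if "degree p = 1" for p :: "complex poly"
    by (rule degree1_coeffs[OF that]) blast
  have ev: "cv (app \<phi> (vline c)) s = \<phi> (c, s)" "cv (app \<phi> (hline c)) s = \<phi> (s, c)" for c s
    by (simp_all add: cv_app[OF \<phi>]) (simp_all add: cv_def)
  have fst: "fst (\<phi> (x, y)) = fst (\<phi> (x, 0))" for x y
    using deg0[OF conjunct1[OF v[of x]], of y 0] by (simp flip: ev add: cv_def)
  have snd: "snd (\<phi> (x, y)) = snd (\<phi> (0, y))" for x y
    using deg0[OF conjunct2[OF h[of y]], of x 0] by (simp flip: ev(2) add: cv_def)
  obtain a c where a: "a \<noteq> 0" "fst (app \<phi> (hline 0)) = [:c, a:]"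
    using deg1[OF conjunct1[OF h[of 0]]] by blast
  obtain b d where b: "b \<noteq> 0" "snd (app \<phi> (vline 0)) = [:d, b:]"
    using deg1[OF conjunct2[OF v[of 0]]] by blast
  have "\<phi> (x, y) = dg a c b d (x, y)" for x y
  proof (rule prod_eqI)
    show "fst (\<phi> (x, y)) = fst (dg a c b d (x, y))"
      using fst[of x y] ev(2)[of 0 x] a(2) by (simp add: cv_def prod_eq_iff mult.commute add.commute)
    show "snd (\<phi> (x, y)) = snd (dg a c b d (x, y))"
      using snd[of x y] ev(1)[of 0 y] b(2) by (simp add: cv_def prod_eq_iff mult.commute add.commute)
  qed
  then have "\<phi> = dg a c b d" by (simp add: fun_eq_iff)
  then show ?thesis using diag_dg[OF a(1) b(1)] by simp
qed

text \<open>A rotation of the word rescales the factor \<open>C\<close> by a letter degree. Once \<open>1 \<le> C < d\<close>, where \<open>d\<close> is the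
  degree of the letter applied first, comparing the images of horizontal and vertical lines under the conjugacy
  and its inverse, forwards and backwards, shows that both factors are \<open>1\<close>.\<close>

lemma diag_if_normalised:
  assumes \<phi>: "poly_aut \<phi>" and wsw: "letters (ws @ [w])" and vs: "letters vs" "vs \<noteq> []"
    and conj: "\<phi> \<circ> word_map (ws @ [w]) = word_map vs \<circ> \<phi>"
    and C: "\<And>X. nonconst X \<Longrightarrow> hgt vs (app \<phi> X) = C * hgt (ws @ [w]) X"
    and C1: "1 \<le> C" "C < ldeg w"
  shows "diag \<phi>"
proof -
  let ?ws = "ws @ [w]"
  define hws hvs where "hws = hats ?ws" and "hvs = hats vs"
  have H: "letters hws" "hws \<noteq> []" "letters hvs" "hvs \<noteq> []"
    using letters_hats[OF wsw] letters_hats[OF vs(1)] vs(2) by (auto simp: hws_def hvs_def hats_def)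
  have ws: "?ws \<noteq> []" by simp
  have t\<phi>: "poly_aut (tswap \<circ> \<phi> \<circ> tswap)"
    by (intro poly_aut_comp poly_aut_tswap \<phi>)
  obtain C' where C': "0 < C'"
    "\<And>X. nonconst X \<Longrightarrow> hgt hvs (app (tswap \<circ> \<phi> \<circ> tswap) X) = C' * hgt hws X"
    using hgt_conj[OF t\<phi> H(1-4)] hats_conj[OF \<phi> wsw vs(1) conj] unfolding hws_def hvs_def by blast
  have C'2: "hgt hvs (sw (app \<phi> X)) = C' * hgt hws (sw X)" if "nonconst X" for X
    using C'(2)[of "sw X"] that by (simp add: app_swap_conj[OF poly_autD(2)[OF \<phi>]] add.commute)
  let ?\<psi> = "inv \<phi>"
  have \<psi>: "poly_aut ?\<psi>" by (rule poly_aut_inv[OF \<phi>])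
  have \<phi>\<psi>: "app \<phi> (app ?\<psi> X) = X" for X
    using app_comp[OF poly_autD(2)[OF \<phi>] poly_autD(2)[OF \<psi>], of X] poly_autD(4)[OF \<phi>] by simp
  have nc: "nonconst (app F (vline c))" "nonconst (app F (hline c))"
    if "poly_aut F" for F c
    by (rule app_nonconst[OF that], simp)+
  have i\<psi>: "C * hgt ?ws (app ?\<psi> (vline c)) = hgt vs (vline c)"
    "C * hgt ?ws (app ?\<psi> (hline c)) = hgt vs (hline c)"
    "C' * hgt hws (sw (app ?\<psi> (vline c))) = hgt hvs (hline c)"
    "C' * hgt hws (sw (app ?\<psi> (hline c))) = hgt hvs (vline c)" for c
    using C[OF nc(1)[OF \<psi>, of c]] C[OF nc(2)[OF \<psi>, of c]] C'2[OF nc(1)[OF \<psi>, of c]] C'2[OF nc(2)[OF \<psi>, of c]]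
    unfolding \<phi>\<psi> by simp_all
  have d: "2 \<le> ldeg w" using wsw letter_degree(1) by simp
  \<comment> \<open>\<open>C < ldeg w\<close> pushes the image of a horizontal line below height 1,
    so its swap is steep and its backward height is the integer \<open>d1\<close>. The swapped line
    is vertical, of height 1, so this integer is \<open>C'\<close>.\<close>
  have h1: "d2 (app \<phi> (hline c)) < d1 (app \<phi> (hline c)) \<and> real (d1 (app \<phi> (hline c))) = C'" for c
  proof -
    let ?X = "app \<phi> (hline c)"
    have "hgt vs ?X = C * (1 / ldeg w)" using C[of "hline c"] hgt_hline[OF wsw] by simp
    also have "\<dots> < 1" using C1 d by (simp add: field_simps)
    finally have lt: "d2 ?X < d1 ?X" by (rule hgt_less_1[OF vs nc(2)[OF \<phi>]])
    then have "hgt hvs (sw ?X) = d1 ?X" using hgt_steep[OF H(3,4), of "sw ?X"] by (simp add: steep_def)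
    then show ?thesis using C'2[of "hline c"] hgt_vline[OF H(1,2)] lt by simp
  qed
  have "1 \<le> C'" using h1[of 0] by linarith
  \<comment> \<open>Since \<open>C' \<ge> 1\<close>, the preimage of a vertical line has backward
    height below 1 and is therefore steep forwards. Its height is an integer
    \<open>d2 \<ge> 1\<close> with \<open>C * d2 = 1\<close>.\<close>
  have "C = 1"
  proof -
    let ?X = "app ?\<psi> (vline 0)"
    have "C' * hgt hws (sw ?X) < 1" unfolding i\<psi> by (rule hgt_hline_less_1[OF H(3,4)])
    moreover have "1 * hgt hws (sw ?X) \<le> C' * hgt hws (sw ?X)"
      using \<open>1 \<le> C'\<close> hgt_pos[OF H(1,2), of "sw ?X"] nc(1)[OF \<psi>, of 0]
      by (intro mult_right_mono) (simp_all add: add.commute)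
    ultimately have "hgt hws (sw ?X) < 1" by simp
    then have lt: "d1 ?X < d2 ?X"
      using hgt_less_1[OF H(1,2), of "sw ?X"] nc(1)[OF \<psi>, of 0] by (simp add: add.commute)
    then have "hgt ?ws ?X = d2 ?X" by (intro hgt_steep[OF wsw ws] steepI)
    then have "C * d2 ?X = 1" using i\<psi>(1)[of 0] hgt_vline[OF vs, of 0] by simp
    moreover have "C * 1 \<le> C * d2 ?X" using lt C1(1) by (intro mult_left_mono) auto
    ultimately show ?thesis using C1(1) by simp
  qed
  have "C' = 1"
  proof -
    let ?X = "app ?\<psi> (hline 0)"
    have "hgt ?ws ?X < 1" using i\<psi>(2)[of 0] hgt_hline_less_1[OF vs, of 0] by (simp add: \<open>C = 1\<close>)
    then have lt: "d2 ?X < d1 ?X" by (rule hgt_less_1[OF wsw ws nc(2)[OF \<psi>]])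
    then have "hgt hws (sw ?X) = d1 ?X" using hgt_steep[OF H(1,2), of "sw ?X"] by (simp add: steep_def)
    then have "C' * d1 ?X = 1" using i\<psi>(4)[of 0] hgt_vline[OF H(3,4), of 0] by simp
    moreover have "C' * 1 \<le> C' * d1 ?X" using lt \<open>1 \<le> C'\<close> by (intro mult_left_mono) auto
    ultimately show ?thesis using \<open>1 \<le> C'\<close> by simp
  qed
  have v1: "d1 (app \<phi> (vline c)) < d2 (app \<phi> (vline c)) \<and> d2 (app \<phi> (vline c)) = 1" for c
  proof -
    let ?X = "app \<phi> (vline c)"
    have "hgt hvs (sw ?X) < 1"
      using C'2[of "vline c"] hgt_hline_less_1[OF H(1,2), of c] by (simp add: \<open>C' = 1\<close>)
    then have lt: "d1 ?X < d2 ?X"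
      using hgt_less_1[OF H(3,4), of "sw ?X"] nc(1)[OF \<phi>, of c] by (simp add: add.commute)
    then have "hgt vs ?X = d2 ?X" by (intro hgt_steep[OF vs] steepI)
    then show ?thesis using lt C[of "vline c"] hgt_vline[OF wsw ws] by (simp add: \<open>C = 1\<close>)
  qed
  show ?thesis
  proof (rule diag_if_lines[OF poly_autD(2)[OF \<phi>]])
    show "d1 (app \<phi> (vline c)) = 0 \<and> d2 (app \<phi> (vline c)) = 1" for c using v1[of c] by simp
    show "d1 (app \<phi> (hline c)) = 1 \<and> d2 (app \<phi> (hline c)) = 0" for c
      using h1[of c] by (simp add: \<open>C' = 1\<close>)
  qed
qed

lemma hgt_funpow:
  assumes ws: "letters ws" "ws \<noteq> []" and pos: "nonconst X"
  shows "hgt ws (app (word_map ws ^^ n) X) = wdeg ws ^ n * hgt ws X"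
proof -
  let ?F = "word_map ws"
  define m where "m = Suc (d1 X + d2 X)"
  have st: "steep (app (?F ^^ (m + n)) X)"
    using funpow_steep_eventually[OF ws pos, of "m + n"] by (simp add: m_def steep_def)
  have "poly_aut (?F ^^ n)" unfolding word_map_funpow by (rule poly_aut_letters[OF letters_power[OF ws(1)]])
  from hgt_eq[OF ws app_nonconst[OF this pos], of m]
  have "hgt ws (app (?F ^^ n) X) = real (d2 (app (?F ^^ (m + n)) X)) / real (wdeg ws) ^ m"
    using st by (simp add: app_funpow_add[OF poly_map_letters[OF ws(1)]])
  then show ?thesis
    using hgt_eq[OF ws pos st] wdeg_pos[OF ws(1)] by (simp add: power_add)
qed

text \<open>As long as \<open>C \<ge> ldeg w\<close>, moving the first applied letter
  \<open>w\<close> to the other end and replacing \<open>\<phi>\<close> by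
  \<open>\<phi> \<circ> inv w\<close> divides \<open>C\<close> by \<open>ldeg w \<ge> 2\<close> and
  keeps it at least 1. The bound \<open>2 ^ n\<close> limits the number of rotations.\<close>

lemma rigidity_aux:
  assumes "poly_aut \<phi>" "letters ws" "ws \<noteq> []" "letters vs" "vs \<noteq> []"
    and "\<phi> \<circ> word_map ws = word_map vs \<circ> \<phi>"
    and "\<And>X. nonconst X \<Longrightarrow> hgt vs (app \<phi> X) = C * hgt ws X"
    and "1 \<le> C" "C < 2 ^ n"
  shows "\<exists>us s. mset us = mset ws \<and> diag s \<and> s \<circ> word_map us = word_map vs \<circ> s"
  using assms
proof (induction n arbitrary: \<phi> ws C)
  case (Suc n)
  note \<phi> = \<open>poly_aut \<phi>\<close>
  obtain us w where ws: "ws = us @ [w]" using \<open>ws \<noteq> []\<close> rev_exhaust by blast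
  have lw: "letter w" "letters us" using \<open>letters ws\<close> ws by auto
  have lws: "letters (us @ [w])" using lw by simp
  show ?case
  proof (cases "C < ldeg w")
    case True
    then have "diag \<phi>"
      using diag_if_normalised[OF \<phi> lws \<open>letters vs\<close> \<open>vs \<noteq> []\<close>] Suc.prems(6,7,8) unfolding ws by blast
    then show ?thesis using Suc.prems(6) by blast
  next
    case False
    have d: "2 \<le> real (ldeg w)" using letter_degree(1)[OF lw(1)] by simp
    have pw: "poly_aut (inv w)" using poly_aut_inv[OF poly_aut_letter[OF lw(1)]] .
    note w = poly_autD[OF poly_aut_letter[OF lw(1)]]
    let ?\<phi> = "\<phi> \<circ> inv w" and ?ws = "w # us"
    have "\<phi> (word_map us (w z)) = word_map vs (\<phi> z)" for z
      using fun_cong[OF Suc.prems(6), of z] ws by simp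
    then have "\<phi> (word_map us z) = word_map vs (\<phi> (inv w z))" for z
      by (metis w(6))
    then have conj: "?\<phi> \<circ> word_map ?ws = word_map vs \<circ> ?\<phi>"
      by (simp add: fun_eq_iff w(7))
    have hgt: "hgt vs (app ?\<phi> X) = C / ldeg w * hgt ?ws X" if "nonconst X" for X
    proof -
      have nc: "nonconst (app (inv w) X)" by (rule app_nonconst[OF pw that])
      have "app w (app (inv w) X) = X"
        using app_comp[OF w(2,3), of X] w(4) by simp
      then have "hgt ?ws X = ldeg w * hgt ws (app (inv w) X)"
        using hgt_rotate[OF lws nc] ws by simp
      moreover have "hgt vs (app ?\<phi> X) = C * hgt ws (app (inv w) X)"
        unfolding app_comp[OF poly_autD(2)[OF \<phi>] w(3)] by (rule Suc.prems(7)[OF nc])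
      ultimately show ?thesis using d by simp
    qed
    have "C / ldeg w \<le> C / 2" using d Suc.prems(8) by (intro divide_left_mono) auto
    also have "\<dots> < 2 ^ n" using Suc.prems(9) by simp
    finally have "C / ldeg w < 2 ^ n" .
    moreover have "1 \<le> C / ldeg w" using False d by (simp add: field_simps)
    ultimately have "\<exists>us' s. mset us' = mset ?ws \<and> diag s \<and> s \<circ> word_map us' = word_map vs \<circ> s"
      by (intro Suc.IH[OF poly_aut_comp[OF \<phi> pw] _ _ Suc.prems(4,5) conj hgt])
        (simp_all only: letters_simps lw simp_thms list.distinct)
    moreover have eq: "mset ?ws = mset ws" using ws by simp
    ultimately show ?thesis by (simp only: eq)
  qed
qed simp

text \<open>Composing \<open>\<phi>\<close> with a power of the word gives another conjugacy and
  multiplies \<open>C\<close> by a power of \<open>wdeg ws\<close>, so \<open>C \<ge> 1\<close> may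
  be assumed.\<close>

theorem rigidity:
  assumes \<phi>: "poly_aut \<phi>" and ws: "letters ws" "ws \<noteq> []" and vs: "letters vs" "vs \<noteq> []"
    and conj: "\<phi> \<circ> word_map ws = word_map vs \<circ> \<phi>"
  shows "\<exists>us s. mset us = mset ws \<and> diag s \<and> s \<circ> word_map us = word_map vs \<circ> s"
proof -
  obtain C where C: "0 < C" "\<And>X. nonconst X \<Longrightarrow> hgt vs (app \<phi> X) = C * hgt ws X"
    using hgt_conj[OF \<phi> ws vs conj] by blast
  have "2 \<le> real (wdeg ws)" using wdeg_ge2[OF ws] by simp
  then obtain n where "1 / C < real (wdeg ws) ^ n"
    using real_arch_pow[of "real (wdeg ws)" "1 / C"] by auto
  then have n: "1 \<le> C * wdeg ws ^ n" using C(1) by (simp add: field_simps)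
  let ?F = "word_map ws"
  have pF: "poly_aut (?F ^^ n)" unfolding word_map_funpow by (rule poly_aut_letters[OF letters_power[OF ws(1)]])
  have "hgt vs (app (\<phi> \<circ> ?F ^^ n) X) = (C * wdeg ws ^ n) * hgt ws X" if "nonconst X" for X
    unfolding app_comp[OF poly_autD(2)[OF \<phi>] poly_autD(2)[OF pF]]
    using C(2)[OF app_nonconst[OF pF that]] hgt_funpow[OF ws that] by simp
  moreover have "(\<phi> \<circ> ?F ^^ n) \<circ> ?F = word_map vs \<circ> (\<phi> \<circ> ?F ^^ n)"
  proof -
    have "(\<phi> \<circ> ?F ^^ n) \<circ> ?F = (\<phi> \<circ> ?F) \<circ> ?F ^^ n"
      by (simp add: comp_assoc funpow_swap1 fun_eq_iff)
    then show ?thesis by (simp only: conj comp_assoc)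
  qed
  moreover obtain m where "C * wdeg ws ^ n < 2 ^ m"
    using real_arch_pow[of 2 "C * wdeg ws ^ n"] by auto
  ultimately show ?thesis
    using rigidity_aux[OF poly_aut_comp[OF \<phi> pF] ws vs _ _ n] by blast
qed

subsection \<open>Uniqueness of factorisations up to diagonal maps\<close>

text \<open>Shears in x measure how two letters differ on the left: every letter is a shear after
  any other one (\<open>lm_shear\<close>).\<close>

definition shear :: "complex \<Rightarrow> complex \<Rightarrow> complex \<Rightarrow> complex poly \<Rightarrow> pmap" where
  "shear a c b q = (\<lambda>(x, y). (a * x + c, b * y + poly q x))"

lemma poly_map_shear: "poly_map (shear a c b q)"
  by (auto intro!: poly_mapI poly2_add poly2_mult poly2_const poly2_fst poly2_snd poly2_poly
      simp: shear_def case_prod_beta)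

lemma app_shear: "app (shear a c b q) X = (smult a (fst X) + [:c:], smult b (snd X) + pcompose q (fst X))"
  by (rule app_eqI) (auto simp: cv_def fun_eq_iff poly_pcompose shear_def)

lemma shear_inverse:
  assumes "a \<noteq> 0" "b \<noteq> 0"
  shows "shear a c b q \<circ> shear (1/a) (-c/a) (1/b) (smult (-1/b) (pcompose q [:-c/a, 1/a:])) = id"
  using assms by (auto simp: fun_eq_iff shear_def poly_pcompose field_simps)

lemma poly_aut_diag: "diag s \<Longrightarrow> poly_aut s"
  by (elim diagE) (simp add: poly_aut_dg)

lemma d2_app_diag:
  assumes "diag s" shows "d1 (app s X) = d1 X" "d2 (app s X) = d2 X"
  using assms by (auto elim!: diagE simp: app_dg)

lemma d2_word_hline:
  assumes "letters us" shows "d2 (app (word_map us) (hline c)) < wdeg us"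
proof (cases us rule: rev_cases)
  case (snoc ws w)
  then have w: "letter w" "letters ws" using assms by auto
  have d: "d1 (app w (hline c)) = 0" "d2 (app w (hline c)) = 1"
    using letter_degree(2,4)[OF w(1), of "hline c"] by simp_all
  then have "steep (app w (hline c))" by (simp add: steep_def)
  from word_steep[OF w(2) this] have "d2 (app (word_map us) (hline c)) = wdeg ws"
    using app_word_append[of ws "[w]" "hline c"] w d by (simp add: snoc)
  moreover have "wdeg ws * 1 < wdeg ws * ldeg w"
    using wdeg_pos[OF w(2)] letter_degree(1)[OF w(1)] by (intro mult_strict_left_mono) auto
  ultimately show ?thesis by (simp add: snoc)
qed simp

text \<open>Evaluated on a horizontal line, the shear produces a steep curve, so the right side has
  degree at least \<open>wdeg vs\<close>; the left side loses the degree of its first applied letter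
  and stays below \<open>wdeg us\<close>.\<close>

lemma shear_wdeg_less:
  assumes us: "letters us" and vs: "letters vs" and s: "diag s" "diag s'" and a: "a \<noteq> 0"
    and eq: "s \<circ> word_map us = s' \<circ> word_map vs \<circ> shear a c b q" and q: "0 < degree q"
  shows "wdeg vs < wdeg us"
proof -
  let ?X = "app (shear a c b q) (hline 0)"
  have X: "d1 ?X = 1" "d2 ?X = degree q"
    using a by (simp_all add: app_shear)
  then have "steep ?X" using q by (simp add: steep_def)
  from word_steep[OF vs this] have "d2 (app (word_map vs) ?X) = wdeg vs * degree q"
    using X(2) by simp
  moreover have "d2 (app (word_map us) (hline 0)) = d2 (app (word_map vs) ?X)"
  proof -
    note pm = poly_map_letters[OF us] poly_map_letters[OF vs] poly_autD(2)[OF poly_aut_diag[OF s(1)]]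
      poly_autD(2)[OF poly_aut_diag[OF s(2)]]
    have "app s (app (word_map us) (hline 0)) = app (s \<circ> word_map us) (hline 0)"
      by (simp add: app_comp pm)
    also have "\<dots> = app s' (app (word_map vs) ?X)"
      unfolding eq by (simp add: app_comp poly_map_comp pm poly_map_shear)
    finally show ?thesis using d2_app_diag(2)[OF s(1)] d2_app_diag(2)[OF s(2)] by metis
  qed
  moreover have "wdeg vs * 1 \<le> wdeg vs * degree q" using q by (intro mult_le_mono) auto
  ultimately show ?thesis using d2_word_hline[OF us, of 0] by linarith
qed

text \<open>The inverse of a shear is a shear of the same degree. A nonconstant \<open>q\<close>
  would make each of the two word degrees smaller than the other.\<close>

lemma shear_diag:
  assumes us: "letters us" and vs: "letters vs" and s: "diag s" and ab: "a \<noteq> 0" "b \<noteq> 0"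
    and eq: "s \<circ> word_map us = word_map vs \<circ> shear a c b q"
  shows "diag (shear a c b q)"
proof -
  have id: "diag id"
    using diag_dg[of 1 1 0 0] by (simp add: dg_def id_def case_prod_eta)
  have "degree q = 0"
  proof (rule ccontr)
    assume "degree q \<noteq> 0"
    let ?q = "smult (-1/b) (pcompose q [:-c/a, 1/a:])"
    let ?\<rho> = "shear (1/a) (-c/a) (1/b) ?q"
    have "id \<circ> word_map vs = s \<circ> word_map us \<circ> ?\<rho>"
      unfolding eq using shear_inverse[OF ab, of c q] by (simp add: comp_assoc)
    moreover have "0 < degree ?q" using \<open>degree q \<noteq> 0\<close> ab by (simp add: degree_pcompose)
    moreover have "s \<circ> word_map us = id \<circ> word_map vs \<circ> shear a c b q"
      using eq by simp
    ultimately have "wdeg us < wdeg vs" "wdeg vs < wdeg us"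
      using shear_wdeg_less[OF vs us id s, of "1/a" "-c/a" "1/b" ?q]
        shear_wdeg_less[OF us vs s id ab(1), of c b q] ab \<open>degree q \<noteq> 0\<close> by auto
    then show False by simp
  qed
  then obtain d where "q = [:d:]" by (rule degree_eq_zeroE)
  then have "shear a c b q = dg a c b d" by (simp add: shear_def dg_def)
  then show ?thesis using diag_dg ab by simp
qed

lemma lm_dg: "lm e k a p \<circ> dg a' c b d = lm (e * b) (e * d + k) (a * a') (pcompose p [:d, b:] + [:a * c:])"
  by (auto simp: fun_eq_iff poly_pcompose algebra_simps)

lemma lm_shear:
  assumes "e \<noteq> 0" "a \<noteq> 0"
  shows "lm e' k' a' p' = shear (e'/e) (k' - e' * k / e) (a'/a) (pcompose (p' - smult (a'/a) p) [:-k/e, 1/e:]) \<circ> lm e k a p"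
  using assms by (auto simp: fun_eq_iff shear_def poly_pcompose field_simps)

text \<open>The letters \<open>w\<close> and \<open>v \<circ> s'\<close> differ by a shear on the
  left. Cancelling the surjective \<open>w\<close> leaves a relation between shorter words, in which
  \<open>shear_diag\<close> makes the shear diagonal.\<close>

lemma peel_letter:
  assumes us: "letters us" and vs: "letters vs" and w: "letter w" and v: "letter v"
    and s: "diag s" "diag s'"
    and eq: "s \<circ> word_map us \<circ> w = word_map vs \<circ> v \<circ> s'"
  shows "\<exists>\<rho>. diag \<rho> \<and> v \<circ> s' = \<rho> \<circ> w \<and> s \<circ> word_map us = word_map vs \<circ> \<rho>"
proof -
  obtain e k a p where W: "e \<noteq> 0" "a \<noteq> 0" "w = lm e k a p"
    using w unfolding letter_def by blast
  obtain e' k' a' p' where V: "e' \<noteq> 0" "a' \<noteq> 0" "v = lm e' k' a' p'"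
    using v unfolding letter_def by blast
  obtain a0 c0 b0 d0 where S: "a0 \<noteq> 0" "b0 \<noteq> 0" "s' = dg a0 c0 b0 d0"
    using s(2) by (rule diagE)
  obtain A c B q where \<rho>: "A \<noteq> 0" "B \<noteq> 0" "v \<circ> s' = shear A c B q \<circ> w"
    unfolding V(3) S(3) W(3) lm_dg
    using lm_shear[OF W(1,2), of "e' * b0" "e' * d0 + k'" "a' * a0" "pcompose p' [:d0, b0:] + [:a' * c0:]" k p]
      W(1,2) V(1,2) S(1,2) by (metis divide_eq_0_iff mult_eq_0_iff)
  have "s (word_map us (w z)) = word_map vs (shear A c B q (w z))" for z
    using fun_cong[OF eq, of z] fun_cong[OF \<rho>(3), of z] by simp
  then have "s (word_map us z) = word_map vs (shear A c B q z)" for z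
    using poly_autD(6)[OF poly_aut_letter[OF w], of z] by metis
  then have "s \<circ> word_map us = word_map vs \<circ> shear A c B q" by (simp add: fun_eq_iff)
  moreover from shear_diag[OF us vs s(1) \<rho>(1,2) this] have "diag (shear A c B q)" .
  ultimately show ?thesis using \<rho>(3) by blast
qed

lemma wdeg_eq:
  assumes us: "letters us" and vs: "letters vs" and s: "diag s" "diag s'"
    and eq: "s \<circ> word_map us = word_map vs \<circ> s'"
  shows "wdeg us = wdeg vs"
proof -
  have "steep (vline 0)" by (simp add: steep_def)
  from word_steep[OF us this] have 1: "d2 (app (word_map us) (vline 0)) = wdeg us" by simp
  have "steep (app s' (vline 0))" by (simp add: steep_def d2_app_diag[OF s(2)])
  from word_steep[OF vs this] have 2: "d2 (app (word_map vs) (app s' (vline 0))) = wdeg vs"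
    by (simp add: d2_app_diag[OF s(2)])
  note pm = poly_map_letters[OF us] poly_map_letters[OF vs] poly_autD(2)[OF poly_aut_diag[OF s(1)]]
    poly_autD(2)[OF poly_aut_diag[OF s(2)]]
  have "app s (app (word_map us) (vline 0)) = app (word_map vs) (app s' (vline 0))"
    using eq by (simp flip: app_comp add: pm)
  then show ?thesis using 1 2 d2_app_diag(2)[OF s(1)] by metis
qed

text \<open>Letters are peeled off at the right end. For \<open>s = s'\<close> the intermediate
  diagonal maps close up to a cyclic sequence, on which the power relations live.\<close>

lemma diagonal_chain:
  assumes "letters ws" "letters vs" "diag s" "diag s'" "s \<circ> word_map ws = word_map vs \<circ> s'"
  shows "length vs = length ws \<and> (\<exists>\<sigma>. \<sigma> 0 = s \<and> \<sigma> (length ws) = s' \<and> (\<forall>j\<le>length ws. diag (\<sigma> j)) \<and>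
    (\<forall>j<length ws. vs ! j \<circ> \<sigma> (Suc j) = \<sigma> j \<circ> ws ! j))"
  using assms
proof (induction ws arbitrary: vs s' rule: rev_induct)
  case Nil
  have "wdeg vs = 1" using wdeg_eq[OF Nil] by simp
  then have "vs = []" using wdeg_ge2[OF Nil(2)] by force
  moreover from this have "s = s'" using Nil(5) by simp
  ultimately show ?case using Nil by (intro conjI exI[of _ "\<lambda>_. s"]) auto
next
  case (snoc w ws)
  have "wdeg vs \<noteq> 1" using wdeg_eq[OF snoc.prems] wdeg_ge2[OF snoc.prems(1)] by simp
  then obtain vs0 v where vs: "vs = vs0 @ [v]" by (cases vs rule: rev_cases) auto
  have "s \<circ> word_map ws \<circ> w = word_map vs0 \<circ> v \<circ> s'"
    using snoc.prems(5) unfolding vs by (simp add: fun_eq_iff)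
  then obtain \<rho> where \<rho>: "diag \<rho>" "v \<circ> s' = \<rho> \<circ> w" "s \<circ> word_map ws = word_map vs0 \<circ> \<rho>"
    using peel_letter[of ws vs0 w v s s'] snoc.prems unfolding vs by auto
  have ls: "letters ws" "letters vs0" using snoc.prems(1,2) by (simp_all add: vs)
  from snoc.IH[OF ls snoc.prems(3) \<rho>(1,3)] obtain \<sigma> where len: "length vs0 = length ws"
    and \<sigma>: "\<sigma> 0 = s" "\<sigma> (length ws) = \<rho>" "\<forall>j\<le>length ws. diag (\<sigma> j)"
      "\<forall>j<length ws. vs0 ! j \<circ> \<sigma> (Suc j) = \<sigma> j \<circ> ws ! j"
    by blast
  define \<tau> where "\<tau> = \<sigma>(Suc (length ws) := s')"
  have "vs ! j \<circ> \<tau> (Suc j) = \<tau> j \<circ> (ws @ [w]) ! j" if "j < Suc (length ws)" for j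
  proof (cases "j = length ws")
    case True
    then show ?thesis using \<rho>(2) \<sigma>(2) len by (simp add: vs \<tau>_def nth_append)
  next
    case False
    then show ?thesis using that \<sigma>(4) len by (simp add: vs \<tau>_def nth_append)
  qed
  moreover have "diag (\<tau> j)" if "j \<le> Suc (length ws)" for j
    using that \<sigma>(3) snoc.prems(4) by (auto simp: \<tau>_def le_Suc_eq)
  ultimately show ?case
    using len \<sigma>(1) by (intro conjI exI[of _ \<tau>]) (auto simp: vs \<tau>_def)
qed

subsection \<open>Finiteness for normalised letters\<close>

text \<open>Covers both normal Henon maps and normal elementary involutions composed with the swap
  (leading coefficient \<open>1\<close>), as well as the hats of normal Henon maps, whose leading coefficient is
  \<open>-a\<close>.\<close>

definition normal_letter :: "pmap \<Rightarrow> bool" where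
  "normal_letter v \<longleftrightarrow> (\<exists>e a p. e\<^sup>2 = 1 \<and> a \<noteq> 0 \<and> 2 \<le> degree p \<and> coeff p (degree p - 1) = 0 \<and>
     (lead_coeff p = 1 \<or> (lead_coeff p)\<^sup>2 = a\<^sup>2) \<and> v = lm e 0 a p)"

lemma normal_letter_letter: "normal_letter v \<Longrightarrow> letter v"
  by (auto simp: normal_letter_def intro!: letterI)

text \<open>The second formula detects translations: the coefficient below the top one moves by a
  nonzero multiple of \<open>d\<close>. Degree bounds instead of exact degrees let the induction on
  \<open>p\<close> pass.\<close>

lemma coeff_pcompose_affine:
  fixes p :: "complex poly"
  shows "degree p \<le> n \<Longrightarrow> coeff (pcompose p [:d, b:]) n = b ^ n * coeff p n"
    and "degree p \<le> Suc n \<Longrightarrow> coeff (pcompose p [:d, b:]) n = b ^ n * (coeff p n + of_nat (Suc n) * d * coeff p (Suc n))"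
proof -
  have *: "(degree p \<le> n \<longrightarrow> coeff (pcompose p [:d, b:]) n = b ^ n * coeff p n) \<and>
    (degree p \<le> Suc n \<longrightarrow> coeff (pcompose p [:d, b:]) n = b ^ n * (coeff p n + of_nat (Suc n) * d * coeff p (Suc n)))"
  proof (induction p arbitrary: n)
    case (pCons a p)
    have dp: "degree (pCons a p) \<le> Suc m \<longleftrightarrow> degree p \<le> m" for m
      by simp
    show ?case
    proof (cases n)
      case 0
      show ?thesis
      proof (intro conjI impI)
        assume "degree (pCons a p) \<le> n"
        then have "p = 0" using 0 by (auto split: if_splits)
        then show "coeff (pcompose (pCons a p) [:d, b:]) n = b ^ n * coeff (pCons a p) n"
          by (simp add: pcompose_pCons 0)
      next
        assume "degree (pCons a p) \<le> Suc n"
        then have "degree p = 0" using 0 by (auto split: if_splits)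
        then obtain z where "p = [:z:]" by (rule degree_eq_zeroE)
        then show "coeff (pcompose (pCons a p) [:d, b:]) n = b ^ n * (coeff (pCons a p) n + of_nat (Suc n) * d * coeff (pCons a p) (Suc n))"
          by (simp add: pcompose_pCons 0)
      qed
    next
      case (Suc m)
      have c: "coeff (pcompose (pCons a p) [:d, b:]) (Suc m) = d * coeff (pcompose p [:d, b:]) (Suc m) + b * coeff (pcompose p [:d, b:]) m"
        by (simp add: pcompose_pCons)
      show ?thesis
      proof (intro conjI impI)
        assume "degree (pCons a p) \<le> n"
        then have "degree p \<le> m" using Suc dp by simp
        then have "coeff (pcompose p [:d, b:]) m = b ^ m * coeff p m"
          "coeff (pcompose p [:d, b:]) (Suc m) = b ^ Suc m * coeff p (Suc m)" "coeff p (Suc m) = 0"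
          using pCons.IH[of m] pCons.IH[of "Suc m"] by (auto simp: coeff_eq_0)
        then show "coeff (pcompose (pCons a p) [:d, b:]) n = b ^ n * coeff (pCons a p) n"
          unfolding Suc c by simp
      next
        assume "degree (pCons a p) \<le> Suc n"
        then have "degree p \<le> Suc m" using Suc dp by simp
        then have "coeff (pcompose p [:d, b:]) m = b ^ m * (coeff p m + of_nat (Suc m) * d * coeff p (Suc m))"
          "coeff (pcompose p [:d, b:]) (Suc m) = b ^ Suc m * coeff p (Suc m)"
          using pCons.IH[of m] pCons.IH[of "Suc m"] by auto
        then show "coeff (pcompose (pCons a p) [:d, b:]) n = b ^ n * (coeff (pCons a p) n + of_nat (Suc n) * d * coeff (pCons a p) (Suc n))"
          unfolding Suc c by (simp add: algebra_simps)
      qed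
    qed
  qed simp
  then show "degree p \<le> n \<Longrightarrow> coeff (pcompose p [:d, b:]) n = b ^ n * coeff p n"
    "degree p \<le> Suc n \<Longrightarrow> coeff (pcompose p [:d, b:]) n = b ^ n * (coeff p n + of_nat (Suc n) * d * coeff p (Suc n))"
    by blast+
qed

text \<open>Both polynomials lack the term below the top one, which forces \<open>d0 = 0\<close>,
  and then \<open>c1 = e' d0 = 0\<close>. The translations \<open>c0\<close> and \<open>d1'\<close>
  are left to the neighbouring letters of the cyclic word.\<close>

lemma lm_intertwine:
  assumes eq: "lm e' 0 a' p' \<circ> dg a0 c0 b0 d0 = dg a1 c1 b1 d1' \<circ> lm e 0 a p"
    and nz: "e' \<noteq> 0" "b0 \<noteq> 0" "b1 \<noteq> 0"
    and p: "2 \<le> degree p" "coeff p (degree p - 1) = 0"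
    and p': "2 \<le> degree p'" "coeff p' (degree p' - 1) = 0"
  shows "d0 = 0" "c1 = 0" "a1 * e = e' * b0" "a' * a0 = b1 * a"
    "lead_coeff p' * b0 ^ degree p = b1 * lead_coeff p"
proof -
  have ev: "e' * (b0 * y + d0) = a1 * (e * y) + c1"
    "a' * (a0 * x + c0) + poly p' (b0 * y + d0) = b1 * (a * x + poly p y) + d1'" for x y
    using fun_cong[OF eq, of "(x, y)"] by simp_all
  have c1: "c1 = e' * d0" using ev(1)[of 0] by simp
  then show "a1 * e = e' * b0" using ev(1)[of 1] by (simp add: algebra_simps)
  show "a' * a0 = b1 * a" using ev(2)[of 0 0] ev(2)[of 1 0] by (simp add: algebra_simps)
  have "poly (pcompose p' [:d0, b0:] + [:a' * c0:]) y = poly (smult b1 p + [:d1':]) y" for y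
    using ev(2)[of 0 y] by (simp add: poly_pcompose algebra_simps)
  from poly_ext[OF this] have P: "pcompose p' [:d0, b0:] + [:a' * c0:] = smult b1 p + [:d1':]" .
  have "degree p' = degree p"
    using arg_cong[OF P, of degree] nz by (simp add: degree_pcompose)
  obtain l where l: "degree p = Suc (Suc l)"
    using p(1) by (metis Suc_le_D add_2_eq_Suc le_Suc_ex)
  have cf: "coeff (pcompose p' [:d0, b0:]) (Suc n) = b1 * coeff p (Suc n)" for n
    using arg_cong[OF P, of "\<lambda>q. coeff q (Suc n)"] by simp
  show L: "lead_coeff p' * b0 ^ degree p = b1 * lead_coeff p"
    using cf[of "Suc l"] coeff_pcompose_affine(1)[of p' "Suc (Suc l)" d0 b0]
    by (simp add: \<open>degree p' = degree p\<close> l mult.commute)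
  have "b0 ^ Suc l * (of_nat (Suc (Suc l)) * d0 * lead_coeff p') = 0"
    using cf[of l] coeff_pcompose_affine(2)[of p' "Suc l" d0 b0] p(2) p'(2)
    by (simp add: \<open>degree p' = degree p\<close> l)
  moreover have "lead_coeff p' \<noteq> 0" using p'(1) by auto
  moreover have "of_nat (Suc (Suc l)) \<noteq> (0::complex)" by (rule of_nat_neq_0)
  ultimately show "d0 = 0" using nz(2) by (simp del: of_nat_Suc)
  then show "c1 = 0" using c1 by simp
qed

text \<open>Following the relations from \<open>Z i\<close> until an index repeats shows that \<open>Z i\<close> is a root of one of
  finitely many nonzero constants.\<close>

lemma finite_power_relations:
  fixes K :: "complex set" and k :: nat
  assumes K: "finite K" "0 \<notin> K" and L: "finite L" "\<And>l. l \<in> L \<Longrightarrow> 2 \<le> l"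
  shows "\<exists>R. finite R \<and> (\<forall>Z::nat \<Rightarrow> complex. (\<forall>i<k. Z i \<noteq> 0 \<and> (\<exists>j<k. \<exists>c\<in>K. \<exists>l\<in>L. Z i ^ l = c * Z j)) \<longrightarrow> (\<forall>i<k. Z i \<in> R))"
proof -
  \<comment> \<open>A pair \<open>(A, C)\<close> stands for a relation
    \<open>Z i ^ A = C * Z j\<close>. Raising it to the power \<open>l\<close> and inserting
    \<open>Z j ^ l = c * Z j'\<close> yields the pair \<open>(A * l, C ^ l * c)\<close>. The pairs
    do not refer to \<open>Z\<close>, so finitely many serve for all \<open>Z\<close>.\<close>
  define step where "step Q = (\<lambda>((A, C), l, c). (A * l, C ^ l * c)) ` (Q \<times> L \<times> K)" for Q :: "(nat \<times> complex) set"
  define P where "P n = (step ^^ n) {(1, 1)}" for n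
  have P0: "P 0 = {(1, 1)}" and PS: "P (Suc n) = step (P n)" for n
    by (simp_all add: P_def)
  have finP: "finite (P n)" for n
    by (induction n) (simp_all add: P0 PS step_def K(1) L(1))
  define Q where "Q = (\<Union>n\<le>k. P n)"
  define R where "R = (\<Union>((A, C), (B, D))\<in>{((A, C), (B, D)). (A, C) \<in> Q \<and> (B, D) \<in> Q \<and> A < B}. {z::complex. z ^ (B - A) = D / C})"
  have "finite Q" by (simp add: Q_def finP)
  have "finite {((A, C), (B, D)). (A, C) \<in> Q \<and> (B, D) \<in> Q \<and> A < B}"
    by (rule finite_subset[of _ "Q \<times> Q"]) (auto simp: \<open>finite Q\<close>)
  then have "finite R"
    unfolding R_def by (rule finite_UN_I) (auto intro!: finite_nth_roots)
  moreover have "Z i \<in> R"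
    if Z: "\<forall>i<k. Z i \<noteq> 0 \<and> (\<exists>j<k. \<exists>c\<in>K. \<exists>l\<in>L. Z i ^ l = c * Z j)" and i: "i < k" for Z i
  proof -
    have "\<forall>i\<in>{..<k}. \<exists>x. fst x < k \<and> fst (snd x) \<in> K \<and> snd (snd x) \<in> L \<and> Z i ^ snd (snd x) = fst (snd x) * Z (fst x)"
      using Z by fastforce
    from bchoice[OF this] obtain f where
      f: "\<forall>i\<in>{..<k}. fst (f i) < k \<and> fst (snd (f i)) \<in> K \<and> snd (snd (f i)) \<in> L \<and> Z i ^ snd (snd (f i)) = fst (snd (f i)) * Z (fst (f i))"
      by (rule exE)
    define \<pi> c l where "\<pi> i = fst (f i)" and "c i = fst (snd (f i))" and "l i = snd (snd (f i))" for i
    have \<pi>: "\<pi> i < k \<and> c i \<in> K \<and> l i \<in> L \<and> Z i ^ l i = c i * Z (\<pi> i)" if "i < k" for i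
      using bspec[OF f, of i] that by (simp add: \<pi>_def c_def l_def)
    define I where "I n = (\<pi> ^^ n) i" for n
    define S where "S = rec_nat (1::nat, 1::complex) (\<lambda>n (A, C). (A * l (I n), C ^ l (I n) * c (I n)))"
    define A where "A n = fst (S n)" for n
    define C where "C n = snd (S n)" for n
    have A0: "A 0 = 1" "C 0 = 1" by (simp_all add: A_def C_def S_def)
    have AS: "A (Suc n) = A n * l (I n)" "C (Suc n) = C n ^ l (I n) * c (I n)" for n
      by (simp_all add: A_def C_def S_def case_prod_beta)
    have I: "I n < k" for n by (induction n) (simp_all add: I_def i \<pi>)
    have AC: "(A n, C n) \<in> P n" for n
    proof (induction n)
      case (Suc n)
      have "(A (Suc n), C (Suc n)) = (\<lambda>((A, C), l, c). (A * l, C ^ l * c)) ((A n, C n), l (I n), c (I n))"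
        by (simp add: AS)
      moreover have "((A n, C n), l (I n), c (I n)) \<in> P n \<times> L \<times> K" using Suc \<pi>[OF I] by simp
      ultimately show ?case unfolding PS step_def by (rule image_eqI)
    qed (simp add: P0 A0)
    have C0: "C n \<noteq> 0" for n
    proof (induction n)
      case (Suc n)
      have "c (I n) \<noteq> 0" using \<pi>[OF I[of n]] K(2) by metis
      then show ?case using Suc by (simp add: AS)
    qed (simp add: A0)
    have rel: "Z i ^ A n = C n * Z (I n)" for n
    proof (induction n)
      case (Suc n)
      have "Z i ^ A (Suc n) = (C n * Z (I n)) ^ l (I n)" by (simp add: AS power_mult Suc)
      also have "\<dots> = C (Suc n) * Z (I (Suc n))" using \<pi>[OF I[of n]] by (simp add: AS power_mult_distrib I_def)
      finally show ?case .
    qed (simp add: A0 I_def)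
    have "strict_mono A"
      unfolding strict_mono_Suc_iff
    proof
      fix n
      have l2: "2 \<le> l (I n)" for n using \<pi>[OF I[of n]] L(2) by simp
      have "0 < A n"
      proof (induction n)
        case (Suc n)
        then show ?case using l2[of n] by (simp add: AS)
      qed (simp add: A0)
      then have "A n * 1 < A n * l (I n)" using \<pi>[OF I[of n]] L(2)[of "l (I n)"] by (intro mult_strict_left_mono) auto
      then show "A n < A (Suc n)" by (simp add: AS)
    qed
    \<comment> \<open>The orbit of \<open>i\<close> has \<open>k + 1\<close> entries among
      \<open>k\<close> indices. At a repetition \<open>Z (I n)\<close> cancels, and since the
      exponents \<open>A\<close> increase strictly, a genuine root equation for \<open>Z i\<close>
      remains.\<close>
    have "\<not> inj_on I {..k}"
    proof
      assume "inj_on I {..k}"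
      moreover have "I ` {..k} \<subseteq> {..<k}" using I by auto
      ultimately have "card {..k} \<le> card {..<k}" by (intro card_inj_on_le) auto
      then show False by simp
    qed
    then obtain x y where "x \<le> k" "y \<le> k" "I x = I y" "x \<noteq> y"
      unfolding inj_on_def by auto
    then have "min x y < max x y" "max x y \<le> k" "I (min x y) = I (max x y)"
      by (auto simp: min_def max_def)
    then obtain m n where mn: "m < n" "n \<le> k" "I m = I n" by blast
    have "A m < A n" using \<open>strict_mono A\<close> mn(1) by (simp add: strict_mono_less)
    have "Z i ^ A n = Z i ^ A m * Z i ^ (A n - A m)"
      using \<open>A m < A n\<close> by (simp flip: power_add)
    then have "C n * Z (I n) = C m * Z (I n) * Z i ^ (A n - A m)"
      using rel[of n] rel[of m] mn(3) by simp
    then have "Z i ^ (A n - A m) = C n / C m"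
      using C0[of m] Z I[of n] by (simp add: field_simps)
    moreover have "(A n, C n) \<in> Q" if "n \<le> k" for n
      unfolding Q_def using AC[of n] that by blast
    then have "(A m, C m) \<in> Q" "(A n, C n) \<in> Q" using mn by auto
    ultimately show "Z i \<in> R" unfolding R_def using \<open>A m < A n\<close>
      by (intro UN_I[of "((A m, C m), (A n, C n))"]) auto
  qed
  ultimately show ?thesis by blast
qed

text \<open>Membership is tested on squares because \<open>e\<close> is only known up to sign in a
  normal letter.\<close>

definition scalings :: "complex set \<Rightarrow> pmap set" where
  "scalings R = (\<lambda>(a, b). dg a 0 b 0) ` ({a. a\<^sup>2 \<in> R} \<times> {b. b\<^sup>2 \<in> R})"

lemma finite_scalings: "finite R \<Longrightarrow> finite (scalings R)"
proof -
  assume "finite R"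
  then have "finite (\<Union>r\<in>R. {a::complex. a\<^sup>2 = r})"
    by (rule finite_UN_I) (rule finite_nth_roots, simp)
  moreover have "{a::complex. a\<^sup>2 \<in> R} = (\<Union>r\<in>R. {a. a\<^sup>2 = r})" by blast
  ultimately have "finite {a::complex. a\<^sup>2 \<in> R}" by (simp only:)
  then show "finite (scalings R)" by (simp add: scalings_def)
qed

text \<open>With \<open>b\<^sub>j\<close> the scalings of the second coordinate along the cyclic word, a factor with leading
  coefficient \<open>1\<close> gives a power relation between \<open>b\<^sub>j\<^sub>+\<^sub>1\<^sup>2\<close> and \<open>b\<^sub>j\<^sup>2\<close>, a hat gives one between \<open>b\<^sub>j\<^sub>+\<^sub>1\<^sup>2\<close> and
  \<open>b\<^sub>j\<^sub>+\<^sub>2\<^sup>2\<close>.\<close>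

lemma normal_letters_scalings:
  assumes ws: "\<And>w. w \<in> set ws \<Longrightarrow> normal_letter w" and "ws \<noteq> []"
  shows "\<exists>R. finite R \<and> (\<forall>vs s. (\<forall>v\<in>set vs. normal_letter v) \<longrightarrow> diag s \<longrightarrow>
      s \<circ> word_map ws = word_map vs \<circ> s \<longrightarrow>
      length vs = length ws \<and> (\<forall>j<length ws. \<exists>\<sigma>\<in>scalings R. \<exists>\<tau>\<in>scalings R. poly_aut \<tau> \<and> vs ! j \<circ> \<tau> = \<sigma> \<circ> ws ! j))"
proof -
  obtain E A P where w: "\<And>w. w \<in> set ws \<Longrightarrow> (E w)\<^sup>2 = 1 \<and> A w \<noteq> 0 \<and> 2 \<le> degree (P w) \<and>
      coeff (P w) (degree (P w) - 1) = 0 \<and> w = lm (E w) 0 (A w) (P w)"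
    using ws unfolding normal_letter_def by metis
  define k where "k = length ws"
  have k: "0 < k" using \<open>ws \<noteq> []\<close> by (simp add: k_def)
  \<comment> \<open>The constants must depend on \<open>ws\<close> alone. An unknown leading
    coefficient of \<open>vs ! j\<close> is 1, or it equals the unknown \<open>a'\<close> up to
    sign, and \<open>a'\<close> is then eliminated; this gives the two families.\<close>
  define K where "K = (\<lambda>w. (lead_coeff (P w))\<^sup>2) ` set ws \<union> (\<lambda>w. (lead_coeff (P w))\<^sup>2 / (A w)\<^sup>2) ` set ws"
  define L where "L = (\<lambda>w. degree (P w)) ` set ws"
  have lc: "lead_coeff (P w) \<noteq> 0" if "w \<in> set ws" for w
    using w[OF that] by auto
  have K: "finite K" "0 \<notin> K" using lc w by (auto simp: K_def)
  have L: "finite L" "\<And>l. l \<in> L \<Longrightarrow> 2 \<le> l" using w by (auto simp: L_def)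
  obtain R where R: "finite R" "\<And>Z. (\<forall>i<k. Z i \<noteq> 0 \<and> (\<exists>j<k. \<exists>c\<in>K. \<exists>l\<in>L. Z i ^ l = c * Z j)) \<Longrightarrow> (\<forall>i<k. Z i \<in> R)"
    using finite_power_relations[OF K L, of k] by blast
  have "length vs = k \<and> (\<forall>j<k. \<exists>\<sigma>\<in>scalings R. \<exists>\<tau>\<in>scalings R. poly_aut \<tau> \<and> vs ! j \<circ> \<tau> = \<sigma> \<circ> ws ! j)"
    if vs: "\<forall>v\<in>set vs. normal_letter v" and s: "diag s" and eq: "s \<circ> word_map ws = word_map vs \<circ> s" for vs s
  proof -
    have "letters ws" "letters vs"
      using ws vs by (auto simp: letters_def normal_letter_letter)
    from diagonal_chain[OF this s s eq] obtain \<sigma> where len: "length vs = k"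
      and \<sigma>: "\<sigma> 0 = s" "\<sigma> k = s" "\<forall>j\<le>k. diag (\<sigma> j)" "\<forall>j<k. vs ! j \<circ> \<sigma> (Suc j) = \<sigma> j \<circ> ws ! j"
      unfolding k_def by blast
    \<comment> \<open>The chain starts and ends at \<open>s\<close>, so it extends periodically to
      all indices.\<close>
    define \<tau> where "\<tau> j = \<sigma> (j mod k)" for j
    have \<tau>\<sigma>: "\<tau> j = \<sigma> j" if "j \<le> k" for j
      using that \<sigma>(1,2) by (cases "j = k") (simp_all add: \<tau>_def)
    have "\<forall>j. \<exists>x. \<sigma> (j mod k) = (case x of (a, c, b, d) \<Rightarrow> dg a c b d) \<and> fst x \<noteq> 0 \<and> fst (snd (snd x)) \<noteq> 0"
    proof
      fix j
      have "diag (\<sigma> (j mod k))" using \<sigma>(3) k by (simp add: less_imp_le)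
      then obtain a c b d where "a \<noteq> 0" "b \<noteq> 0" "\<sigma> (j mod k) = dg a c b d" by (rule diagE)
      then show "\<exists>x. \<sigma> (j mod k) = (case x of (a, c, b, d) \<Rightarrow> dg a c b d) \<and> fst x \<noteq> 0 \<and> fst (snd (snd x)) \<noteq> 0"
        by (intro exI[of _ "(a, c, b, d)"]) simp
    qed
    from choice[OF this] obtain X where
      X: "\<And>j. \<sigma> (j mod k) = (case X j of (a, c, b, d) \<Rightarrow> dg a c b d) \<and> fst (X j) \<noteq> 0 \<and> fst (snd (snd (X j))) \<noteq> 0"
      by blast
    define a c b d where "a j = fst (X (j mod k))" and "c j = fst (snd (X (j mod k)))"
      and "b j = fst (snd (snd (X (j mod k))))" and "d j = snd (snd (snd (X (j mod k))))" for j
    have X: "\<tau> j = dg (a j) (c j) (b j) (d j)" "a j \<noteq> 0" "b j \<noteq> 0" for j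
      using X[of "j mod k"] by (simp_all add: \<tau>_def a_def b_def c_def d_def case_prod_beta)
    have per: "a (j mod k) = a j" "b (j mod k) = b j" for j by (simp_all add: a_def b_def)
    have step: "d (Suc j) = 0 \<and> c j = 0 \<and> (a j)\<^sup>2 = (b (Suc j))\<^sup>2 \<and>
        (\<exists>a' q. a' \<noteq> 0 \<and> (q = 1 \<or> q\<^sup>2 = a'\<^sup>2) \<and> a' * a (Suc j) = b j * A (ws ! j) \<and>
          q * b (Suc j) ^ degree (P (ws ! j)) = b j * lead_coeff (P (ws ! j)))"
      if j: "j < k" for j
    proof -
      let ?w = "ws ! j"
      have inw: "?w \<in> set ws" using j by (simp add: k_def)
      note W = w[OF inw]
      have "vs ! j \<in> set vs" using j len by simp
      then obtain e' a' p' where V: "e'\<^sup>2 = 1" "a' \<noteq> 0" "2 \<le> degree p'" "coeff p' (degree p' - 1) = 0"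
        "lead_coeff p' = 1 \<or> (lead_coeff p')\<^sup>2 = a'\<^sup>2" "vs ! j = lm e' 0 a' p'"
        using vs unfolding normal_letter_def by blast
      have we: "lm (E ?w) 0 (A ?w) (P ?w) = ?w" using W by simp
      have "vs ! j \<circ> \<tau> (Suc j) = \<tau> j \<circ> ?w" using \<sigma>(4) \<tau>\<sigma> j by simp
      then have "lm e' 0 a' p' \<circ> dg (a (Suc j)) (c (Suc j)) (b (Suc j)) (d (Suc j)) = dg (a j) (c j) (b j) (d j) \<circ> lm (E ?w) 0 (A ?w) (P ?w)"
        unfolding V(6) X(1) we .
      moreover have "e' \<noteq> 0" using V(1) by auto
      ultimately have I: "d (Suc j) = 0" "c j = 0" "a j * E ?w = e' * b (Suc j)" "a' * a (Suc j) = b j * A ?w"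
        "lead_coeff p' * b (Suc j) ^ degree (P ?w) = b j * lead_coeff (P ?w)"
        using lm_intertwine[of e' a' p' "a (Suc j)" "c (Suc j)" "b (Suc j)" "d (Suc j)" "a j" "c j" "b j" "d j" "E ?w" "A ?w" "P ?w"]
          X(3) W V(3,4) by auto
      have ab: "(a j)\<^sup>2 = (b (Suc j))\<^sup>2"
        using arg_cong[OF I(3), of "\<lambda>x. x\<^sup>2"] W V(1) by (simp add: power_mult_distrib)
      then show ?thesis using I V(2,5) by blast
    qed
    have rel: "\<exists>j'<k. \<exists>q\<in>K. \<exists>l\<in>L. ((b (Suc j))\<^sup>2) ^ l = q * (b j')\<^sup>2" if j: "j < k" for j
    proof -
      let ?w = "ws ! j"
      have inw: "?w \<in> set ws" using j by (simp add: k_def)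
      note W = w[OF inw]
      obtain a' q where V: "a' \<noteq> 0" "q = 1 \<or> q\<^sup>2 = a'\<^sup>2" and I: "a' * a (Suc j) = b j * A ?w"
        "q * b (Suc j) ^ degree (P ?w) = b j * lead_coeff (P ?w)"
        using step[OF j] by blast
      have L': "degree (P ?w) \<in> L" using inw by (simp add: L_def)
      have sq: "q\<^sup>2 * ((b (Suc j))\<^sup>2) ^ degree (P ?w) = (b j)\<^sup>2 * (lead_coeff (P ?w))\<^sup>2"
        using arg_cong[OF I(2), of "\<lambda>x. x\<^sup>2"] by (simp add: power_mult_distrib power_mult[symmetric] mult.commute)
      \<comment> \<open>Elimination of \<open>(b j)\<^sup>2\<close> and \<open>a'\<^sup>2\<close>
        between the relation for \<open>a\<close> and the one for leading coefficients.\<close>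
      have ratio: "u = l / m * t" if "r * t = v * m" "m \<noteq> 0" "r \<noteq> 0" "r * u = v * l" for r t v m u l :: complex
      proof -
        have "r * (u * m) = (r * u) * m" by simp
        also have "\<dots> = l * (v * m)" by (simp add: that(4))
        also have "\<dots> = r * (l * t)" by (simp flip: that(1))
        finally show ?thesis using that(2,3) by (simp add: field_simps)
      qed
      have "\<exists>j'<k. \<exists>r\<in>K. ((b (Suc j))\<^sup>2) ^ degree (P ?w) = r * (b j')\<^sup>2"
        using V(2)
      proof
        assume "q = 1"
        then have "((b (Suc j))\<^sup>2) ^ degree (P ?w) = (lead_coeff (P ?w))\<^sup>2 * (b j)\<^sup>2"
          using sq by (simp add: mult.commute)
        moreover have "(lead_coeff (P ?w))\<^sup>2 \<in> K" using inw by (simp add: K_def)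
        ultimately show ?thesis using j by blast
      next
        assume hat: "q\<^sup>2 = a'\<^sup>2"
        have "a'\<^sup>2 * (a (Suc j))\<^sup>2 = (b j)\<^sup>2 * (A ?w)\<^sup>2"
          using arg_cong[OF I(1), of "\<lambda>x. x\<^sup>2"] by (simp add: power_mult_distrib)
        moreover have "(A ?w)\<^sup>2 \<noteq> 0" "a'\<^sup>2 \<noteq> 0" using W V(1) by auto
        ultimately have "((b (Suc j))\<^sup>2) ^ degree (P ?w) = (lead_coeff (P ?w))\<^sup>2 / (A ?w)\<^sup>2 * (a (Suc j))\<^sup>2"
          using sq unfolding hat by (intro ratio)
        moreover have "(a (Suc j))\<^sup>2 = (b (Suc (Suc j) mod k))\<^sup>2"
        proof -
          have "Suc j mod k < k" using k by simp
          from step[OF this] show ?thesis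
            using per(1)[of "Suc j"] per(2)[of "Suc (Suc j mod k)"] by (simp add: mod_Suc_eq)
        qed
        moreover have "(lead_coeff (P ?w))\<^sup>2 / (A ?w)\<^sup>2 \<in> K" using inw by (simp add: K_def)
        moreover have "Suc (Suc j) mod k < k" using k by simp
        ultimately show ?thesis by metis
      qed
      then show ?thesis using L' by blast
    qed
    have "\<forall>i<k. (b i)\<^sup>2 \<in> R"
    proof (rule R(2), intro allI impI conjI)
      fix i assume "i < k"
      show "(b i)\<^sup>2 \<noteq> 0" using X(3) by simp
      define j where "j = (if i = 0 then k - 1 else i - 1)"
      have j: "j < k" "Suc j mod k = i" using \<open>i < k\<close> k by (auto simp: j_def)
      then have "b (Suc j) = b i" using per(2)[of "Suc j"] by simp
      then show "\<exists>j<k. \<exists>c\<in>K. \<exists>l\<in>L. (b i)\<^sup>2 ^ l = c * (b j)\<^sup>2" using rel[OF j(1)] by simp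
    qed
    then have "(b (j mod k))\<^sup>2 \<in> R" for j using k by simp
    then have bR: "(b j)\<^sup>2 \<in> R" for j by (simp only: per)
    \<comment> \<open>The relation at letter \<open>m\<close> controls \<open>c\<close> and
      \<open>a\<close>, whereas \<open>d\<close> at \<open>m\<close> vanishes by the relation at its
      cyclic predecessor \<open>i\<close>.\<close>
    have 0: "c j = 0 \<and> d j = 0 \<and> (a j)\<^sup>2 \<in> R" for j
    proof -
      define m where "m = j mod k"
      define i where "i = (if m = 0 then k - 1 else m - 1)"
      have m: "m < k" unfolding m_def using k by simp
      then have i: "i < k" "Suc i mod k = m" using k by (auto simp: i_def)
      have "d j = d (Suc i)" "c j = c m" "a j = a m"
        using i(2) m by (simp_all add: d_def c_def a_def m_def)
      then show ?thesis
        using step[OF i(1)] step[OF m] bR[of "Suc m"] by simp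
    qed
    have sc: "\<tau> j \<in> scalings R" for j
      unfolding X(1) scalings_def using 0[of j] bR[of j] by (intro image_eqI[of _ _ "(a j, b j)"]) auto
    moreover have "poly_aut (\<tau> j)" for j unfolding X(1) using X(2,3) by (rule poly_aut_dg)
    moreover have "vs ! j \<circ> \<tau> (Suc j) = \<tau> j \<circ> ws ! j" if "j < k" for j
      using \<sigma>(4) \<tau>\<sigma> that by simp
    ultimately show ?thesis using len by blast
  qed
  then show ?thesis using R(1) unfolding k_def by blast
qed

text \<open>Fix one nonempty word \<open>ws\<close>. By \<open>rigidity\<close> any other nonempty
  one is diagonally conjugate to a rearrangement of \<open>ws\<close>, and its letters
  \<open>\<sigma> \<circ> us ! j \<circ> inv \<tau>\<close> come from a finite set. The empty word,
  being the identity, is added by hand.\<close>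

lemma finite_normal_conj:
  "finite {vs. (\<forall>v\<in>set vs. normal_letter v) \<and> conj_in_G g (word_map vs)}" (is "finite ?S")
proof (cases "?S \<subseteq> {[]}")
  case True
  then show ?thesis by (rule finite_subset) simp
next
  case False
  then obtain ws where ws: "ws \<noteq> []" "\<forall>w\<in>set ws. normal_letter w" "conj_in_G g (word_map ws)" by blast
  define U where "U = {us. mset us = mset ws}"
  have "U \<subseteq> {us. set us \<subseteq> set ws \<and> length us = length ws}"
    unfolding U_def by (auto dest: mset_eq_setD mset_eq_length)
  then have finU: "finite U" by (rule finite_subset) (simp add: finite_lists_length_eq)
  have U: "\<forall>w\<in>set us. normal_letter w" "us \<noteq> []" if "us \<in> U" for us
    using that ws(1,2) unfolding U_def by (auto dest: mset_eq_setD)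
  define V where "V us = {vs. (\<forall>v\<in>set vs. normal_letter v) \<and> (\<exists>s. diag s \<and> s \<circ> word_map us = word_map vs \<circ> s)}" for us
  have finV: "finite (V us)" if us: "us \<in> U" for us
  proof -
    obtain R where R: "finite R" "\<And>vs s. (\<forall>v\<in>set vs. normal_letter v) \<Longrightarrow> diag s \<Longrightarrow>
      s \<circ> word_map us = word_map vs \<circ> s \<Longrightarrow> length vs = length us \<and>
      (\<forall>j<length us. \<exists>\<sigma>\<in>scalings R. \<exists>\<tau>\<in>scalings R. poly_aut \<tau> \<and> vs ! j \<circ> \<tau> = \<sigma> \<circ> us ! j)"
      using normal_letters_scalings[of us] U[OF us] by blast
    define T where "T = (\<lambda>(\<sigma>, w, \<tau>). \<sigma> \<circ> w \<circ> inv \<tau>) ` (scalings R \<times> set us \<times> scalings R)"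
    have "finite T" by (simp add: T_def finite_scalings R(1))
    have "set vs \<subseteq> T \<and> length vs = length us" if vs: "vs \<in> V us" for vs
    proof -
      obtain s where "\<forall>v\<in>set vs. normal_letter v" "diag s" "s \<circ> word_map us = word_map vs \<circ> s"
        using vs unfolding V_def by blast
      note * = R(2)[OF this]
      have "vs ! j \<in> T" if j: "j < length us" for j
      proof -
        obtain \<sigma> \<tau> where st: "\<sigma> \<in> scalings R" "\<tau> \<in> scalings R" "poly_aut \<tau>" "vs ! j \<circ> \<tau> = \<sigma> \<circ> us ! j"
          using * j by blast
        have "vs ! j = vs ! j \<circ> (\<tau> \<circ> inv \<tau>)" using poly_autD(4)[OF st(3)] by simp
        also have "\<dots> = \<sigma> \<circ> us ! j \<circ> inv \<tau>" by (simp only: st(4) flip: comp_assoc)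
        finally show ?thesis
          unfolding T_def using st(1,2) j by (intro image_eqI[of _ _ "(\<sigma>, us ! j, \<tau>)"]) auto
      qed
      then show ?thesis using * by (auto simp: in_set_conv_nth)
    qed
    then have "V us \<subseteq> {vs. set vs \<subseteq> T \<and> length vs = length us}" by blast
    then show ?thesis by (rule finite_subset) (rule finite_lists_length_eq[OF \<open>finite T\<close>])
  qed
  have "?S \<subseteq> insert [] (\<Union>us\<in>U. V us)"
  proof
    fix vs assume vs: "vs \<in> ?S"
    show "vs \<in> insert [] (\<Union>us\<in>U. V us)"
    proof (cases "vs = []")
      case False
      have "conj_in_G (word_map vs) (word_map ws)"
        using vs ws(3) conj_in_G_sym conj_in_G_trans by blast
      then obtain \<phi> where \<phi>: "poly_aut \<phi>" "word_map vs \<circ> \<phi> = \<phi> \<circ> word_map ws" by (meson conj_in_GD)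
      have "letters ws" "letters vs"
        using ws(2) vs by (auto simp: letters_def normal_letter_letter)
      then obtain us s where "mset us = mset ws" "diag s" "s \<circ> word_map us = word_map vs \<circ> s"
        using rigidity[OF \<phi>(1) _ ws(1) _ False \<phi>(2)[symmetric]] by blast
      then show ?thesis using vs unfolding U_def V_def by blast
    qed simp
  qed
  then show ?thesis using finU finV by (meson finite_UN_I finite_insert finite_subset)
qed

subsection \<open>Elementary and affine maps\<close>

definition el :: "complex \<Rightarrow> complex poly \<Rightarrow> complex \<Rightarrow> complex \<Rightarrow> pmap" where
  "el a p b h = (\<lambda>(x, y). (a * x + poly p y, b * y + h))"

lemma el_apply [simp]: "el a p b h (x, y) = (a * x + poly p y, b * y + h)"
  by (simp add: el_def)

lemma elementary_el: "elementary e \<longleftrightarrow> (\<exists>a p b h. a \<noteq> 0 \<and> b \<noteq> 0 \<and> e = el a p b h)"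
  unfolding elementary_def el_def by blast

lemma affine_el_iff:
  assumes "a \<noteq> 0" "b \<noteq> 0" shows "affine_aut (el a p b h) \<longleftrightarrow> degree p \<le> 1"
proof
  assume "affine_aut (el a p b h)"
  then obtain a' b' c' d' u v where *: "el a p b h = (\<lambda>(x, y). (a' * x + b' * y + u, c' * x + d' * y + v))"
    unfolding affine_aut_def by blast
  have "poly p y = poly [:u, b':] y" for y
    using fun_cong[OF *, of "(0, y)"] by (simp add: mult.commute add.commute)
  then have "p = [:u, b':]" by (rule poly_ext)
  then show "degree p \<le> 1" by simp
next
  assume "degree p \<le> 1"
  have "coeff p n = coeff [:coeff p 0, coeff p 1:] n" for n
  proof (cases "n < 2")
    case True
    then have "n = 0 \<or> n = 1" by linarith
    then show ?thesis by (elim disjE) simp_all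
  next
    case False
    then obtain m where "n = Suc (Suc m)" by (metis add_2_eq_Suc le_Suc_ex not_less)
    then show ?thesis using \<open>degree p \<le> 1\<close> by (simp add: coeff_eq_0)
  qed
  then have "p = [:coeff p 0, coeff p 1:]" by (rule poly_eqI)
  then obtain u w where p: "p = [:u, w:]" by (rule that)
  have "el a p b h = (\<lambda>(x, y). (a * x + w * y + u, 0 * x + b * y + h))"
    unfolding p by (simp add: fun_eq_iff mult.commute)
  moreover have "a * b - w * 0 \<noteq> 0" using assms by simp
  ultimately show "affine_aut (el a p b h)" unfolding affine_aut_def by (intro exI conjI)
qed

lemma el_comp: "el a p b h \<circ> el a' p' b' h' = el (a * a') (smult a p' + pcompose p [:h', b':]) (b * b') (b * h' + h)"
  by (auto simp: fun_eq_iff poly_pcompose algebra_simps)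

lemma el_inverse:
  assumes "a \<noteq> 0" "b \<noteq> 0"
  shows "poly_aut (el a p b h)" "inv (el a p b h) = el (1/a) (smult (-1/a) (pcompose p [:-h/b, 1/b:])) (1/b) (-h/b)"
proof -
  have pm: "poly_map (el a p b h)" for a p b h
    by (auto intro!: poly_mapI poly2_add poly2_mult poly2_const poly2_fst poly2_snd poly2_poly
        simp: el_def case_prod_beta)
  let ?G = "el (1/a) (smult (-1/a) (pcompose p [:-h/b, 1/b:])) (1/b) (-h/b)"
  have "el a p b h \<circ> ?G = id" "?G \<circ> el a p b h = id"
    using assms by (auto simp: fun_eq_iff poly_pcompose field_simps)
  from poly_autI[OF this pm pm] show "poly_aut (el a p b h)" "inv (el a p b h) = ?G"
    by simp_all
qed

definition elem2 :: "pmap \<Rightarrow> bool" where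
  "elem2 e \<longleftrightarrow> elementary e \<and> \<not> affine_aut e"

definition tri :: "pmap \<Rightarrow> bool" where
  "tri s \<longleftrightarrow> elementary s \<and> affine_aut s"

lemma elem2_iff: "elem2 e \<longleftrightarrow> (\<exists>a p b h. a \<noteq> 0 \<and> b \<noteq> 0 \<and> 2 \<le> degree p \<and> e = el a p b h)"
proof
  assume e: "elem2 e"
  then obtain a p b h where *: "a \<noteq> 0" "b \<noteq> 0" "e = el a p b h"
    unfolding elem2_def elementary_el by blast
  then have "\<not> degree p \<le> 1" using e affine_el_iff[OF *(1,2)] by (simp add: elem2_def)
  then have "2 \<le> degree p" by simp
  then show "\<exists>a p b h. a \<noteq> 0 \<and> b \<noteq> 0 \<and> 2 \<le> degree p \<and> e = el a p b h" using * by blast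
next
  assume "\<exists>a p b h. a \<noteq> 0 \<and> b \<noteq> 0 \<and> 2 \<le> degree p \<and> e = el a p b h"
  then obtain a p b h where *: "a \<noteq> 0" "b \<noteq> 0" "2 \<le> degree p" "e = el a p b h" by blast
  then have "\<not> affine_aut e" using affine_el_iff[OF *(1,2)] by simp
  then show "elem2 e" unfolding elem2_def elementary_el using * by blast
qed

lemma elem2_el: "a \<noteq> 0 \<Longrightarrow> b \<noteq> 0 \<Longrightarrow> 2 \<le> degree p \<Longrightarrow> elem2 (el a p b h)"
  unfolding elem2_iff by blast

lemma tri_iff: "tri s \<longleftrightarrow> (\<exists>a p b h. a \<noteq> 0 \<and> b \<noteq> 0 \<and> degree p \<le> 1 \<and> s = el a p b h)"
proof
  assume s: "tri s"
  then obtain a p b h where *: "a \<noteq> 0" "b \<noteq> 0" "s = el a p b h"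
    unfolding tri_def elementary_el by blast
  then have "degree p \<le> 1" using s affine_el_iff[OF *(1,2)] by (simp add: tri_def)
  then show "\<exists>a p b h. a \<noteq> 0 \<and> b \<noteq> 0 \<and> degree p \<le> 1 \<and> s = el a p b h" using * by blast
next
  assume "\<exists>a p b h. a \<noteq> 0 \<and> b \<noteq> 0 \<and> degree p \<le> 1 \<and> s = el a p b h"
  then obtain a p b h where *: "a \<noteq> 0" "b \<noteq> 0" "degree p \<le> 1" "s = el a p b h" by blast
  then have "affine_aut s" using affine_el_iff[OF *(1,2)] by simp
  then show "tri s" unfolding tri_def elementary_el using * by blast
qed

lemma tri_el: "a \<noteq> 0 \<Longrightarrow> b \<noteq> 0 \<Longrightarrow> degree p \<le> 1 \<Longrightarrow> tri (el a p b h)"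
  unfolding tri_iff by blast

lemma poly_aut_elementary: "elementary e \<Longrightarrow> poly_aut e"
  by (auto simp: elementary_el el_inverse)

lemma elem2_tri: 
  assumes "elem2 e" "tri s" shows "elem2 (e \<circ> s)" "elem2 (s \<circ> e)"
proof -
  obtain a p b h where e: "a \<noteq> 0" "b \<noteq> 0" "2 \<le> degree p" "e = el a p b h"
    using assms(1) unfolding elem2_iff by blast
  obtain a' p' b' h' where s: "a' \<noteq> 0" "b' \<noteq> 0" "degree p' \<le> 1" "s = el a' p' b' h'"
    using assms(2) unfolding tri_iff by blast
  have "degree (smult a p' + pcompose p [:h', b':]) = degree p"
    using e s by (subst degree_add_eq_right) (auto simp: degree_pcompose)
  then show "elem2 (e \<circ> s)"
    unfolding e(4) s(4) el_comp using e s by (intro elem2_el) auto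
  have "degree (pcompose p' [:h, b:]) \<le> 1" using s(3) e(2) by (simp add: degree_pcompose)
  then have "degree (smult a' p + pcompose p' [:h, b:]) = degree p"
    using e s by (subst degree_add_eq_left) auto
  then show "elem2 (s \<circ> e)"
    unfolding e(4) s(4) el_comp using e s by (intro elem2_el) auto
qed

lemma tri_inv:
  assumes "tri s" shows "tri (inv s)"
proof -
  obtain a p b h where e: "a \<noteq> 0" "b \<noteq> 0" "degree p \<le> 1" "s = el a p b h"
    using assms(1) unfolding tri_iff by blast
  have "degree (smult (-1/a) (pcompose p [:-h/b, 1/b:])) \<le> 1"
    using e by (auto simp: degree_pcompose)
  then show ?thesis unfolding e(4) el_inverse(2)[OF e(1,2)]
    using e(1,2) by (intro tri_el) auto
qed

lemma tri_id: "tri id"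
proof -
  have "id = el 1 0 1 0" by (simp add: fun_eq_iff)
  then show ?thesis using tri_el[of 1 1 0 0] by simp
qed

lemma poly_aut_tri: "tri s \<Longrightarrow> poly_aut s"
  by (simp add: tri_def poly_aut_elementary)

lemma letter_elem2: "letter (tswap \<circ> e) \<longleftrightarrow> elem2 e"
proof
  assume "letter (tswap \<circ> e)"
  then obtain e' k a p where w: "e' \<noteq> 0" "a \<noteq> 0" "2 \<le> degree p" "tswap \<circ> e = lm e' k a p"
    unfolding letter_def by blast
  have "e = tswap \<circ> (tswap \<circ> e)" by (simp add: fun_eq_iff)
  also have "\<dots> = el a p e' k" unfolding w(4) by (auto simp: fun_eq_iff)
  finally show "elem2 e" unfolding elem2_iff using w by blast
next
  assume "elem2 e"
  then obtain a p b h where e: "a \<noteq> 0" "b \<noteq> 0" "2 \<le> degree p" "e = el a p b h"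
    unfolding elem2_iff by blast
  have "tswap \<circ> e = lm b h a p" unfolding e(4) by (auto simp: fun_eq_iff)
  then show "letter (tswap \<circ> e)" using e letterI by simp
qed

lemma elem2_letter: "letter w \<Longrightarrow> elem2 (tswap \<circ> w)"
  using letter_elem2[of "tswap \<circ> w"] by (simp flip: comp_assoc)

section \<open>Affine maps and affine involutions\<close>

lemma affine_tswap: "affine_aut tswap"
  unfolding affine_aut_def tswap_def
  by (intro exI[of _ 0] exI[of _ 1] exI[of _ 1] exI[of _ 0]) auto

lemma not_elementary_affine:
  assumes "affine_aut r" "\<not> elementary r"
  obtains a b c d u v where "a * d - b * c \<noteq> 0" "c \<noteq> 0" "r = (\<lambda>(x, y). (a * x + b * y + u, c * x + d * y + v))"
proof -
  obtain a b c d u v where r: "a * d - b * c \<noteq> 0" "r = (\<lambda>(x, y). (a * x + b * y + u, c * x + d * y + v))"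
    using assms(1) unfolding affine_aut_def by blast
  have "c \<noteq> 0"
  proof
    assume "c = 0"
    then have "r = el a [:u, b:] d v" using r(2) by (simp add: fun_eq_iff mult.commute add.commute)
    moreover have "a \<noteq> 0" "d \<noteq> 0" using r(1) \<open>c = 0\<close> by auto
    ultimately show False using assms(2) unfolding elementary_el by blast
  qed
  then show ?thesis using that r by blast
qed

lemma not_elementary_tswap: "\<not> elementary tswap"
proof
  assume "elementary tswap"
  then obtain a p b h where *: "tswap = el a p b h" unfolding elementary_el by blast
  show False using fun_cong[OF *, of "(0, 0)"] fun_cong[OF *, of "(1, 0)"] by simp
qed

text \<open>The big cell of the Bruhat decomposition: the lower left entry \<open>c\<close> of the
  linear part is nonzero. The right factor makes the second component of \<open>r\<close> the new
  first coordinate, and the left one rebuilds the first component of \<open>r\<close>.\<close>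

lemma affine_decomposition:
  assumes "affine_aut r" "\<not> elementary r"
  shows "\<exists>s s'. tri s \<and> tri s' \<and> r = s \<circ> tswap \<circ> s'"
proof -
  obtain a b c d u v where r: "a * d - b * c \<noteq> 0" "c \<noteq> 0" "r = (\<lambda>(x, y). (a * x + b * y + u, c * x + d * y + v))"
    using not_elementary_affine[OF assms] .
  let ?s = "el (b - a * d / c) [:u - a * v / c, a / c:] 1 0" and ?s' = "el c [:v, d:] 1 0"
  have "b - a * d / c \<noteq> 0" using r(1,2) by (auto simp: field_simps)
  then have "tri ?s" "tri ?s'"
    using r(2) by (auto intro!: tri_el)
  moreover have "r = ?s \<circ> tswap \<circ> ?s'"
    unfolding r(3) using r(2) by (auto simp: fun_eq_iff field_simps)
  ultimately show ?thesis by blast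
qed

text \<open>In the coordinates (second component of \<open>r\<close>, y), independent because
  \<open>c \<noteq> 0\<close>, an involution simply exchanges the two.\<close>

lemma affine_involution_conj:
  assumes "affine_aut r" "\<not> elementary r" "involution r"
  shows "\<exists>s. tri s \<and> s \<circ> r = tswap \<circ> s"
proof -
  obtain a b c d u v where r: "a * d - b * c \<noteq> 0" "c \<noteq> 0" "r = (\<lambda>(x, y). (a * x + b * y + u, c * x + d * y + v))"
    using not_elementary_affine[OF assms(1,2)] .
  have rr: "r (r z) = z" for z
    using assms(3) unfolding involution_def by (metis comp_apply id_apply)
  have c0: "a * u + b * v + u = 0" "c * u + d * v + v = 0"
    using rr[of "(0, 0)"] by (simp_all add: r(3))
  have c1: "a * (a + u) + b * (c + v) + u = 1" "c * (a + u) + d * (c + v) + v = 0"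
    using rr[of "(1, 0)"] by (simp_all add: r(3))
  have sq: "a * a + b * c = 1" "c * (a + d) = 0"
    using c0 c1 by (simp_all add: algebra_simps) (metis add.commute add.left_commute add_0)+
  have d: "d = - a" using sq(2) r(2) by (metis add.commute add_eq_0_iff2 mult_eq_0_iff)
  let ?s = "el c [:v, d:] 1 0"
  have "tri ?s" using r(2) by (auto intro!: tri_el)
  moreover have "?s \<circ> r = tswap \<circ> ?s"
  proof -
    have "?s (r (x, y)) = tswap (?s (x, y))" for x y
    proof -
      have "c * (a * x + b * y + u) + (v + (c * x + d * y + v) * d) = y + (c * u - a * v + v)"
        using sq(1) unfolding d by algebra
      also have "\<dots> = y" using c0(2) unfolding d by algebra
      finally show ?thesis by (simp add: r(3) algebra_simps)
    qed
    then show ?thesis by (simp add: fun_eq_iff)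
  qed
  ultimately show ?thesis by blast
qed

subsection \<open>Reduction of symmetric words to letters\<close>

text \<open>The symmetric word \<open>f\<^sub>1\<^sup>-\<^sup>1 \<cdots> f\<^sub>m\<^sup>-\<^sup>1 r\<^sub>1 f\<^sub>m \<cdots> f\<^sub>1 r\<^sub>0\<close> with \<open>W = f\<^sub>m \<cdots> f\<^sub>1\<close>.\<close>

definition core :: "pmap \<Rightarrow> pmap \<Rightarrow> pmap \<Rightarrow> pmap" where
  "core W r1 r0 = inv W \<circ> r1 \<circ> W \<circ> r0"

text \<open>The two ends of \<open>W\<close> may be changed by different maps: \<open>s1\<close> has
  to respect \<open>r1\<close> and \<open>s0\<close> has to respect \<open>r0\<close>, while only
  \<open>s0\<close> conjugates the whole word.\<close>

lemma core_intertwine: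
  assumes W: "poly_aut W" "poly_aut W'" and s: "poly_aut s0"
    and eq: "s1 \<circ> W = W' \<circ> s0" "s1 \<circ> r1 = r1' \<circ> s1" "s0 \<circ> r0 = r0' \<circ> s0"
  shows "conj_in_G (core W r1 r0) (core W' r1' r0')"
proof -
  note w = poly_autD(6,7)[OF W(1)] poly_autD(6,7)[OF W(2)]
  have e: "s1 (W z) = W' (s0 z)" "s1 (r1 z) = r1' (s1 z)" "s0 (r0 z) = r0' (s0 z)" for z
    using fun_cong[OF eq(1), of z] fun_cong[OF eq(2), of z] fun_cong[OF eq(3), of z] by simp_all
  have "W' (s0 (inv W z)) = s1 z" for z using e(1)[of "inv W z"] w(1) by simp
  then have i: "s0 (inv W z) = inv W' (s1 z)" for z using w(4) by metis
  have "s0 \<circ> core W r1 r0 = core W' r1' r0' \<circ> s0"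
    by (simp add: fun_eq_iff core_def i e del: split_paired_All)
  then have "conj_in_G (core W' r1' r0') (core W r1 r0)" using s conj_in_GI by metis
  then show ?thesis by (rule conj_in_G_sym)
qed

text \<open>Conjugation by \<open>r1 \<circ> W\<close> exchanges the roles of the involutions, so in
  the mixed case the affine one may be put at the right end.\<close>

lemma core_swap:
  assumes W: "poly_aut W" and r1: "poly_aut r1" "involution r1"
  shows "conj_in_G (core W r1 r0) (core (inv W) r0 r1)"
proof -
  note w = poly_autD(6,7)[OF W]
  have r: "r1 (r1 z) = z" for z using fun_cong[OF r1(2)[unfolded involution_def], of z] by simp
  have "inv (inv W) = W" using W poly_autD(1) by (simp add: inv_inv_eq)
  then have "(r1 \<circ> W) \<circ> core W r1 r0 = core (inv W) r0 r1 \<circ> (r1 \<circ> W)"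
    by (simp add: fun_eq_iff core_def w r del: split_paired_All)
  then have "conj_in_G (core (inv W) r0 r1) (core W r1 r0)"
    using poly_aut_comp[OF r1(1) W] conj_in_GI by metis
  then show ?thesis by (rule conj_in_G_sym)
qed

lemma involution_conj:
  assumes "involution r" "poly_aut s" shows "involution (s \<circ> r \<circ> inv s)" "s \<circ> r = (s \<circ> r \<circ> inv s) \<circ> s"
proof -
  have r: "r (r z) = z" for z using fun_cong[OF assms(1)[unfolded involution_def], of z] by simp
  show "involution (s \<circ> r \<circ> inv s)" "s \<circ> r = (s \<circ> r \<circ> inv s) \<circ> s"
    unfolding involution_def using r poly_autD(6,7)[OF assms(2)] by (simp_all add: fun_eq_iff del: split_paired_All)
qed

lemma elem2_conj: "elem2 e \<Longrightarrow> tri s \<Longrightarrow> elem2 (s \<circ> e \<circ> inv s)"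
  by (intro elem2_tri tri_inv)

lemma reduced_word_Cons:
  "reduced_word (u # v # ws) \<longleftrightarrow> in_AE_minus_S u \<and> diff_subgroups u v \<and> reduced_word (v # ws)"
proof
  assume r: "reduced_word (u # v # ws)"
  have "diff_subgroups ((v # ws) ! i) ((v # ws) ! Suc i)" if "Suc i < length (v # ws)" for i
  proof -
    have "Suc (Suc i) < length (u # v # ws)" using that by simp
    then have "diff_subgroups ((u # v # ws) ! Suc i) ((u # v # ws) ! Suc (Suc i))"
      using r unfolding reduced_word_def by blast
    then show ?thesis by simp
  qed
  moreover have "diff_subgroups ((u # v # ws) ! 0) ((u # v # ws) ! Suc 0)"
    using r unfolding reduced_word_def by force
  ultimately show "in_AE_minus_S u \<and> diff_subgroups u v \<and> reduced_word (v # ws)"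
    using r unfolding reduced_word_def by simp
next
  assume a: "in_AE_minus_S u \<and> diff_subgroups u v \<and> reduced_word (v # ws)"
  have "diff_subgroups ((u # v # ws) ! i) ((u # v # ws) ! Suc i)" if "Suc i < length (u # v # ws)" for i
  proof (cases i)
    case (Suc j)
    then show ?thesis using a that unfolding reduced_word_def by simp
  qed (use a in simp)
  then show "reduced_word (u # v # ws)" using a unfolding reduced_word_def by simp
qed

lemma reduced_word_single: "reduced_word [u] \<longleftrightarrow> in_AE_minus_S u"
  by (simp add: reduced_word_def)

lemma reduced_word_appendD:
  assumes "reduced_word (us @ vs)"
  shows "us \<noteq> [] \<Longrightarrow> reduced_word us" "vs \<noteq> [] \<Longrightarrow> reduced_word vs"
    "us \<noteq> [] \<Longrightarrow> vs \<noteq> [] \<Longrightarrow> diff_subgroups (last us) (hd vs)"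
proof -
  have "(us \<noteq> [] \<longrightarrow> reduced_word us) \<and> (vs \<noteq> [] \<longrightarrow> reduced_word vs) \<and>
      (us \<noteq> [] \<longrightarrow> vs \<noteq> [] \<longrightarrow> diff_subgroups (last us) (hd vs))"
    using assms
  proof (induction us)
    case (Cons u us)
    show ?case
    proof (cases us)
      case Nil
      then show ?thesis using Cons.prems
        by (cases vs) (simp_all add: reduced_word_Cons reduced_word_single)
    next
      case (Cons u' us')
      then show ?thesis using Cons.IH Cons.prems by (simp add: reduced_word_Cons)
    qed
  qed simp
  then show "us \<noteq> [] \<Longrightarrow> reduced_word us" "vs \<noteq> [] \<Longrightarrow> reduced_word vs"
    "us \<noteq> [] \<Longrightarrow> vs \<noteq> [] \<Longrightarrow> diff_subgroups (last us) (hd vs)"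
    by blast+
qed

lemma reduced_word_poly_aut:
  assumes "reduced_word us" "u \<in> set us" shows "poly_aut u"
proof -
  have "in_AE_minus_S u" using assms by (simp add: reduced_word_def)
  then consider "elementary u" | "affine_aut u" "\<not> elementary u"
    unfolding in_AE_minus_S_def by blast
  then show ?thesis
  proof cases
    case 2
    then obtain s s' where "tri s" "tri s'" "u = s \<circ> tswap \<circ> s'" using affine_decomposition by blast
    then show ?thesis using poly_aut_tri poly_aut_tswap poly_aut_comp by metis
  qed (rule poly_aut_elementary)
qed

text \<open>Each affine factor contributes a swap; the triangular maps around it are absorbed into the neighbouring
  elementary factors.\<close>

lemma reduced_word_letters:
  assumes "reduced_word (us @ [f])" "elementary f" "tri s"
  shows "\<exists>h ks. letters ks \<and> word_map (us @ [f]) \<circ> s = h \<circ> word_map ks \<and>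
    (if affine_aut (hd (us @ [f])) then tri h else elem2 h)"
  using assms(1)
proof (induction us)
  case Nil
  then have "\<not> affine_aut f" using assms(2) by (auto simp: reduced_word_single in_AE_minus_S_def)
  then have "elem2 (f \<circ> s)" using assms by (intro elem2_tri) (simp_all add: elem2_def)
  then show ?case using \<open>\<not> affine_aut f\<close> by (intro exI[of _ "f \<circ> s"] exI[of _ "[]"]) simp
next
  case (Cons u us)
  obtain v vs where vs: "us @ [f] = v # vs" by (cases us) auto
  have red: "in_AE_minus_S u" "diff_subgroups u v" "reduced_word (us @ [f])"
    using Cons.prems by (simp_all add: vs reduced_word_Cons)
  have "in_AE_minus_S v" using red(3) by (simp add: vs reduced_word_def)
  from Cons.IH[OF red(3)] obtain h ks where h: "letters ks" "word_map (v # vs) \<circ> s = h \<circ> word_map ks"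
    "if affine_aut v then tri h else elem2 h"
    unfolding vs list.sel by blast
  have "word_map ((u # us) @ [f]) \<circ> s = u \<circ> (word_map (v # vs) \<circ> s)"
    by (simp only: append_Cons vs word_map_simps(2)[of u] comp_assoc)
  then have eq: "word_map ((u # us) @ [f]) \<circ> s = u \<circ> h \<circ> word_map ks"
    by (simp only: h(2) comp_assoc)
  show ?case
  proof (cases "affine_aut u")
    case True
    then have "\<not> elementary u" "\<not> affine_aut v"
      using red(1,2) by (auto simp: in_AE_minus_S_def diff_subgroups_def)
    then obtain s1 s2 where s: "tri s1" "tri s2" "u = s1 \<circ> tswap \<circ> s2"
      using affine_decomposition[OF True] by blast
    have "letter (tswap \<circ> (s2 \<circ> h))"
      using h(3) \<open>\<not> affine_aut v\<close> s(2) by (simp add: letter_elem2 elem2_tri)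
    moreover have "u \<circ> h \<circ> word_map ks = s1 \<circ> word_map ((tswap \<circ> (s2 \<circ> h)) # ks)"
      by (simp add: s(3) comp_assoc)
    ultimately show ?thesis using True s(1) h(1) unfolding eq
      by (intro exI[of _ s1] exI[of _ "(tswap \<circ> (s2 \<circ> h)) # ks"]) (simp del: word_map_simps)
  next
    case False
    then have "elementary u" "affine_aut v"
      using red(1,2) \<open>in_AE_minus_S v\<close> by (auto simp: in_AE_minus_S_def diff_subgroups_def)
    then have "elem2 (u \<circ> h)" using h(3) False by (intro elem2_tri) (simp_all add: elem2_def)
    then show ?thesis using False h(1) unfolding eq
      by (intro exI[of _ "u \<circ> h"] exI[of _ ks]) (simp del: word_map_simps)
  qed
qed

lemma reduced_word_split:
  assumes "reduced_word us" "us \<noteq> []" "elementary (last us)" "tri s"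
  obtains h ks where "letters ks" "word_map us \<circ> s = h \<circ> word_map ks"
    "affine_aut (hd us) \<longrightarrow> tri h" "\<not> affine_aut (hd us) \<longrightarrow> elem2 h"
proof -
  have us: "butlast us @ [last us] = us" using assms(2) by simp
  have "reduced_word (butlast us @ [last us])" unfolding us by (rule assms(1))
  from reduced_word_letters[OF this assms(3,4)] obtain h ks where
    "letters ks \<and> word_map us \<circ> s = h \<circ> word_map ks \<and> (if affine_aut (hd us) then tri h else elem2 h)"
    unfolding us by (elim exE)
  note h = this[THEN conjunct1] this[THEN conjunct2, THEN conjunct1] this[THEN conjunct2, THEN conjunct2]
  show thesis
  proof (rule that[OF h(1,2)])
    show "affine_aut (hd us) \<longrightarrow> tri h" "\<not> affine_aut (hd us) \<longrightarrow> elem2 h"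
      using h(3) by simp_all
  qed
qed

definition elem2_involution :: "pmap \<Rightarrow> bool" where
  "elem2_involution e \<longleftrightarrow> elem2 e \<and> involution e"

lemma elem2_involution_conj: "elem2_involution e \<Longrightarrow> tri s \<Longrightarrow> elem2_involution (s \<circ> e \<circ> inv s)"
  by (simp add: elem2_involution_def elem2_conj involution_conj(1) poly_aut_tri)

text \<open>Here an elementary factor \<open>h\<close> is left over next to \<open>r1\<close>. Using
  \<open>tswap \<circ> s'\<close> instead of \<open>s'\<close> turns it into one more letter, and
  the extra swap commutes with the involution \<open>tswap\<close>.\<close>

lemma core_aa:
  assumes red: "reduced_word (us @ [r0])" and us: "us \<noteq> []" "elementary (hd us)"
    and r0: "affine_aut r0" "involution r0" and r1: "affine_aut r1" "\<not> elementary r1" "involution r1"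
  shows "\<exists>ks. letters ks \<and> ks \<noteq> [] \<and> conj_in_G (core (word_map us) r1 r0) (core (word_map ks) tswap tswap)"
proof -
  have red': "reduced_word us" "diff_subgroups (last us) r0" "in_AE_minus_S r0"
    using reduced_word_appendD[OF red] us(1) by (auto simp: reduced_word_single)
  have "in_AE_minus_S (last us)" "in_AE_minus_S (hd us)" using red'(1) us(1) by (auto simp: reduced_word_def)
  then have last: "elementary (last us)" and hd: "\<not> affine_aut (hd us)"
    using red'(2) r0(1) us(2) by (auto simp: in_AE_minus_S_def diff_subgroups_def)
  have "\<not> elementary r0" using red'(3) r0(1) by (auto simp: in_AE_minus_S_def)
  then obtain s where s: "tri s" "s \<circ> r0 = tswap \<circ> s" using affine_involution_conj r0 by blast
  obtain s' where s': "tri s'" "s' \<circ> r1 = tswap \<circ> s'" using affine_involution_conj r1 by blast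
  obtain h ks where h: "letters ks" "word_map us \<circ> inv s = h \<circ> word_map ks"
    and "affine_aut (hd us) \<longrightarrow> tri h" "\<not> affine_aut (hd us) \<longrightarrow> elem2 h"
    by (rule reduced_word_split[OF red'(1) us(1) last tri_inv[OF s(1)]])
  then have h3: "elem2 h" using hd by blast
  let ?ks = "(tswap \<circ> (s' \<circ> h)) # ks"
  have ls: "letters ?ks" using h(1) elem2_tri(2)[OF h3 s'(1)] by (simp add: letter_elem2)
  have "conj_in_G (core (word_map us) r1 r0) (core (word_map ?ks) tswap tswap)"
  proof (rule core_intertwine[where ?s0.0 = s and ?s1.0 = "tswap \<circ> s'"])
    show "poly_aut (word_map us)" using reduced_word_poly_aut[OF red'(1)] by (rule poly_aut_word_map)
    show "poly_aut (word_map ?ks)" using ls by (rule poly_aut_letters)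
    show "poly_aut s" using s(1) by (rule poly_aut_tri)
    have "word_map us = word_map us \<circ> (inv s \<circ> s)" using poly_autD(5)[OF poly_aut_tri[OF s(1)]] by simp
    also have "\<dots> = h \<circ> word_map ks \<circ> s" using h(2) by (simp only: flip: comp_assoc)
    finally show "tswap \<circ> s' \<circ> word_map us = word_map ?ks \<circ> s" by (simp add: comp_assoc)
    show "tswap \<circ> s' \<circ> r1 = tswap \<circ> (tswap \<circ> s')" using s'(2) by (simp add: comp_assoc)
    show "s \<circ> r0 = tswap \<circ> s" by (rule s(2))
  qed
  then show ?thesis using ls by (intro exI[of _ ?ks]) (simp del: word_map_simps)
qed

text \<open>The leftover \<open>h\<close> is triangular, so it can be absorbed by conjugating
  \<open>r1\<close>, which remains an elementary involution. For empty \<open>us\<close> it is just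
  \<open>inv s\<close>.\<close>

lemma core_ea:
  assumes red: "reduced_word (us @ [r0])" and us: "us \<noteq> [] \<Longrightarrow> affine_aut (hd us)"
    and r0: "affine_aut r0" "involution r0" and r1: "elem2_involution r1"
  shows "\<exists>ks e. letters ks \<and> elem2_involution e \<and> conj_in_G (core (word_map us) r1 r0) (core (word_map ks) e tswap)"
proof -
  have "in_AE_minus_S r0" using red by (simp add: reduced_word_def)
  then have "\<not> elementary r0" using r0(1) by (auto simp: in_AE_minus_S_def)
  then obtain s where s: "tri s" "s \<circ> r0 = tswap \<circ> s" using affine_involution_conj r0 by blast
  have ps: "poly_aut s" using s(1) by (rule poly_aut_tri)
  have pus: "poly_aut (word_map us)" using reduced_word_poly_aut[OF red] by (intro poly_aut_word_map) simp
  obtain h ks where h: "letters ks" "word_map us \<circ> inv s = h \<circ> word_map ks" "tri h"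
  proof (cases "us = []")
    case True
    then show ?thesis using that[of "[]" "inv s"] tri_inv[OF s(1)] by simp
  next
    case False
    have red': "reduced_word us" "diff_subgroups (last us) r0"
      using reduced_word_appendD[OF red] False by auto
    have "in_AE_minus_S (last us)" using red'(1) False by (auto simp: reduced_word_def)
    then have last: "elementary (last us)"
      using red'(2) r0(1) by (auto simp: in_AE_minus_S_def diff_subgroups_def)
    obtain h ks where h: "letters ks" "word_map us \<circ> inv s = h \<circ> word_map ks"
      and "affine_aut (hd us) \<longrightarrow> tri h" "\<not> affine_aut (hd us) \<longrightarrow> elem2 h"
      by (rule reduced_word_split[OF red'(1) False last tri_inv[OF s(1)]])
    then have "tri h" using us[OF False] by blast
    then show ?thesis by (rule that[OF h])
  qed
  let ?s1 = "inv h"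
  have ph: "poly_aut h" "poly_aut ?s1" using h(3) poly_aut_tri tri_inv by auto
  have e: "elem2_involution (?s1 \<circ> r1 \<circ> inv ?s1)" by (rule elem2_involution_conj[OF r1 tri_inv[OF h(3)]])
  have "conj_in_G (core (word_map us) r1 r0) (core (word_map ks) (?s1 \<circ> r1 \<circ> inv ?s1) tswap)"
  proof (rule core_intertwine[OF pus poly_aut_letters[OF h(1)] ps _ _ s(2)])
    have "?s1 \<circ> word_map us = ?s1 \<circ> (word_map us \<circ> inv s) \<circ> s"
      using poly_autD(5)[OF ps] by (simp add: comp_assoc)
    also have "\<dots> = word_map ks \<circ> s"
      unfolding h(2) using poly_autD(5)[OF ph(1)] by (simp flip: comp_assoc)
    finally show "?s1 \<circ> word_map us = word_map ks \<circ> s" .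
    show "?s1 \<circ> r1 = (?s1 \<circ> r1 \<circ> inv ?s1) \<circ> ?s1"
      using r1 by (intro involution_conj ph(2)) (simp add: elem2_involution_def)
  qed
  then show ?thesis using h(1) e by blast
qed

text \<open>The factor next to \<open>r0\<close> is affine and contributes a swap with no elementary
  factor to its right; conjugating by it moves \<open>r0\<close> to
  \<open>tswap \<circ> e0 \<circ> tswap\<close>.\<close>

lemma core_ee:
  assumes red: "reduced_word (us @ [r0])" and us: "us \<noteq> []" "affine_aut (hd us)"
    and r0: "elem2_involution r0" and r1: "elem2_involution r1"
  shows "\<exists>ks e e0. letters ks \<and> elem2_involution e \<and> elem2_involution e0 \<and>
    conj_in_G (core (word_map us) r1 r0) (core (word_map ks) e (tswap \<circ> e0 \<circ> tswap))"
proof -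
  have red': "reduced_word us" "diff_subgroups (last us) r0"
    using reduced_word_appendD[OF red] us(1) by auto
  have "in_AE_minus_S (last us)" using red'(1) us(1) by (auto simp: reduced_word_def)
  then have last: "affine_aut (last us)" "\<not> elementary (last us)"
    using red'(2) r0 by (auto simp: in_AE_minus_S_def diff_subgroups_def elem2_involution_def elem2_def)
  obtain s1 s2 where s: "tri s1" "tri s2" "last us = s1 \<circ> tswap \<circ> s2"
    using affine_decomposition[OF last] by blast
  define vs where "vs = butlast us"
  have us_eq: "us = vs @ [last us]" using us(1) by (simp add: vs_def)
  obtain h ks where h: "letters ks" "word_map vs \<circ> s1 = h \<circ> word_map ks" "tri h"
  proof (cases "vs = []")
    case True
    then show ?thesis using that[of "[]" s1] s(1) by simp
  next
    case False
    have "reduced_word (vs @ [last us])" using red'(1) us_eq by simp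
    note red'' = reduced_word_appendD[OF this]
    have "diff_subgroups (last vs) (last us)" "reduced_word vs" using red''(1,3) False by auto
    moreover from this have "in_AE_minus_S (last vs)" using False by (auto simp: reduced_word_def)
    ultimately have lv: "elementary (last vs)"
      using last by (auto simp: in_AE_minus_S_def diff_subgroups_def)
    have hv: "affine_aut (hd vs)" using us(2) us_eq False by (metis hd_append2)
    obtain h ks where h: "letters ks" "word_map vs \<circ> s1 = h \<circ> word_map ks"
      and "affine_aut (hd vs) \<longrightarrow> tri h" "\<not> affine_aut (hd vs) \<longrightarrow> elem2 h"
      by (rule reduced_word_split[OF \<open>reduced_word vs\<close> False lv s(1)])
    then have "tri h" using hv by blast
    then show ?thesis by (rule that[OF h])
  qed
  let ?s1 = "inv h"
  have ps: "poly_aut s2" "poly_aut h" "poly_aut ?s1" using s h(3) poly_aut_tri tri_inv by auto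
  have pus: "poly_aut (word_map us)" using reduced_word_poly_aut[OF red'(1)] by (rule poly_aut_word_map)
  define e e0 where "e = ?s1 \<circ> r1 \<circ> inv ?s1" and "e0 = s2 \<circ> r0 \<circ> inv s2"
  have e: "elem2_involution e" "elem2_involution e0"
    unfolding e_def e0_def using r0 r1 s(2) h(3) by (auto intro!: elem2_involution_conj tri_inv)
  have "conj_in_G (core (word_map us) r1 r0) (core (word_map ks) e (tswap \<circ> e0 \<circ> tswap))"
  proof (rule core_intertwine[OF pus poly_aut_letters[OF h(1)] poly_aut_comp[OF poly_aut_tswap ps(1)]])
    have "word_map us = h \<circ> word_map ks \<circ> tswap \<circ> s2"
      using h(2) s(3) by (subst us_eq) (simp flip: comp_assoc)
    then show "?s1 \<circ> word_map us = word_map ks \<circ> (tswap \<circ> s2)"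
      using poly_autD(5)[OF ps(2)] by (simp flip: comp_assoc)
    show "?s1 \<circ> r1 = e \<circ> ?s1"
      unfolding e_def using r1 by (intro involution_conj ps(3)) (simp add: elem2_involution_def)
    have "s2 \<circ> r0 = e0 \<circ> s2"
      unfolding e0_def using r0 by (intro involution_conj ps(1)) (simp add: elem2_involution_def)
    then show "tswap \<circ> s2 \<circ> r0 = tswap \<circ> e0 \<circ> tswap \<circ> (tswap \<circ> s2)"
      by (simp add: fun_eq_iff)
  qed
  then show ?thesis using h(1) e by blast
qed

subsection \<open>Normalisation\<close>

lemma complex_root_exists:
  assumes "c \<noteq> 0" "0 < n" shows "\<exists>z::complex. z \<noteq> 0 \<and> z ^ n = c"
proof -
  have "card {z. z ^ n = c} = n" using assms by (intro card_nth_roots)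
  then have "{z. z ^ n = c} \<noteq> {}" using assms(2) by (metis card.empty less_irrefl)
  then obtain z where "z ^ n = c" by blast
  moreover from this have "z \<noteq> 0" using assms by (auto simp: power_0_left)
  ultimately show ?thesis by blast
qed

lemma balance_powers:
  fixes u v :: complex
  assumes "u \<noteq> 0" "v \<noteq> 0" "m < n" shows "\<exists>z. z \<noteq> 0 \<and> u * z ^ m = v * z ^ n"
proof -
  obtain z where z: "z \<noteq> 0" "z ^ (n - m) = u / v"
    using complex_root_exists[of "u / v" "n - m"] assms by auto
  have "z ^ n = z ^ (n - m) * z ^ m" using assms(3) by (simp flip: power_add)
  then have "v * z ^ n = u * z ^ m" using z(2) assms(2) by simp
  then show ?thesis using z(1) by metis
qed

text \<open>The barycentre of the roots; moving it to 0 removes the coefficient below the leading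
  one.\<close>

definition centre :: "complex poly \<Rightarrow> complex" where
  "centre p = - coeff p (degree p - 1) / (of_nat (degree p) * lead_coeff p)"

lemma centred:
  assumes p: "2 \<le> degree p" and b: "b \<noteq> 0" and m: "m * lead_coeff p = b ^ degree p"
  defines "q \<equiv> smult m (pcompose p [:centre p, 1/b:])"
  shows "degree q = degree p" "lead_coeff q = 1" "coeff q (degree q - 1) = 0"
proof -
  obtain n where n: "degree p = Suc n" using p by (cases "degree p") auto
  have lc: "lead_coeff p \<noteq> 0" using p by auto
  have m0: "m \<noteq> 0"
  proof
    assume "m = 0"
    then have "b ^ degree p = 0" using m by simp
    then show False using b by simp
  qed
  show dq: "degree q = degree p" unfolding q_def using m0 b by (simp add: degree_pcompose)
  have "lead_coeff q = m * (1/b) ^ degree p * lead_coeff p"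
    unfolding dq unfolding q_def using coeff_pcompose_affine(1)[of p "degree p" "centre p" "1/b"] by simp
  also have "\<dots> = b ^ degree p * (1/b) ^ degree p" by (simp flip: m)
  finally show "lead_coeff q = 1" using b by (simp flip: power_mult_distrib)
  have "coeff q n = m * ((1/b) ^ n * (coeff p n + of_nat (Suc n) * centre p * coeff p (Suc n)))"
    unfolding q_def using coeff_pcompose_affine(2)[of p n "centre p" "1/b"] n by simp
  moreover have "of_nat (Suc n) * centre p * coeff p (Suc n) = - coeff p n"
  proof -
    have "of_nat (Suc n) \<noteq> (0::complex)" by (rule of_nat_neq_0)
    moreover have "coeff p (Suc n) \<noteq> 0" using lc n by simp
    ultimately show ?thesis unfolding centre_def n by (simp del: of_nat_Suc)
  qed
  ultimately show "coeff q (degree q - 1) = 0" unfolding dq n by simp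
qed

lemma normal_henon_lm:
  "d \<noteq> 0 \<Longrightarrow> 2 \<le> degree p \<Longrightarrow> lead_coeff p = 1 \<Longrightarrow> coeff p (degree p - 1) = 0 \<Longrightarrow> normal_henon (lm 1 0 d p)"
  unfolding normal_henon_def
  by (intro exI[of _ p] exI[of _ "- d"]) (auto simp: fun_eq_iff)

lemma normal_henonE:
  assumes "normal_henon h"
  obtains d p where "d \<noteq> 0" "2 \<le> degree p" "lead_coeff p = 1" "coeff p (degree p - 1) = 0" "h = lm 1 0 d p"
proof -
  obtain p \<delta> where "\<delta> \<noteq> 0" "2 \<le> degree p" "lead_coeff p = 1" "coeff p (degree p - 1) = 0"
    "h = (\<lambda>(x, y). (y, poly p y - \<delta> * x))"
    using assms unfolding normal_henon_def by blast
  then show ?thesis using that[of "- \<delta>" p] by (simp add: fun_eq_iff)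
qed

text \<open>Leading coefficient 1 ties \<open>b1\<close> to \<open>b0\<close>, and centring fixes
  the translation \<open>b0 * \<gamma>\<close>. The values \<open>a0\<close>, \<open>c0\<close>,
  \<open>d1\<close> stay free, which is what allows neighbouring letters to be spliced.\<close>

lemma normalise_letter:
  assumes "letter k"
  shows "\<exists>\<gamma> \<zeta> e l r. e \<noteq> 0 \<and> r \<noteq> 0 \<and> 2 \<le> l \<and> (\<forall>a0 c0 b0 b1 d1. a0 \<noteq> 0 \<longrightarrow> b0 \<noteq> 0 \<longrightarrow> b1 * r = b0 ^ l \<longrightarrow>
    (\<exists>h. normal_henon h \<and> dg (b0 / e) (b0 * \<zeta>) b1 d1 \<circ> k = h \<circ> dg a0 c0 b0 (b0 * \<gamma>)))"
proof -
  obtain e \<kappa> a p where k: "e \<noteq> 0" "a \<noteq> 0" "2 \<le> degree p" "k = lm e \<kappa> a p"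
    using assms unfolding letter_def by blast
  define \<gamma> where "\<gamma> = - centre p"
  have lc: "lead_coeff p \<noteq> 0" using k(3) by auto
  have "\<exists>h. normal_henon h \<and> dg (b0 / e) (b0 * (\<gamma> - \<kappa> / e)) b1 d1 \<circ> k = h \<circ> dg a0 c0 b0 (b0 * \<gamma>)"
    if nz: "a0 \<noteq> 0" "b0 \<noteq> 0" and b1: "b1 * lead_coeff p = b0 ^ degree p" for a0 c0 b0 b1 d1
  proof -
    define q0 where "q0 = smult b1 (pcompose p [:centre p, 1/b0:])"
    note q0 = centred[OF k(3) nz(2) b1, folded q0_def]
    \<comment> \<open>The constant term absorbs the free translations \<open>c0\<close> and
      \<open>d1\<close>; the two top coefficients are untouched because the degree is at least
      2.\<close>
    define q where "q = q0 + [:d1 - b1 * a / a0 * c0:]"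
    obtain n where n: "degree p = Suc (Suc n)" using k(3) by (metis add_2_eq_Suc le_Suc_ex)
    have dq: "degree q = Suc (Suc n)" unfolding q_def using q0(1) n by simp
    then have q: "2 \<le> degree q" "lead_coeff q = 1" "coeff q (degree q - 1) = 0"
      using q0 n unfolding q_def by simp_all
    have "b1 \<noteq> 0" using b1 nz(2) by (metis mult_zero_left power_not_zero)
    then have "normal_henon (lm 1 0 (b1 * a / a0) q)" using k(2) nz by (intro normal_henon_lm q) auto
    moreover have "dg (b0 / e) (b0 * (\<gamma> - \<kappa> / e)) b1 d1 \<circ> k = lm 1 0 (b1 * a / a0) q \<circ> dg a0 c0 b0 (b0 * \<gamma>)"
    proof -
      have "dg (b0 / e) (b0 * (\<gamma> - \<kappa> / e)) b1 d1 (k (x, y)) = lm 1 0 (b1 * a / a0) q (dg a0 c0 b0 (b0 * \<gamma>) (x, y))" for x y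
      proof -
        have "centre p + (b0 * y + b0 * \<gamma>) / b0 = y" using nz(2) by (simp add: \<gamma>_def field_simps)
        then have "poly q (b0 * y + b0 * \<gamma>) = b1 * poly p y + (d1 - b1 * a / a0 * c0)"
          by (simp add: q_def q0_def poly_pcompose)
        moreover have "b1 * a / a0 * (a0 * x + c0) = b1 * a * x + b1 * a / a0 * c0"
          using nz(1) by (simp add: field_simps)
        ultimately show ?thesis using k(1) by (simp add: k(4) field_simps)
      qed
      then show ?thesis by (simp add: fun_eq_iff)
    qed
    ultimately show ?thesis by blast
  qed
  then show ?thesis using k(1,3) lc by blast
qed

abbreviation normal_henons :: "pmap list \<Rightarrow> bool" where
  "normal_henons hs \<equiv> \<forall>h\<in>set hs. normal_henon h"

text \<open>The parameters depend on \<open>ks\<close> only. The freedom in \<open>a\<close>,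
  \<open>c\<close>, \<open>b\<close> at the right end and \<open>d\<close> at the left end is spent
  on matching the two boundary involutions.\<close>

definition normalises ::
  "complex \<Rightarrow> complex \<Rightarrow> complex \<Rightarrow> complex \<Rightarrow> nat \<Rightarrow> nat \<Rightarrow> pmap list \<Rightarrow> bool" where
  "normalises \<gamma> \<xi> \<mu> \<nu> m n ks \<longleftrightarrow> \<mu> \<noteq> 0 \<and> \<nu> \<noteq> 0 \<and> m < n \<and> (\<forall>a c b d. a \<noteq> 0 \<longrightarrow> b \<noteq> 0 \<longrightarrow>
    (\<exists>hs. normal_henons hs \<and>
      dg (\<mu> * b ^ m) (\<xi> * b ^ m) (\<nu> * b ^ n) d \<circ> word_map ks = word_map hs \<circ> dg a c b (b * \<gamma>)))"

text \<open>The scaling \<open>b\<close> of the second coordinate at the right end propagates through a word to scalings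
  \<open>\<mu> b\<^sup>m\<close> and \<open>\<nu> b\<^sup>N\<close> with \<open>m < N\<close> at the left end; the boundary involutions then fix \<open>b\<close> through
  an equation between two different powers.\<close>

lemma normalise_word:
  assumes "letters ks" "ks \<noteq> []"
  shows "\<exists>\<gamma> \<xi> \<mu> \<nu> m n. normalises \<gamma> \<xi> \<mu> \<nu> m n ks"
  using assms
proof (induction ks)
  case (Cons k ks)
  have "letter k" using Cons.prems(1) by simp
  from normalise_letter[OF this] obtain \<gamma> \<zeta> e l r where k: "e \<noteq> 0" "r \<noteq> 0" "2 \<le> (l::nat)"
    and "\<forall>a0 c0 b0 b1 d1. a0 \<noteq> 0 \<longrightarrow> b0 \<noteq> 0 \<longrightarrow> b1 * r = b0 ^ l \<longrightarrow>
      (\<exists>h. normal_henon h \<and> dg (b0 / e) (b0 * \<zeta>) b1 d1 \<circ> k = h \<circ> dg a0 c0 b0 (b0 * \<gamma>))"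
    by (elim exE conjE)
  then have step: "\<exists>h. normal_henon h \<and> dg (b0 / e) (b0 * \<zeta>) (b0 ^ l / r) d1 \<circ> k = h \<circ> dg a0 c0 b0 (b0 * \<gamma>)"
    if "a0 \<noteq> 0" "b0 \<noteq> 0" for a0 c0 b0 d1
    using that by simp
  show ?case
  proof (cases "ks = []")
    case True
    have "normalises \<gamma> \<zeta> (1/e) (1/r) 1 l (k # ks)"
      unfolding normalises_def
    proof (intro conjI allI impI)
      fix a c b d :: complex assume nz: "a \<noteq> 0" "b \<noteq> 0"
      obtain h where h: "normal_henon h" "dg (b / e) (b * \<zeta>) (b ^ l / r) d \<circ> k = h \<circ> dg a c b (b * \<gamma>)"
        using step[OF nz, of d c] by (elim exE conjE)
      have "dg (1 / e * b ^ 1) (\<zeta> * b ^ 1) (1 / r * b ^ l) d \<circ> word_map (k # ks) = word_map [h] \<circ> dg a c b (b * \<gamma>)"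
        using h(2) True by (simp add: mult.commute)
      then show "\<exists>hs. normal_henons hs \<and>
          dg (1 / e * b ^ 1) (\<zeta> * b ^ 1) (1 / r * b ^ l) d \<circ> word_map (k # ks) = word_map hs \<circ> dg a c b (b * \<gamma>)"
        using h(1) by (intro exI[of _ "[h]"] conjI) simp_all
    qed (use k in auto)
    then show ?thesis by (intro exI)
  next
    case False
    obtain \<gamma>' \<xi>' \<mu>' \<nu>' m' n' where ih: "normalises \<gamma>' \<xi>' \<mu>' \<nu>' m' n' ks"
      using Cons.IH Cons.prems(1) False by auto
    then have IH: "\<mu>' \<noteq> 0" "\<nu>' \<noteq> 0" "m' < n'" by (simp_all add: normalises_def)
    \<comment> \<open>The new first coordinate inherits the old second scaling
      \<open>\<nu>' * b ^ n'\<close>, and the new second one is its \<open>l\<close>-th power up to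
      a constant; hence the exponents \<open>n'\<close> and \<open>n' * l\<close>.\<close>
    have "normalises \<gamma>' (\<nu>' * \<zeta>) (\<nu>' / e) (\<nu>' ^ l / r) n' (n' * l) (k # ks)"
      unfolding normalises_def
    proof (intro conjI allI impI)
      fix a c b d :: complex assume nz: "a \<noteq> 0" "b \<noteq> 0"
      let ?a = "\<mu>' * b ^ m'" and ?c = "\<xi>' * b ^ m'" and ?b = "\<nu>' * b ^ n'"
      have "\<exists>hs. normal_henons hs \<and>
          dg ?a ?c ?b (?b * \<gamma>) \<circ> word_map ks = word_map hs \<circ> dg a c b (b * \<gamma>')"
        using ih nz by (simp only: normalises_def simp_thms)
      then obtain hs where hs: "normal_henons hs"
        "dg ?a ?c ?b (?b * \<gamma>) \<circ> word_map ks = word_map hs \<circ> dg a c b (b * \<gamma>')"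
        by (elim exE conjE)
      have "?a \<noteq> 0" "?b \<noteq> 0" using IH nz by auto
      from step[OF this, of d ?c] obtain h where h: "normal_henon h"
        "dg (?b / e) (?b * \<zeta>) (?b ^ l / r) d \<circ> k = h \<circ> dg ?a ?c ?b (?b * \<gamma>)"
        by (elim exE conjE)
      have "dg (\<nu>' / e * b ^ n') (\<nu>' * \<zeta> * b ^ n') (\<nu>' ^ l / r * b ^ (n' * l)) d = dg (?b / e) (?b * \<zeta>) (?b ^ l / r) d"
        unfolding power_mult power_mult_distrib by (simp add: mult_ac)
      then have "dg (\<nu>' / e * b ^ n') (\<nu>' * \<zeta> * b ^ n') (\<nu>' ^ l / r * b ^ (n' * l)) d \<circ> word_map (k # ks)
        = (dg (?b / e) (?b * \<zeta>) (?b ^ l / r) d \<circ> k) \<circ> word_map ks"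
        by (simp only: word_map_simps comp_assoc)
      also have "\<dots> = h \<circ> (dg ?a ?c ?b (?b * \<gamma>) \<circ> word_map ks)"
        by (simp only: h(2) comp_assoc)
      also have "\<dots> = word_map (h # hs) \<circ> dg a c b (b * \<gamma>')"
        by (simp only: hs(2) word_map_simps comp_assoc)
      finally show "\<exists>hs. normal_henons hs \<and>
          dg (\<nu>' / e * b ^ n') (\<nu>' * \<zeta> * b ^ n') (\<nu>' ^ l / r * b ^ (n' * l)) d \<circ> word_map (k # ks) =
          word_map hs \<circ> dg a c b (b * \<gamma>')"
        using h(1) hs(1) by (intro exI[of _ "h # hs"] conjI) simp_all
    next
      have "n' * 1 < n' * l" using IH(3) k(3) by (intro mult_strict_left_mono) auto
      then show "n' < n' * l" by simp
    qed (use IH k in auto)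
    then show ?thesis by (intro exI)
  qed
qed simp

text \<open>Both \<open>\<alpha>\<close> and \<open>\<beta>\<close> are signs, and
  \<open>\<alpha> = \<beta> = 1\<close> would force \<open>p = 0\<close>. For
  \<open>\<beta> = -1\<close> the reflection of y preserves \<open>p\<close> up to sign, so its
  centre \<open>\<eta> / 2\<close> is the barycentre of the roots, and centring \<open>p\<close>
  also centres the reflection.\<close>

lemma normalise_involution:
  assumes "elem2_involution e"
  shows "\<exists>\<gamma> l r. r \<noteq> 0 \<and> 2 \<le> l \<and> (\<forall>a c b. a \<noteq> 0 \<longrightarrow> b \<noteq> 0 \<longrightarrow> a * r = b ^ l \<longrightarrow>
    (\<exists>e'. normal_elem_involution e' \<and> elem_involution e' \<and> dg a c b (b * \<gamma>) \<circ> e = e' \<circ> dg a c b (b * \<gamma>)))"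
proof -
  obtain \<alpha> p \<beta> \<eta> where e: "\<alpha> \<noteq> 0" "\<beta> \<noteq> 0" "2 \<le> degree p" "e = el \<alpha> p \<beta> \<eta>"
    using assms unfolding elem2_involution_def elem2_iff by blast
  have ee: "e (e z) = z" for z
    using assms unfolding elem2_involution_def involution_def by (metis comp_apply id_apply)
  have lc: "lead_coeff p \<noteq> 0" using e(3) by auto
  have rel: "\<alpha> * (\<alpha> * x + poly p y) + poly p (\<beta> * y + \<eta>) = x" "\<beta> * (\<beta> * y + \<eta>) + \<eta> = y" for x y
    using ee[of "(x, y)"] by (simp_all add: e(4))
  have \<beta>2: "\<beta> * \<eta> + \<eta> = 0" "\<beta> * \<beta> = 1"
    using rel(2)[of 0] rel(2)[of 1] by algebra+
  have p\<alpha>: "\<alpha> * poly p y + poly p (\<beta> * y + \<eta>) = 0" for y using rel(1)[of 0 y] by simp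
  have "\<alpha> * \<alpha> = 1" using rel(1)[of 1 0] p\<alpha>[of 0] by (simp add: algebra_simps)
  then have \<alpha>: "\<alpha> = 1 \<or> \<alpha> = - 1" by (metis square_eq_1_iff)
  have \<beta>: "\<beta> = 1 \<or> \<beta> = - 1" using \<beta>2(2) by (metis square_eq_1_iff)
  define \<gamma> where "\<gamma> = - centre p"
  have cases: "\<alpha> = - 1 \<and> \<beta> = 1 \<and> \<eta> = 0 \<or> \<beta> = - 1 \<and> \<eta> = - 2 * \<gamma>"
    using \<beta>
  proof
    assume b1: "\<beta> = 1"
    then have "\<eta> = 0" using \<beta>2(1) by simp
    moreover have "\<alpha> \<noteq> 1"
    proof
      assume "\<alpha> = 1"
      then have "poly p y = poly 0 y" for y using p\<alpha>[of y] b1 \<open>\<eta> = 0\<close> by simp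
      then have "p = 0" by (rule poly_ext)
      then show False using e(3) by simp
    qed
    ultimately show ?thesis using b1 \<alpha> by blast
  next
    assume b1: "\<beta> = - 1"
    have "poly (smult \<alpha> p) y = poly (- pcompose p [:\<eta>, - 1:]) y" for y
      using p\<alpha>[of y] b1 by (simp add: poly_pcompose add_eq_0_iff2 add.commute)
    then have P: "smult \<alpha> p = - pcompose p [:\<eta>, - 1:]" by (rule poly_ext)
    obtain n where n: "degree p = Suc n" using e(3) by (cases "degree p") auto
    have "\<alpha> * coeff p (Suc n) = - ((- 1) ^ Suc n * coeff p (Suc n))"
      using arg_cong[OF P, of "\<lambda>q. coeff q (Suc n)"] coeff_pcompose_affine(1)[of p "Suc n" \<eta> "- 1"] n by simp
    moreover have "coeff p (Suc n) \<noteq> 0" using lc n by simp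
    ultimately have a: "\<alpha> = (- 1) ^ n" by (simp add: minus_mult_commute)
    have "\<alpha> * coeff p n = - ((- 1) ^ n * (coeff p n + of_nat (Suc n) * \<eta> * coeff p (Suc n)))"
      using arg_cong[OF P, of "\<lambda>q. coeff q n"] coeff_pcompose_affine(2)[of p n \<eta> "- 1"] n by simp
    then have "(- 1) ^ n * (2 * coeff p n + of_nat (Suc n) * \<eta> * coeff p (Suc n)) = 0"
      unfolding a by (simp add: algebra_simps)
    then have "of_nat (Suc n) * \<eta> * coeff p (Suc n) = - 2 * coeff p n"
      by (simp add: add_eq_0_iff2 del: of_nat_Suc)
    moreover have "of_nat (Suc n) \<noteq> (0::complex)" by (rule of_nat_neq_0)
    ultimately have "\<eta> = - 2 * \<gamma>"
      unfolding \<gamma>_def centre_def n using \<open>coeff p (Suc n) \<noteq> 0\<close> by (simp add: field_simps del: of_nat_Suc)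
    then show ?thesis using b1 by blast
  qed
  have "\<exists>e'. normal_elem_involution e' \<and> elem_involution e' \<and> dg a c b (b * \<gamma>) \<circ> e = e' \<circ> dg a c b (b * \<gamma>)"
    if nz: "a \<noteq> 0" "b \<noteq> 0" and ab: "a * lead_coeff p = b ^ degree p" for a c b
  proof -
    define q0 where "q0 = smult a (pcompose p [:centre p, 1/b:])"
    note q0 = centred[OF e(3) nz(2) ab, folded q0_def]
    define q where "q = q0 + [:c - \<alpha> * c:]"
    obtain n where n: "degree p = Suc (Suc n)" using e(3) by (metis add_2_eq_Suc le_Suc_ex)
    have dq: "degree q = Suc (Suc n)" unfolding q_def using q0(1) n by simp
    then have q: "2 \<le> degree q" "lead_coeff q = 1" "coeff q (degree q - 1) = 0"
      using q0 n unfolding q_def by simp_all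
    define e' where "e' = el \<alpha> q \<beta> 0"
    have eq: "dg a c b (b * \<gamma>) \<circ> e = e' \<circ> dg a c b (b * \<gamma>)"
    proof -
      have "dg a c b (b * \<gamma>) (e (x, y)) = e' (dg a c b (b * \<gamma>) (x, y))" for x y
      proof -
        have "centre p + (b * y + b * \<gamma>) / b = y" using nz(2) by (simp add: \<gamma>_def field_simps)
        then have "poly q (b * y + b * \<gamma>) = a * poly p y + (c - \<alpha> * c)"
          by (simp add: q_def q0_def poly_pcompose)
        moreover have "b * (\<beta> * y + \<eta>) + b * \<gamma> = \<beta> * (b * y + b * \<gamma>)"
          using cases by (auto simp: algebra_simps)
        ultimately show ?thesis by (simp add: e(4) e'_def algebra_simps)
      qed
      then show ?thesis by (simp add: fun_eq_iff)
    qed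
    have "e' (e' (dg a c b (b * \<gamma>) z)) = dg a c b (b * \<gamma>) z" for z
      using fun_cong[OF eq, of z] fun_cong[OF eq, of "e z"] ee[of z] by simp
    then have inv: "e' (e' z) = z" for z
      using poly_autD(6)[OF poly_aut_dg(1)[OF nz, of c "b * \<gamma>"], of z] by metis
    have "involution e'"
      unfolding involution_def using inv by (simp add: fun_eq_iff del: split_paired_All)
    moreover have "elementary e'" unfolding elementary_el e'_def using e(1,2) by blast
    ultimately have "elem_involution e'" by (simp add: elem_involution_def)
    moreover have "normal_elem_involution e'"
      unfolding normal_elem_involution_def
    proof (intro exI[of _ q] conjI)
      have sym: "\<alpha> * poly q y + poly q (\<beta> * y) = 0" for y
        using inv[of "(0, y)"] by (simp add: e'_def)
      \<comment> \<open>Parity needs no separate normalisation: it is the involution equation read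
        coefficient by coefficient.\<close>
      have par: "(\<alpha> + (- 1) ^ i) * coeff q i = 0" if "\<beta> = - 1" for i
      proof -
        have "poly (smult \<alpha> q + pcompose q [:0, - 1:]) y = poly 0 y" for y
          using sym[of y] that by (simp add: poly_pcompose)
        then have "smult \<alpha> q + pcompose q [:0, - 1:] = 0" by (rule poly_ext)
        then have "coeff (smult \<alpha> q + pcompose q [:0, - 1:]) i = 0" by simp
        then show ?thesis by (simp add: coeff_pcompose_linear distrib_right)
      qed
      show "(coeff q (degree q - 1) = 0 \<and> e' = (\<lambda>(x, y). (- x + poly q y, y))) \<or>
        ((\<forall>i. even i \<longrightarrow> coeff q i = 0) \<and> e' = (\<lambda>(x, y). (x + poly q y, - y))) \<or>
        ((\<forall>i. odd i \<longrightarrow> coeff q i = 0) \<and> e' = (\<lambda>(x, y). (- x + poly q y, - y)))"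
      proof (cases "\<beta> = - 1")
        case True
        have "coeff q i = 0" if "\<alpha> = 1" "even i" for i
          using par[OF True, of i] that by simp
        moreover have "coeff q i = 0" if "\<alpha> = - 1" "odd i" for i
          using par[OF True, of i] that by simp
        ultimately show ?thesis using \<alpha> True by (auto simp: e'_def el_def)
      next
        case False
        then show ?thesis using cases q(3) by (auto simp: e'_def el_def)
      qed
    qed (use q in auto)
    ultimately show ?thesis using eq by blast
  qed
  then show ?thesis using lc e(3) by blast
qed

subsection \<open>Existence of the normal forms\<close>

lemma letter_normal_henon: "normal_henon h \<Longrightarrow> letter h"
  by (elim normal_henonE) (simp add: letterI)

lemma henon_normal_henon: "normal_henon h \<Longrightarrow> henon h"
  unfolding normal_henon_def henon_def by blast

lemma letters_normal_henon: "normal_henons hs \<Longrightarrow> letters hs"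
  by (simp add: letters_def letter_normal_henon)

lemma inv_word_rev:
  assumes "letters hs" shows "inv (word_map (rev hs)) = word_map (map inv hs)"
  using inv_word_map[of "rev hs"] assms by (simp add: letters_def poly_autD(1) poly_aut_letter)

lemma form_core:
  assumes "letters hs"
  shows "form_aa hs = core (word_map (rev hs)) tswap tswap"
    and "form_ea hs e = core (word_map (rev hs)) e tswap"
    and "conj_in_G (core (word_map (rev hs)) e (tswap \<circ> e0 \<circ> tswap)) (form_ee hs e e0)"
proof -
  show "form_aa hs = core (word_map (rev hs)) tswap tswap" "form_ea hs e = core (word_map (rev hs)) e tswap"
    by (simp_all only: form_aa_def form_ea_def core_def inv_word_rev[OF assms])
  have "core (word_map (rev hs)) e (tswap \<circ> e0 \<circ> tswap) \<circ> tswap = tswap \<circ> form_ee hs e e0"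
    by (simp add: form_ee_def core_def inv_word_rev[OF assms] fun_eq_iff del: split_paired_All)
  then show "conj_in_G (core (word_map (rev hs)) e (tswap \<circ> e0 \<circ> tswap)) (form_ee hs e e0)"
    by (rule conj_in_GI[OF poly_aut_tswap])
qed

lemma dg_tswap: "dg a c a c \<circ> tswap = tswap \<circ> dg a c a c" "tswap \<circ> dg a c b d = dg b d a c \<circ> tswap"
  by (simp_all add: fun_eq_iff)

text \<open>A diagonal map acting alike on both coordinates commutes with the swap. At the right end
  this is a choice; at the left end it requires \<open>\<mu> * b ^ m = \<nu> * b ^ n\<close>,
  solvable since \<open>m < n\<close>.\<close>

lemma exists_form_aa:
  assumes ks: "letters ks" "ks \<noteq> []"
  shows "\<exists>hs. normal_henons hs \<and> conj_in_G (core (word_map ks) tswap tswap) (form_aa hs)"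
proof -
  obtain \<gamma> \<xi> \<mu> \<nu> m n where N: "normalises \<gamma> \<xi> \<mu> \<nu> m n ks"
    using normalise_word[OF ks] by (elim exE)
  then have nz: "\<mu> \<noteq> 0" "\<nu> \<noteq> 0" "m < n" by (simp_all add: normalises_def)
  obtain b where b: "b \<noteq> 0" "\<mu> * b ^ m = \<nu> * b ^ n" using balance_powers[OF nz] by blast
  have "\<exists>hs. normal_henons hs \<and>
      dg (\<mu> * b ^ m) (\<xi> * b ^ m) (\<nu> * b ^ n) (\<xi> * b ^ m) \<circ> word_map ks = word_map hs \<circ> dg b (b * \<gamma>) b (b * \<gamma>)"
    using N b(1) by (simp only: normalises_def simp_thms)
  then obtain hs where hs: "normal_henons hs"
    "dg (\<mu> * b ^ m) (\<xi> * b ^ m) (\<mu> * b ^ m) (\<xi> * b ^ m) \<circ> word_map ks = word_map hs \<circ> dg b (b * \<gamma>) b (b * \<gamma>)"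
    unfolding b(2)[symmetric] by (elim exE conjE)
  have ls: "letters hs" by (rule letters_normal_henon[OF hs(1)])
  have "conj_in_G (core (word_map ks) tswap tswap) (core (word_map hs) tswap tswap)"
    by (rule core_intertwine[OF poly_aut_letters[OF ks(1)] poly_aut_letters[OF ls] poly_aut_dg(1)[OF b(1) b(1)] hs(2)
          dg_tswap(1) dg_tswap(1)])
  moreover have "form_aa (rev hs) = core (word_map hs) tswap tswap"
    using form_core(1)[of "rev hs"] ls by simp
  ultimately show ?thesis using hs(1) by (intro exI[of _ "rev hs"] conjI) simp_all
qed

text \<open>The right end must commute with the swap and the left end must make the involution
  monic, which is an equation between \<open>b ^ m\<close> and \<open>b ^ (n * l)\<close>. For the
  empty word one map serves both ends, and the powers are \<open>b\<close> and
  \<open>b ^ l\<close>.\<close>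

lemma exists_form_ea:
  assumes ks: "letters ks" and e: "elem2_involution e"
  shows "\<exists>hs e1. normal_henons hs \<and> elem_involution e1 \<and> normal_elem_involution e1 \<and>
    conj_in_G (core (word_map ks) e tswap) (form_ea hs e1)"
proof -
  obtain \<delta> l r where E: "r \<noteq> 0" "2 \<le> (l::nat)" "\<And>a c b. a \<noteq> 0 \<Longrightarrow> b \<noteq> 0 \<Longrightarrow> a * r = b ^ l \<Longrightarrow>
    \<exists>e'. normal_elem_involution e' \<and> elem_involution e' \<and> dg a c b (b * \<delta>) \<circ> e = e' \<circ> dg a c b (b * \<delta>)"
    using normalise_involution[OF e] by blast
  obtain A C B b c hs where dat: "b \<noteq> 0" "A \<noteq> 0" "B \<noteq> 0" "A * r = B ^ l" "normal_henons hs"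
    "dg A C B (B * \<delta>) \<circ> word_map ks = word_map hs \<circ> dg b c b c"
  proof (cases "ks = []")
    case True
    obtain b where b: "b \<noteq> 0" "r * b ^ 1 = 1 * b ^ l"
      using balance_powers[of r 1 1 l] E(1,2) by auto
    show ?thesis
      by (rule that[of b b b "[]" "b * \<delta>" "b * \<delta>"]) (use b True in \<open>auto simp: mult.commute\<close>)
  next
    case False
    obtain \<gamma> \<xi> \<mu> \<nu> m n where N: "normalises \<gamma> \<xi> \<mu> \<nu> m n ks"
      using normalise_word[OF ks False] by (elim exE)
    then have nz: "\<mu> \<noteq> 0" "\<nu> \<noteq> 0" "m < n" by (simp_all add: normalises_def)
    have "n * 1 \<le> n * l" using E(2) by (intro mult_le_mono) auto
    then have "m < n * l" using nz(3) by linarith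
    then obtain b where b: "b \<noteq> 0" "\<mu> * r * b ^ m = \<nu> ^ l * b ^ (n * l)"
      using balance_powers[of "\<mu> * r" "\<nu> ^ l" m "n * l"] nz E(1) by auto
    have "\<exists>hs. normal_henons hs \<and>
        dg (\<mu> * b ^ m) (\<xi> * b ^ m) (\<nu> * b ^ n) (\<nu> * b ^ n * \<delta>) \<circ> word_map ks = word_map hs \<circ> dg b (b * \<gamma>) b (b * \<gamma>)"
      using N b(1) by (simp only: normalises_def simp_thms)
    then obtain hs where hs: "normal_henons hs"
      "dg (\<mu> * b ^ m) (\<xi> * b ^ m) (\<nu> * b ^ n) (\<nu> * b ^ n * \<delta>) \<circ> word_map ks = word_map hs \<circ> dg b (b * \<gamma>) b (b * \<gamma>)"
      by (elim exE conjE)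
    have "\<mu> * b ^ m * r = \<mu> * r * b ^ m" by simp
    also have "\<dots> = (\<nu> * b ^ n) ^ l" unfolding b(2) by (simp only: power_mult_distrib power_mult)
    finally have "\<mu> * b ^ m * r = (\<nu> * b ^ n) ^ l" .
    moreover have "\<mu> * b ^ m \<noteq> 0" "\<nu> * b ^ n \<noteq> 0" using nz b(1) by auto
    ultimately show ?thesis using that[OF b(1) _ _ _ hs] by blast
  qed
  obtain e1 where e1: "normal_elem_involution e1" "elem_involution e1" "dg A C B (B * \<delta>) \<circ> e = e1 \<circ> dg A C B (B * \<delta>)"
    using E(3)[OF dat(2,3,4)] by blast
  have ls: "letters hs" by (rule letters_normal_henon[OF dat(5)])
  have "conj_in_G (core (word_map ks) e tswap) (core (word_map hs) e1 tswap)"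
    by (rule core_intertwine[OF poly_aut_letters[OF ks] poly_aut_letters[OF ls] poly_aut_dg(1)[OF dat(1) dat(1)] dat(6)
          e1(3) dg_tswap(1)])
  moreover have "form_ea (rev hs) e1 = core (word_map hs) e1 tswap"
    using form_core(2)[of "rev hs"] ls by simp
  ultimately show ?thesis using dat(5) e1(1,2) by (intro exI[of _ "rev hs"] exI[of _ e1] conjI) simp_all
qed

text \<open>For nonempty words the left involution determines \<open>b\<close> and the right one
  then the free scaling \<open>a\<close>. For the empty word both conditions fall on one diagonal
  map; eliminating \<open>a\<close> leaves the powers \<open>b\<close> and
  \<open>b ^ (l * l')\<close>.\<close>

lemma exists_form_ee:
  assumes ks: "letters ks" and e: "elem2_involution e" and e': "elem2_involution e'"
  shows "\<exists>hs e1 e0. normal_henons hs \<and> elem_involution e1 \<and> normal_elem_involution e1 \<and>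
    elem_involution e0 \<and> normal_elem_involution e0 \<and>
    conj_in_G (core (word_map ks) e (tswap \<circ> e' \<circ> tswap)) (form_ee hs e1 e0)"
proof -
  obtain \<delta> l r where E: "r \<noteq> 0" "2 \<le> (l::nat)" "\<And>a c b. a \<noteq> 0 \<Longrightarrow> b \<noteq> 0 \<Longrightarrow> a * r = b ^ l \<Longrightarrow>
    \<exists>e'. normal_elem_involution e' \<and> elem_involution e' \<and> dg a c b (b * \<delta>) \<circ> e = e' \<circ> dg a c b (b * \<delta>)"
    using normalise_involution[OF e] by blast
  obtain \<delta>' l' r' where E': "r' \<noteq> 0" "2 \<le> (l'::nat)" "\<And>a c b. a \<noteq> 0 \<Longrightarrow> b \<noteq> 0 \<Longrightarrow> a * r' = b ^ l' \<Longrightarrow>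
    \<exists>e0. normal_elem_involution e0 \<and> elem_involution e0 \<and> dg a c b (b * \<delta>') \<circ> e' = e0 \<circ> dg a c b (b * \<delta>')"
    using normalise_involution[OF e'] by blast
  obtain A C B a b d hs where dat: "a \<noteq> 0" "b \<noteq> 0" "b * r' = a ^ l'" "A \<noteq> 0" "B \<noteq> 0" "A * r = B ^ l"
    "normal_henons hs"
    "dg A C B (B * \<delta>) \<circ> word_map ks = word_map hs \<circ> dg a (a * \<delta>') b d"
  proof (cases "ks = []")
    case True
    have "1 * 2 \<le> l * l'" using E(2) E'(2) by (intro mult_le_mono) auto
    then have "1 < l * l'" by simp
    then obtain b where b: "b \<noteq> 0" "r' * r ^ l' * b ^ 1 = 1 * b ^ (l * l')"
      using balance_powers[of "r' * r ^ l'" 1 1 "l * l'"] E(1) E'(1) by auto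
    show ?thesis
    proof (rule that[of "b ^ l / r" b "b ^ l / r" b "[]" "b ^ l / r * \<delta>'" "b * \<delta>"])
      show "b * r' = (b ^ l / r) ^ l'"
        using b(1) E(1) b(2)[unfolded power_mult[of b l l']] by (simp add: power_divide field_simps)
    qed (use b(1) E(1) True in auto)
  next
    case False
    obtain \<gamma> \<xi> \<mu> \<nu> m n where N: "normalises \<gamma> \<xi> \<mu> \<nu> m n ks"
      using normalise_word[OF ks False] by (elim exE)
    then have nz: "\<mu> \<noteq> 0" "\<nu> \<noteq> 0" "m < n" by (simp_all add: normalises_def)
    have "n * 1 \<le> n * l" using E(2) by (intro mult_le_mono) auto
    then have "m < n * l" using nz(3) by linarith
    then obtain b where b: "b \<noteq> 0" "\<mu> * r * b ^ m = \<nu> ^ l * b ^ (n * l)"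
      using balance_powers[of "\<mu> * r" "\<nu> ^ l" m "n * l"] nz E(1) by auto
    obtain a where a: "a \<noteq> 0" "a ^ l' = b * r'"
      using complex_root_exists[of "b * r'" l'] b(1) E'(1,2) by auto
    have "\<exists>hs. normal_henons hs \<and>
        dg (\<mu> * b ^ m) (\<xi> * b ^ m) (\<nu> * b ^ n) (\<nu> * b ^ n * \<delta>) \<circ> word_map ks = word_map hs \<circ> dg a (a * \<delta>') b (b * \<gamma>)"
      using N a(1) b(1) by (simp only: normalises_def simp_thms)
    then obtain hs where hs: "normal_henons hs"
      "dg (\<mu> * b ^ m) (\<xi> * b ^ m) (\<nu> * b ^ n) (\<nu> * b ^ n * \<delta>) \<circ> word_map ks = word_map hs \<circ> dg a (a * \<delta>') b (b * \<gamma>)"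
      by (elim exE conjE)
    have "\<mu> * b ^ m * r = \<mu> * r * b ^ m" by simp
    also have "\<dots> = (\<nu> * b ^ n) ^ l" unfolding b(2) by (simp only: power_mult_distrib power_mult)
    finally have "\<mu> * b ^ m * r = (\<nu> * b ^ n) ^ l" .
    moreover have "\<mu> * b ^ m \<noteq> 0" "\<nu> * b ^ n \<noteq> 0" using nz b(1) by auto
    ultimately show ?thesis using that[OF a(1) b(1) a(2)[symmetric] _ _ _ hs] by blast
  qed
  obtain e1 where e1: "normal_elem_involution e1" "elem_involution e1" "dg A C B (B * \<delta>) \<circ> e = e1 \<circ> dg A C B (B * \<delta>)"
    using E(3)[OF dat(4,5,6)] by blast
  obtain e0 where e0: "normal_elem_involution e0" "elem_involution e0" "dg b d a (a * \<delta>') \<circ> e' = e0 \<circ> dg b d a (a * \<delta>')"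
    using E'(3)[OF dat(2,1,3)] by blast
  have ls: "letters hs" by (rule letters_normal_henon[OF dat(7)])
  have "dg a (a * \<delta>') b d \<circ> (tswap \<circ> e' \<circ> tswap) = (tswap \<circ> e0 \<circ> tswap) \<circ> dg a (a * \<delta>') b d"
  proof -
    have "dg a (a * \<delta>') b d \<circ> (tswap \<circ> e' \<circ> tswap) = tswap \<circ> (dg b d a (a * \<delta>') \<circ> e') \<circ> tswap"
      using dg_tswap(2)[of b d a "a * \<delta>'"] by (simp only: comp_assoc[symmetric])
    also have "\<dots> = tswap \<circ> e0 \<circ> (dg b d a (a * \<delta>') \<circ> tswap)"
      by (simp only: e0(3) comp_assoc)
    also have "\<dots> = (tswap \<circ> e0 \<circ> tswap) \<circ> dg a (a * \<delta>') b d"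
      by (simp only: dg_tswap(2)[of a "a * \<delta>'" b d, symmetric] comp_assoc)
    finally show ?thesis .
  qed
  then have "conj_in_G (core (word_map ks) e (tswap \<circ> e' \<circ> tswap)) (core (word_map hs) e1 (tswap \<circ> e0 \<circ> tswap))"
    by (rule core_intertwine[OF poly_aut_letters[OF ks] poly_aut_letters[OF ls] poly_aut_dg(1)[OF dat(1,2)] dat(8) e1(3)])
  moreover have "conj_in_G (core (word_map hs) e1 (tswap \<circ> e0 \<circ> tswap)) (form_ee (rev hs) e1 e0)"
    using form_core(3)[of "rev hs"] ls by simp
  ultimately have "conj_in_G (core (word_map ks) e (tswap \<circ> e' \<circ> tswap)) (form_ee (rev hs) e1 e0)"
    by (rule conj_in_G_trans)
  then show ?thesis using dat(7) e1(1,2) e0(1,2)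
    by (intro exI[of _ "rev hs"] exI[of _ e1] exI[of _ e0] conjI) simp_all
qed

subsection \<open>The normal forms as words of normalised letters\<close>

text \<open>The inverses in the forms are not letters; conjugated by the swap they become hats, and
  the swaps between consecutive factors cancel.\<close>

definition letters_aa :: "pmap list \<Rightarrow> pmap list" where
  "letters_aa hs = map hat hs @ rev hs"

definition letters_ea :: "pmap list \<Rightarrow> pmap \<Rightarrow> pmap list" where
  "letters_ea hs e1 = map hat hs @ (tswap \<circ> e1) # rev hs"

definition letters_ee :: "pmap list \<Rightarrow> pmap \<Rightarrow> pmap \<Rightarrow> pmap list" where
  "letters_ee hs e1 e0 = letters_ea hs e1 @ [tswap \<circ> e0]"

lemma word_map_hat: "word_map (map hat hs) = tswap \<circ> word_map (map inv hs) \<circ> tswap"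
  by (induction hs) (simp_all add: hat_def fun_eq_iff del: split_paired_All)

lemma form_letters:
  "form_aa hs = tswap \<circ> word_map (letters_aa hs) \<circ> tswap"
  "form_ea hs e1 = tswap \<circ> word_map (letters_ea hs e1) \<circ> tswap"
  "form_ee hs e1 e0 = word_map (letters_ee hs e1 e0)"
  by (simp_all add: form_aa_def form_ea_def form_ee_def letters_aa_def letters_ea_def letters_ee_def
      word_map_hat fun_eq_iff del: split_paired_All)

lemma normal_letter_lm:
  "e\<^sup>2 = 1 \<Longrightarrow> a \<noteq> 0 \<Longrightarrow> 2 \<le> degree p \<Longrightarrow> coeff p (degree p - 1) = 0 \<Longrightarrow>
    lead_coeff p = 1 \<or> (lead_coeff p)\<^sup>2 = a\<^sup>2 \<Longrightarrow> normal_letter (lm e 0 a p)"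
  unfolding normal_letter_def by blast

lemma normal_letter_henon:
  assumes "normal_henon h" shows "normal_letter h" "normal_letter (hat h)"
proof -
  obtain d p where h: "d \<noteq> 0" "2 \<le> degree p" "lead_coeff p = 1" "coeff p (degree p - 1) = 0" "h = lm 1 0 d p"
    using assms by (rule normal_henonE)
  show "normal_letter h" unfolding h(5) using h by (intro normal_letter_lm) auto
  have "hat h = lm 1 0 (1/d) (smult (-1/d) p)"
    unfolding h(5) using h(1) by (subst hat_lm) simp_all
  then show "normal_letter (hat h)" using h by (auto intro!: normal_letter_lm simp: power2_eq_square)
qed

text \<open>In the two cases with a parity condition, the coefficient below the leading one has the
  wrong parity and vanishes.\<close>

lemma normal_letter_involution:
  assumes "normal_elem_involution e" shows "normal_letter (tswap \<circ> e)"
proof -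
  obtain p where p: "2 \<le> degree p" "lead_coeff p = 1"
    and cases: "(coeff p (degree p - 1) = 0 \<and> e = (\<lambda>(x, y). (- x + poly p y, y))) \<or>
      ((\<forall>i. even i \<longrightarrow> coeff p i = 0) \<and> e = (\<lambda>(x, y). (x + poly p y, - y))) \<or>
      ((\<forall>i. odd i \<longrightarrow> coeff p i = 0) \<and> e = (\<lambda>(x, y). (- x + poly p y, - y)))"
    using assms unfolding normal_elem_involution_def by blast
  have c: "coeff p (degree p - 1) = 0"
  proof -
    have "even (degree p - 1) \<longleftrightarrow> odd (degree p)" using p(1) by auto
    moreover have "coeff p (degree p) \<noteq> 0" using p(2) by simp
    ultimately show ?thesis using cases by metis
  qed
  have "tswap \<circ> e = lm 1 0 (-1) p \<or> tswap \<circ> e = lm (-1) 0 1 p \<or> tswap \<circ> e = lm (-1) 0 (-1) p"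
    using cases by (auto simp: fun_eq_iff)
  then show ?thesis using p c by (elim disjE) (auto intro!: normal_letter_lm)
qed

lemma normal_letters_forms:
  assumes "normal_henons hs"
  shows "\<forall>w\<in>set (letters_aa hs). normal_letter w"
    and "normal_elem_involution e1 \<Longrightarrow> \<forall>w\<in>set (letters_ea hs e1). normal_letter w"
    and "normal_elem_involution e1 \<Longrightarrow> normal_elem_involution e0 \<Longrightarrow> \<forall>w\<in>set (letters_ee hs e1 e0). normal_letter w"
  using assms by (auto simp: letters_aa_def letters_ea_def letters_ee_def normal_letter_henon normal_letter_involution)

section \<open>Cyclic reducedness of the forms\<close>

text \<open>Both orders occur: a word of letters starts with a swap, whereas its conjugate by the
  swap starts with an elementary factor.\<close>

lemma alternating_cyclically_reduced:
  assumes "es \<noteq> []" "\<forall>e\<in>set es. elem2 e"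
  shows "cyclically_reduced_word (concat (map (\<lambda>e. [e, tswap]) es))"
    and "cyclically_reduced_word (concat (map (\<lambda>e. [tswap, e]) es))"
proof -
  have t: "in_AE_minus_S tswap"
    using affine_tswap not_elementary_tswap by (simp add: in_AE_minus_S_def)
  have e: "in_AE_minus_S e" "diff_subgroups e tswap" "diff_subgroups tswap e" if "elem2 e" for e
    using that affine_tswap not_elementary_tswap
    by (auto simp: in_AE_minus_S_def diff_subgroups_def elem2_def)
  have "reduced_word (concat (map (\<lambda>e. [e, tswap]) es)) \<and> reduced_word (concat (map (\<lambda>e. [tswap, e]) es)) \<and>
    2 \<le> length (concat (map (\<lambda>e. [e, tswap]) es)) \<and> 2 \<le> length (concat (map (\<lambda>e. [tswap, e]) es)) \<and>
    elem2 (hd (concat (map (\<lambda>e. [e, tswap]) es))) \<and> last (concat (map (\<lambda>e. [e, tswap]) es)) = tswap \<and>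
    hd (concat (map (\<lambda>e. [tswap, e]) es)) = tswap \<and> elem2 (last (concat (map (\<lambda>e. [tswap, e]) es)))"
    using assms
  proof (induction es)
    case (Cons a es)
    then show ?case
      by (cases es) (simp_all add: reduced_word_Cons reduced_word_single t e)
  qed simp
  then show "cyclically_reduced_word (concat (map (\<lambda>e. [e, tswap]) es))"
    "cyclically_reduced_word (concat (map (\<lambda>e. [tswap, e]) es))"
    using e unfolding cyclically_reduced_word_def by simp_all
qed

lemma word_map_alternating:
  "word_map (concat (map (\<lambda>e. [e, tswap]) (map ((\<circ>) tswap) ws))) = tswap \<circ> word_map ws \<circ> tswap"
  "word_map (concat (map (\<lambda>e. [tswap, e]) (map ((\<circ>) tswap) ws))) = word_map ws"
  by (induction ws) (simp_all add: fun_eq_iff del: split_paired_All)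

text \<open>The empty word is included: it gives the identity, which is affine.\<close>

lemma cyc_reduced_letters:
  assumes "\<forall>w\<in>set ws. normal_letter w"
  shows "cyc_reduced_map (word_map ws)" "cyc_reduced_map (tswap \<circ> word_map ws \<circ> tswap)"
proof -
  have id: "affine_aut id"
    using tri_id by (simp add: tri_def)
  have e: "\<forall>e\<in>set (map ((\<circ>) tswap) ws). elem2 e"
    using assms by (auto intro: elem2_letter normal_letter_letter)
  show "cyc_reduced_map (word_map ws)"
  proof (cases "ws = []")
    case False
    then have "map ((\<circ>) tswap) ws \<noteq> []" by simp
    from alternating_cyclically_reduced(2)[OF this e] show ?thesis
      unfolding cyc_reduced_map_def using word_map_alternating(2)[of ws] by metis
  qed (simp add: cyc_reduced_map_def id)
  show "cyc_reduced_map (tswap \<circ> word_map ws \<circ> tswap)"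
  proof (cases "ws = []")
    case False
    then have "map ((\<circ>) tswap) ws \<noteq> []" by simp
    from alternating_cyclically_reduced(1)[OF this e] show ?thesis
      unfolding cyc_reduced_map_def using word_map_alternating(1)[of ws] by metis
  qed (simp add: cyc_reduced_map_def id)
qed

lemma conj_in_G_tswap: "conj_in_G g (tswap \<circ> F \<circ> tswap) \<Longrightarrow> conj_in_G g F"
  by (erule conj_in_G_trans, rule conj_in_GI[OF poly_aut_tswap])
    (simp add: fun_eq_iff del: split_paired_All)

section \<open>Finiteness of each form and assembly of the theorem\<close>

abbreviation normal_conjugates :: "pmap \<Rightarrow> pmap list set" where
  "normal_conjugates g \<equiv> {ws. (\<forall>w\<in>set ws. normal_letter w) \<and> conj_in_G g (word_map ws)}"

text \<open>The list \<open>hs\<close> is recovered from its word as the reversed second half, so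
  the set is contained in the image of the finite set of normal words.\<close>

lemma finite_form_aa:
  "finite {hs. (\<forall>h\<in>set hs. henon h \<and> normal_henon h) \<and>
     cyc_reduced_map (form_aa hs) \<and> conj_in_G g (form_aa hs)}" (is "finite ?S")
proof (rule finite_surj[OF finite_normal_conj[of g]])
  show "?S \<subseteq> (\<lambda>ws. rev (drop (length ws div 2) ws)) ` normal_conjugates g"
  proof
    fix hs assume hs: "hs \<in> ?S"
    then have "\<forall>w\<in>set (letters_aa hs). normal_letter w" by (intro normal_letters_forms) simp
    moreover have "conj_in_G g (word_map (letters_aa hs))"
      using hs conj_in_G_tswap unfolding form_letters by simp
    moreover have "hs = rev (drop (length (letters_aa hs) div 2) (letters_aa hs))"
      by (simp add: letters_aa_def)
    ultimately show "hs \<in> (\<lambda>ws. rev (drop (length ws div 2) ws)) ` normal_conjugates g"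
      by (intro image_eqI) auto
  qed
qed

lemma finite_form_ea:
  "finite {(hs, e1). (\<forall>h\<in>set hs. henon h \<and> normal_henon h) \<and>
     elem_involution e1 \<and> normal_elem_involution e1 \<and>
     cyc_reduced_map (form_ea hs e1) \<and> conj_in_G g (form_ea hs e1)}" (is "finite ?S")
proof (rule finite_surj[OF finite_normal_conj[of g]])
  \<comment> \<open>The word has odd length and its middle letter is the swap followed on the right
    by \<open>e1\<close>; a further \<open>tswap\<close> undoes the swap.\<close>
  let ?f = "\<lambda>ws. let n = length ws div 2 in (rev (drop (Suc n) ws), tswap \<circ> ws ! n)"
  show "?S \<subseteq> ?f ` normal_conjugates g"
  proof
    fix x assume "x \<in> ?S"
    then obtain hs e1 where x: "x = (hs, e1)" and h: "normal_henons hs" "normal_elem_involution e1"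
      and c: "conj_in_G g (form_ea hs e1)" by auto
    have "\<forall>w\<in>set (letters_ea hs e1). normal_letter w" by (rule normal_letters_forms(2)[OF h])
    moreover have "conj_in_G g (word_map (letters_ea hs e1))"
      using c conj_in_G_tswap unfolding form_letters by blast
    moreover have "x = ?f (letters_ea hs e1)"
      by (simp add: x letters_ea_def nth_append fun_eq_iff Let_def del: split_paired_All)
    ultimately show "x \<in> ?f ` normal_conjugates g"
      by (intro image_eqI) auto
  qed
qed

lemma finite_form_ee:
  "finite {(hs, e1, e0). (\<forall>h\<in>set hs. henon h \<and> normal_henon h) \<and>
     elem_involution e1 \<and> normal_elem_involution e1 \<and>
     elem_involution e0 \<and> normal_elem_involution e0 \<and>
     cyc_reduced_map (form_ee hs e1 e0) \<and> conj_in_G g (form_ee hs e1 e0)}" (is "finite ?S")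
proof (rule finite_surj[OF finite_normal_conj[of g]])
  let ?f = "\<lambda>ws. let n = length (butlast ws) div 2 in
    (rev (drop (Suc n) (butlast ws)), tswap \<circ> butlast ws ! n, tswap \<circ> last ws)"
  show "?S \<subseteq> ?f ` normal_conjugates g"
  proof
    fix x assume "x \<in> ?S"
    then obtain hs e1 e0 where x: "x = (hs, e1, e0)" and h: "normal_henons hs"
      "normal_elem_involution e1" "normal_elem_involution e0"
      and c: "conj_in_G g (form_ee hs e1 e0)" by auto
    have "\<forall>w\<in>set (letters_ee hs e1 e0). normal_letter w" by (rule normal_letters_forms(3)[OF h])
    moreover have "conj_in_G g (word_map (letters_ee hs e1 e0))"
      using c unfolding form_letters .
    moreover have "x = ?f (letters_ee hs e1 e0)"
    proof -
      have "butlast (letters_ee hs e1 e0) = letters_ea hs e1" "last (letters_ee hs e1 e0) = tswap \<circ> e0"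
        by (simp_all add: letters_ee_def)
      then show ?thesis
        by (simp add: x letters_ea_def nth_append fun_eq_iff Let_def del: split_paired_All)
    qed
    ultimately show "x \<in> ?f ` normal_conjugates g"
      by (intro image_eqI) auto
  qed
qed

lemma elementary_inv:
  assumes "elementary e" shows "elementary (inv e)"
proof -
  obtain a p b h where e: "a \<noteq> 0" "b \<noteq> 0" "e = el a p b h"
    using assms unfolding elementary_el by blast
  then have "1/a \<noteq> 0" "1/b \<noteq> 0" by simp_all
  then show ?thesis unfolding elementary_el e(3) el_inverse(2)[OF e(1,2)] by blast
qed

theorem theorem3p5:
  fixes g r0 r1 :: pmap and fs :: "pmap list"
  assumes "poly_aut g"
    and "reduced_word (map inv fs @ [r1] @ rev fs @ [r0])"
    and "involution r0" and "involution r1"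
    and "affine_aut r0 \<or> elementary r0" and "affine_aut r1 \<or> elementary r1"
    and "conj_in_G g (word_map (map inv fs @ [r1] @ rev fs @ [r0]))"
  shows
   "(affine_aut r0 \<and> affine_aut r1 \<longrightarrow>
       (\<exists>hs. (\<forall>h\<in>set hs. henon h \<and> normal_henon h) \<and>
          cyc_reduced_map (form_aa hs) \<and> conj_in_G g (form_aa hs))
     \<and> finite {hs. (\<forall>h\<in>set hs. henon h \<and> normal_henon h) \<and>
          cyc_reduced_map (form_aa hs) \<and> conj_in_G g (form_aa hs)})
  \<and> ((affine_aut r0 \<and> elementary r1) \<or> (elementary r0 \<and> affine_aut r1) \<longrightarrow>
       (\<exists>hs e1. (\<forall>h\<in>set hs. henon h \<and> normal_henon h) \<and>
          elem_involution e1 \<and> normal_elem_involution e1 \<and>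
          cyc_reduced_map (form_ea hs e1) \<and> conj_in_G g (form_ea hs e1))
     \<and> finite {(hs, e1). (\<forall>h\<in>set hs. henon h \<and> normal_henon h) \<and>
          elem_involution e1 \<and> normal_elem_involution e1 \<and>
          cyc_reduced_map (form_ea hs e1) \<and> conj_in_G g (form_ea hs e1)})
  \<and> (elementary r0 \<and> elementary r1 \<longrightarrow>
       (\<exists>hs e1 e0. (\<forall>h\<in>set hs. henon h \<and> normal_henon h) \<and>
          elem_involution e1 \<and> normal_elem_involution e1 \<and>
          elem_involution e0 \<and> normal_elem_involution e0 \<and>
          cyc_reduced_map (form_ee hs e1 e0) \<and> conj_in_G g (form_ee hs e1 e0))
     \<and> finite {(hs, e1, e0). (\<forall>h\<in>set hs. henon h \<and> normal_henon h) \<and>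
          elem_involution e1 \<and> normal_elem_involution e1 \<and>
          elem_involution e0 \<and> normal_elem_involution e0 \<and>
          cyc_reduced_map (form_ee hs e1 e0) \<and> conj_in_G g (form_ee hs e1 e0)})"
proof -
  let ?us = "rev fs"
  have redR: "reduced_word ([r1] @ ?us @ [r0])" and redL: "reduced_word (map inv fs @ [r1])"
    using reduced_word_appendD(2)[OF assms(2)]
      reduced_word_appendD(1)[of "map inv fs @ [r1]" "?us @ [r0]"] assms(2) by simp_all
  have redU: "reduced_word (?us @ [r0])" using reduced_word_appendD(2)[OF redR] by simp
  have ae: "in_AE_minus_S r0" "in_AE_minus_S r1" "\<And>u. u \<in> set ?us \<Longrightarrow> in_AE_minus_S u"
    using redR by (auto simp: reduced_word_def)
  have r1_us: "diff_subgroups r1 (hd (?us @ [r0]))"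
    using reduced_word_appendD(3)[OF redR] by simp
  have us_r0: "diff_subgroups (last ?us) r0" if "fs \<noteq> []"
    using reduced_word_appendD(3)[OF redU] that by simp
  have pus: "poly_aut u" if "u \<in> set ?us" for u
    using reduced_word_poly_aut[OF redU] that by simp
  define W where "W = word_map ?us"
  have pW: "poly_aut W" unfolding W_def using pus by (rule poly_aut_word_map)
  have invW: "inv W = word_map (map inv fs)"
    using inv_word_map[of ?us] pus poly_autD(1) unfolding W_def by auto
  have conj: "conj_in_G g (core W r1 r0)"
    using assms(7) by (simp add: core_def invW[unfolded W_def] W_def comp_assoc)
  have e2: "elem2_involution r" if "elementary r" "in_AE_minus_S r" "involution r" for r
    using that by (auto simp: elem2_involution_def elem2_def in_AE_minus_S_def)
  have hd_us: "hd ?us \<in> set ?us" "hd (?us @ [r0]) = hd ?us" if "fs \<noteq> []"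
    using that hd_in_set[of ?us] by (simp_all add: hd_append)

  have aa: "\<exists>hs. (\<forall>h\<in>set hs. henon h \<and> normal_henon h) \<and> cyc_reduced_map (form_aa hs) \<and> conj_in_G g (form_aa hs)"
    if r: "affine_aut r0" "affine_aut r1"
  proof -
    \<comment> \<open>Without any \<open>fs\<close> the two affine involutions would be adjacent in
      a reduced word.\<close>
    have ne: "fs \<noteq> []" using r1_us r by (auto simp: diff_subgroups_def)
    have "elementary (hd ?us)"
      using r1_us hd_us[OF ne] r(2) ae(3) by (auto simp: diff_subgroups_def in_AE_minus_S_def)
    moreover have "\<not> elementary r1" using ae(2) r(2) by (auto simp: in_AE_minus_S_def)
    ultimately obtain ks where ks: "letters ks" "ks \<noteq> []" "conj_in_G (core W r1 r0) (core (word_map ks) tswap tswap)"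
      unfolding W_def using core_aa[OF redU _ _ r(1) assms(3) r(2) _ assms(4)] ne by auto
    obtain hs where hs: "normal_henons hs" "conj_in_G (core (word_map ks) tswap tswap) (form_aa hs)"
      using exists_form_aa[OF ks(1,2)] by blast
    have "conj_in_G g (form_aa hs)"
      using conj ks(3) hs(2) conj_in_G_trans by blast
    moreover have "cyc_reduced_map (form_aa hs)"
      unfolding form_letters by (rule cyc_reduced_letters(2)[OF normal_letters_forms(1)[OF hs(1)]])
    ultimately show ?thesis using hs(1) henon_normal_henon by blast
  qed

  have ea: "\<exists>hs e1. (\<forall>h\<in>set hs. henon h \<and> normal_henon h) \<and> elem_involution e1 \<and> normal_elem_involution e1 \<and>
      cyc_reduced_map (form_ea hs e1) \<and> conj_in_G g (form_ea hs e1)"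
    if r: "(affine_aut r0 \<and> elementary r1) \<or> (elementary r0 \<and> affine_aut r1)"
  proof -
    obtain ks e where ks: "letters ks" "elem2_involution e" "conj_in_G g (core (word_map ks) e tswap)"
      using r
    proof
      assume r: "affine_aut r0 \<and> elementary r1"
      have "affine_aut (hd ?us)" if "?us \<noteq> []"
        using r1_us hd_us that r ae(3)[OF hd_us(1)] by (auto simp: diff_subgroups_def in_AE_minus_S_def)
      then obtain ks e where "letters ks" "elem2_involution e" "conj_in_G (core W r1 r0) (core (word_map ks) e tswap)"
        unfolding W_def using core_ea[OF redU _ _ assms(3) e2[OF _ ae(2) assms(4)]] r by blast
      then show ?thesis using that conj conj_in_G_trans by blast
    next
      assume r: "elementary r0 \<and> affine_aut r1"
      \<comment> \<open>After \<open>core_swap\<close> the word is read from its other end and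
        starts with the inverse of \<open>hd fs\<close>. As the neighbour of the elementary
        \<open>r0\<close>, \<open>hd fs\<close> is not elementary; neither is its inverse, which
        must therefore be affine.\<close>
      have hd: "affine_aut (hd (map inv fs))" if "map inv fs \<noteq> []"
      proof -
        have ne: "fs \<noteq> []" using that by simp
        have "\<not> elementary (hd fs)"
          using us_r0[OF ne] r ne by (auto simp: diff_subgroups_def last_rev)
        moreover have "inv (inv (hd fs)) = hd fs"
          using pus[of "hd fs"] ne by (simp add: inv_inv_eq poly_autD(1))
        ultimately have "\<not> elementary (inv (hd fs))" using elementary_inv by metis
        moreover have "in_AE_minus_S (hd (map inv fs))"
          using redL ne by (auto simp: reduced_word_def hd_map)
        ultimately show ?thesis using ne by (auto simp: in_AE_minus_S_def hd_map)
      qed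
      obtain ks e where "letters ks" "elem2_involution e" "conj_in_G (core (inv W) r0 r1) (core (word_map ks) e tswap)"
        unfolding invW using core_ea[OF redL hd _ assms(4) e2[OF _ ae(1) assms(3)]] r by blast
      moreover have "poly_aut r1" using reduced_word_poly_aut[OF redL] by simp
      ultimately show ?thesis
        using that conj core_swap[OF pW _ assms(4), of r0] conj_in_G_trans by blast
    qed
    obtain hs e1 where hs: "normal_henons hs" "elem_involution e1" "normal_elem_involution e1"
      "conj_in_G (core (word_map ks) e tswap) (form_ea hs e1)"
      using exists_form_ea[OF ks(1,2)] by blast
    have "conj_in_G g (form_ea hs e1)" using ks(3) hs(4) by (rule conj_in_G_trans)
    moreover have "cyc_reduced_map (form_ea hs e1)"
      unfolding form_letters by (rule cyc_reduced_letters(2)[OF normal_letters_forms(2)[OF hs(1,3)]])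
    ultimately show ?thesis using hs henon_normal_henon by blast
  qed

  have ee: "\<exists>hs e1 e0. (\<forall>h\<in>set hs. henon h \<and> normal_henon h) \<and> elem_involution e1 \<and> normal_elem_involution e1 \<and>
      elem_involution e0 \<and> normal_elem_involution e0 \<and>
      cyc_reduced_map (form_ee hs e1 e0) \<and> conj_in_G g (form_ee hs e1 e0)"
    if r: "elementary r0" "elementary r1"
  proof -
    have ne: "fs \<noteq> []" using r1_us r by (auto simp: diff_subgroups_def)
    have "affine_aut (hd ?us)"
      using r1_us hd_us[OF ne] r(2) ae(3) by (auto simp: diff_subgroups_def in_AE_minus_S_def)
    then obtain ks e e' where ks: "letters ks" "elem2_involution e" "elem2_involution e'"
      "conj_in_G (core W r1 r0) (core (word_map ks) e (tswap \<circ> e' \<circ> tswap))"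
      unfolding W_def using core_ee[OF redU _ _ e2[OF r(1) ae(1) assms(3)] e2[OF r(2) ae(2) assms(4)]] ne by auto
    obtain hs e1 e0 where hs: "normal_henons hs" "elem_involution e1" "normal_elem_involution e1"
      "elem_involution e0" "normal_elem_involution e0"
      "conj_in_G (core (word_map ks) e (tswap \<circ> e' \<circ> tswap)) (form_ee hs e1 e0)"
      using exists_form_ee[OF ks(1-3)] by blast
    have "conj_in_G g (form_ee hs e1 e0)"
      using conj ks(4) hs(6) conj_in_G_trans by blast
    moreover have "cyc_reduced_map (form_ee hs e1 e0)"
      unfolding form_letters by (rule cyc_reduced_letters(1)[OF normal_letters_forms(3)[OF hs(1,3,5)]])
    ultimately show ?thesis using hs henon_normal_henon by blast
  qed

  show ?thesis
    using aa ea ee finite_form_aa[of g] finite_form_ea[of g] finite_form_ee[of g] by (intro conjI impI) simp_all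
qed

end
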